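(* Assume the setting, notation and assumptions (O1)-(O3), (K1)-(K2), (P1)-(P3) described in the context. Then for each $t\in\{0,\dots,T-1\}$: (a) there is a continuous and unique optimizer $\theta^*_{t+1}(x_{1:t},y_{1:t}):(\mathcal X_{1:t}\times\mathcal Y_{1:t},d)\to(\Theta_{t+1},d_{\Theta_{t+1}})$ for the extended dynamic programming equation $$V_t(x_{1:t},y_{1:t})=\inf_{\theta_{t+1}\in D_t(x_{1:t},y_{1:t})}f_t(x_{1:t},y_{1:t},\theta_{t+1});\qquad(\mathrm{DP})$$ (b) the equilibrium parametric kernel $$\gamma(dx_{t+1:T},dy_{t+1:T}\mid\theta^*_{t+1:T}(x_{1:t},y_{1:t}))=\prod_{s=t}^{T-1}\gamma(dx_{s+1},dy_{s+1}\mid\theta^*_{s+1}(x_{1:s},y_{1:s})),$$ as a map $(\mathcal X_{1:t}\times\mathcal Y_{1:t},d)\to\mathcal P_p(\mathcal X_{t+1:T}\times\mathcal Y_{t+1:T})$, is continuous and unique; (c) the corresponding value function $V_t$ satisfies (DP) and $V_t\in C_p(\mathcal X_{1:t}\times\mathcal Y_{1:t})$.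
   Context: **Spaces and metrics.** $T\ge1$ is the number of periods, $p\in[1,\infty)$ is fixed. For $t\in\{1,\dots,T\}$, $\mathcal X_t,\mathcal Y_t$ are closed subsets of $\mathbb R^d$ with the Euclidean topology; $\mathcal X_0,\mathcal Y_0$ are singletons (fixed initial state). $\mathcal X_{s:t}=\mathcal X_s\times\dots\times\mathcal X_t$, $\mathcal X=\mathcal X_{1:T}$, $x_{s:t}=(x_s,\dots,x_t)$, similarly for $\mathcal Y$. Metrics: $d_{\mathcal X}(x_{1:t},x'_{1:t})=[\sum_{s=1}^t|x_s-x'_s|^p]^{1/p}$, $d_{\mathcal Y}$ likewise, and $d((x,y),(\bar x,\bar y))=[d_{\mathcal X}(x,\bar x)^p+d_{\mathcal Y}(y,\bar y)^p]^{1/p}$, with analogous definitions for subsets of coordinates. Reference points $\bar x\in\mathcal X$, $\bar y\in\mathcal Y$ are fixed. For a Polish metric space $(\mathcal S,d_{\mathcal S})$ with reference point $\bar s$, $\mathcal P_p(\mathcal S)$ is the set of Borel probability measures with $\int d_{\mathcal S}(s,\bar s)^p\,d\mu<\infty$, equipped with the $p$-Wasserstein distance $W_p$, and $C_p(\mathcal S)$ is the set of continuous $f:\mathcal S\to\mathbb R$ with $|f(s)|\le C(1+d_{\mathcal S}(s,\bar s)^p)$ for some constant $C>0$. $C$ denotes a generic constant. $\Pi(\alpha,\beta)$ is the set of couplings of $\alpha,\beta$. **Measures.** $\mu$ and $\nu$ are Borel probability measures on $\mathcal X$ and $\mathcal Y$, with regular conditional kernels $\mu(dx_{t+1:T}\mid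 x_{1:t})$, $\nu(dy_{t+1:T}\mid y_{1:t})$ (and $\mu(dx_{t+1}\mid x_{1:t})$, $\nu(dy_{t+1}\mid y_{1:t})$); for $t=0$ these are the unconditional laws. **Parametric couplings.** For $t\in\{0,\dots,T-1\}$, $\Theta_{t+1}$ is a Polish topological vector space with complete compatible metric $d_{\Theta_{t+1}}$, and $\theta_{t+1}\mapsto\gamma(dx_{t+1},dy_{t+1}\mid\theta_{t+1})$ is a map from $\Theta_{t+1}$ to $\mathcal P_p(\mathcal X_{t+1}\times\mathcal Y_{t+1})$. The correspondence $D_t$ sends $(x_{1:t},y_{1:t})$ to $$D_t(x_{1:t},y_{1:t})=\{\theta_{t+1}\in\Theta_{t+1}:\gamma(dx_{t+1},dy_{t+1}\mid\theta_{t+1})\in\Pi(\mu(dx_{t+1}\mid x_{1:t}),\nu(dy_{t+1}\mid y_{1:t}))\}.$$ **Objective.** The cost functional at time $t$ is $$J(x_{1:t},y_{1:t};\theta_{t+1:T})=\int c(x_t,y_t,x_{1:T},y_{1:T})\,\gamma(dx_{t+1:T},dy_{t+1:T}\mid\theta_{t+1:T})+G\Big(x_t,y_t,\int h(x_{1:T},y_{1:T})\,\gamma(dx_{t+1:T},dy_{t+1:T}\mid\theta_{t+1:T})\Big),$$ where $\gamma(dx_{t+1:T},dy_{t+1:T}\mid\theta_{t+1:T})=\prod_{s=t}^{T-1}\gamma(dx_{s+1},dy_{s+1}\mid\theta_{s+1})$. **Recursion.** $V_T(x_{1:T},y_{1:T})=c(x_T,y_T,x_{1:T},y_{1:T})+G(x_T,y_T,h(x_{1:T},y_{1:T}))$.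 Backward in $t=T-1,\dots,0$, with $\theta^*_{s+1}(x_{1:s},y_{1:s})$ an optimizer of (DP) at time $s$ for $s>t$, set $$g_{t+1}(x_{1:t+1},y_{1:t+1})=\int h(x_{1:T},y_{1:T})\,\gamma(dx_{t+2:T},dy_{t+2:T}\mid\theta^*_{t+2:T}(x_{1:t+1},y_{1:t+1})),$$ $$b_{t+1}(w,v,x_{1:t+1},y_{1:t+1})=\int c(w,v,x_{1:T},y_{1:T})\,\gamma(dx_{t+2:T},dy_{t+2:T}\mid\theta^*_{t+2:T}(x_{1:t+1},y_{1:t+1})),$$ (with $g_T=h$, $b_T=c$), where $\gamma(dx_{t+2:T},dy_{t+2:T}\mid\theta^*_{t+2:T}(x_{1:t+1},y_{1:t+1}))=\prod_{s=t+1}^{T-1}\gamma(dx_{s+1},dy_{s+1}\mid\theta^*_{s+1}(x_{1:s},y_{1:s}))$, and $$f_t(x_{1:t},y_{1:t},\theta_{t+1})=G\Big(x_t,y_t,\int g_{t+1}(x_{1:t+1},y_{1:t+1})\,\gamma(dx_{t+1},dy_{t+1}\mid\theta_{t+1})\Big)+\int b_{t+1}(x_t,y_t,x_{1:t+1},y_{1:t+1})\,\gamma(dx_{t+1},dy_{t+1}\mid\theta_{t+1}).$$ The concatenation of the kernels $\gamma(\cdot\mid\theta^*_{s+1}(x_{1:s},y_{1:s}))$ built from optimizers of (DP) is the equilibrium parametric kernel: at each time $t$, if the kernels at later times are the starred ones, then $\theta^*_{t+1}(x_{1:t},y_{1:t})$ minimizes the time-$t$ cost functional over $D_t(x_{1:t},y_{1:t})$.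 **Assumptions on the objective.** (O1) For each $t\in\{0,\dots,T\}$, $(x_{1:T},y_{1:T})\mapsto c(x_t,y_t,x_{1:T},y_{1:T})$ is in $C_p(\mathcal X_{1:T}\times\mathcal Y_{1:T})$. (O2) $h$ is continuous and $|h(x_{1:T},y_{1:T})|\le C(1+d((x_{1:T},y_{1:T}),(\bar x_{1:T},\bar y_{1:T}))^{1/r})$ for some constant $r>0$ with $1/r\le p$. (O3) For each $t\in\{0,\dots,T\}$, $G:\mathcal X_t\times\mathcal Y_t\times\mathbb R\to\mathbb R$ is continuous and $|G(x_t,y_t,g)|\le C[1+|g|^{pr}+d((x_t,y_t),(\bar x_t,\bar y_t))^p]$. **Assumptions on the measures.** (K1) For each $t\in\{0,\dots,T-1\}$, $x_{1:t}\mapsto\mu(dx_{t+1}\mid x_{1:t})$ is continuous from $(\mathcal X_{1:t},d_{\mathcal X})$ to $(\mathcal P_p(\mathcal X_{t+1}),W_p)$. (K2) For each $t\in\{0,\dots,T-1\}$ and $a\in\{1/r,p\}$ (same $r$ as in (O2)), $\int_{\mathcal X_{t+1:T}}d_{\mathcal X}(x_{1:T},\bar x_{1:T})^a\mu(dx_{t+1:T}\mid x_{1:t})\le C[1+d_{\mathcal X}(x_{1:t},\bar x_{1:t})^a]$. The same assumptions hold for $\nu$ with $d_{\mathcal Y}$. **Assumptions on the parametrization.** For each $t\in\{0,\dots,T-1\}$: (P1) $\theta_{t+1}\mapsto\gamma(dx_{t+1},dy_{t+1}\mid\theta_{t+1})$ is continuous from $(\Theta_{t+1},d_{\Theta_{t+1}})$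 to $\mathcal P_p(\mathcal X_{t+1}\times\mathcal Y_{t+1})$; (P2) $D_t$ is a continuous (i.e. upper and lower hemicontinuous) correspondence and each $D_t(x_{1:t},y_{1:t})$ is non-empty, convex and compact; (P3) for every $(x_{1:t},y_{1:t})\in\mathcal X_{1:t}\times\mathcal Y_{1:t}$, $\theta_{t+1}\mapsto f_t(x_{1:t},y_{1:t},\theta_{t+1})$ is strictly quasiconvex on $\Theta_{t+1}$, i.e. $f_t(\cdot,\lambda\theta+(1-\lambda)\theta')<\max\{f_t(\cdot,\theta),f_t(\cdot,\theta')\}$ for all $\theta\ne\theta'$, $\lambda\in(0,1)$. A correspondence $\varphi$ from $X$ to subsets of $Y$ is upper hemicontinuous at $x$ if for every neighborhood $U$ of $\varphi(x)$ there is a neighborhood $V$ of $x$ with $\varphi(z)\subset U$ for $z\in V$; lower hemicontinuous at $x$ if for every open $U$ with $\varphi(x)\cap U\ne\emptyset$ there is a neighborhood $V$ of $x$ with $\varphi(z)\cap U\neq\emptyset$ for $z\in V$. *)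

theory Defs
  imports "HOL-Probability.Probability"
begin

section \<open>Metrics, Wasserstein spaces and function classes\<close>

text \<open>
  The metric spaces below are given by a carrier and a distance function.  The product metric has
  the form \<open>(d\<^sub>1\<^sup>p + d\<^sub>2\<^sup>p)\<^sup>1\<^sup>/\<^sup>p\<close>; a tuple \<open>x\<^sub>s\<^sub>:\<^sub>t\<close> is an extensional function on \<open>{s..t}\<close>, so the tuple
  \<open>x\<^sub>1\<^sub>:\<^sub>0\<close> is the unique element \<open>\<lambda>_. undefined\<close> of the empty product.
\<close>

type_synonym 'd path = "nat \<Rightarrow> real ^ 'd"

definition path_dist :: "real \<Rightarrow> nat set \<Rightarrow> ('d::finite) path \<Rightarrow> 'd path \<Rightarrow> real" where
  "path_dist p I x x' = (\<Sum>s\<in>I. norm (x s - x' s) powr p) powr (1 / p)"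

definition pair_dist ::
  "real \<Rightarrow> ('a \<Rightarrow> 'a \<Rightarrow> real) \<Rightarrow> ('b \<Rightarrow> 'b \<Rightarrow> real) \<Rightarrow> 'a \<times> 'b \<Rightarrow> 'a \<times> 'b \<Rightarrow> real" where
  "pair_dist p d1 d2 z z' =
     (d1 (fst z) (fst z') powr p + d2 (snd z) (snd z') powr p) powr (1 / p)"

definition cont_map ::
  "'a set \<Rightarrow> ('a \<Rightarrow> 'a \<Rightarrow> real) \<Rightarrow> 'b set \<Rightarrow> ('b \<Rightarrow> 'b \<Rightarrow> real) \<Rightarrow> ('a \<Rightarrow> 'b) \<Rightarrow> bool" where
  "cont_map A d B d' f \<longleftrightarrow>
     f \<in> A \<rightarrow> B \<and>
     (\<forall>a\<in>A. \<forall>\<epsilon>>0. \<exists>\<delta>>0. \<forall>a'\<in>A. d a a' < \<delta> \<longrightarrow> d' (f a) (f a') < \<epsilon>)"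

text \<open>The class \<open>C\<^sub>p\<close> of continuous functions of growth at most \<open>p\<close>, relative to the reference point
  \<open>a\<^sub>0\<close>.\<close>

definition C_growth ::
  "real \<Rightarrow> 'a set \<Rightarrow> ('a \<Rightarrow> 'a \<Rightarrow> real) \<Rightarrow> 'a \<Rightarrow> ('a \<Rightarrow> real) \<Rightarrow> bool" where
  "C_growth p A d a0 f \<longleftrightarrow>
     cont_map A d UNIV dist f \<and> (\<exists>C>0. \<forall>a\<in>A. \<bar>f a\<bar> \<le> C * (1 + d a a0 powr p))"

text \<open>\<open>\<P>\<^sub>p\<close>; the measure \<open>M\<close> only supplies the carrier and its Borel sets.\<close>

definition P_moment ::
  "real \<Rightarrow> 'a measure \<Rightarrow> ('a \<Rightarrow> 'a \<Rightarrow> real) \<Rightarrow> 'a \<Rightarrow> 'a measure set" where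
  "P_moment p M d a0 =
     {\<alpha>. sets \<alpha> = sets M \<and> prob_space \<alpha> \<and> (\<integral>\<^sup>+a. ennreal (d a a0 powr p) \<partial>\<alpha>) < \<infinity>}"

definition couplings :: "'a measure \<Rightarrow> 'b measure \<Rightarrow> ('a \<times> 'b) measure set" where
  "couplings \<alpha> \<beta> =
     {\<pi>. sets \<pi> = sets (\<alpha> \<Otimes>\<^sub>M \<beta>) \<and> distr \<pi> \<alpha> fst = \<alpha> \<and> distr \<pi> \<beta> snd = \<beta>}"

text \<open>The infimum is finite for measures in \<open>\<P>\<^sub>p\<close>, the only ones to which \<open>W\<^sub>p\<close> is applied.\<close>

definition wasserstein ::
  "real \<Rightarrow> ('a \<Rightarrow> 'a \<Rightarrow> real) \<Rightarrow> 'a measure \<Rightarrow> 'a measure \<Rightarrow> real" where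
  "wasserstein p d \<alpha> \<beta> =
     enn2real (INF \<pi>\<in>couplings \<alpha> \<beta>. \<integral>\<^sup>+z. ennreal (d (fst z) (snd z) powr p) \<partial>\<pi>) powr (1 / p)"

section \<open>Polish vector spaces, correspondences and quasiconvexity\<close>

text \<open>The parameter spaces \<open>\<Theta>\<^sub>1, \<dots>, \<Theta>\<^sub>T\<close> may be different spaces.  They are represented as linear
  subspaces of one ambient real vector space (such as their direct sum), each with a metric of its
  own; the ambient space carries no topology.\<close>

definition polish_tvs :: "('b::real_vector) set \<Rightarrow> ('b \<Rightarrow> 'b \<Rightarrow> real) \<Rightarrow> bool" where
  "polish_tvs V d \<longleftrightarrow>
     subspace V \<and> Metric_space V d \<and> Metric_space.mcomplete V d \<and>
     separable_space (Metric_space.mtopology V d) \<and>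
     continuous_map
       (prod_topology (Metric_space.mtopology V d) (Metric_space.mtopology V d))
       (Metric_space.mtopology V d) (\<lambda>(u, v). u + v) \<and>
     continuous_map
       (prod_topology euclideanreal (Metric_space.mtopology V d))
       (Metric_space.mtopology V d) (\<lambda>(a, v). a *\<^sub>R v)"

definition upper_hemicontinuous ::
  "'a set \<Rightarrow> ('a \<Rightarrow> 'a \<Rightarrow> real) \<Rightarrow> 'b topology \<Rightarrow> ('a \<Rightarrow> 'b set) \<Rightarrow> bool" where
  "upper_hemicontinuous A d \<tau> \<phi> \<longleftrightarrow>
     (\<forall>a\<in>A. \<forall>U. openin \<tau> U \<and> \<phi> a \<subseteq> U \<longrightarrow>
        (\<exists>\<delta>>0. \<forall>z\<in>A. d a z < \<delta> \<longrightarrow> \<phi> z \<subseteq> U))"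

definition lower_hemicontinuous ::
  "'a set \<Rightarrow> ('a \<Rightarrow> 'a \<Rightarrow> real) \<Rightarrow> 'b topology \<Rightarrow> ('a \<Rightarrow> 'b set) \<Rightarrow> bool" where
  "lower_hemicontinuous A d \<tau> \<phi> \<longleftrightarrow>
     (\<forall>a\<in>A. \<forall>U. openin \<tau> U \<and> \<phi> a \<inter> U \<noteq> {} \<longrightarrow>
        (\<exists>\<delta>>0. \<forall>z\<in>A. d a z < \<delta> \<longrightarrow> \<phi> z \<inter> U \<noteq> {}))"

definition strictly_quasiconvex :: "('b::real_vector) set \<Rightarrow> ('b \<Rightarrow> real) \<Rightarrow> bool" where
  "strictly_quasiconvex V f \<longleftrightarrow>
     (\<forall>u\<in>V. \<forall>v\<in>V. \<forall>l. u \<noteq> v \<and> 0 < l \<and> l < 1 \<longrightarrow>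
        f (l *\<^sub>R u + (1 - l) *\<^sub>R v) < max (f u) (f v))"

section \<open>The data of the problem\<close>

text \<open>
  \<open>horizon\<close> is \<open>T\<close>, \<open>pexp\<close> is \<open>p\<close> and \<open>rexp\<close> is \<open>r\<close>; \<open>Xs t\<close> and \<open>Ys t\<close> are the state spaces at time \<open>t\<close>,
  and \<open>xref\<close>, \<open>yref\<close> the reference points.  \<open>muk t x\<close> is the kernel \<open>\<mu>(dx\<^sub>t\<^sub>+\<^sub>1 | x\<^sub>1\<^sub>:\<^sub>t)\<close>,
  likewise \<open>nuk\<close>.  The fields \<open>Theta\<close>, \<open>dTheta\<close> and \<open>gam\<close> are indexed by \<open>t + 1\<close>, as are
  \<open>\<Theta>\<^sub>t\<^sub>+\<^sub>1\<close> and \<open>\<gamma>(dx\<^sub>t\<^sub>+\<^sub>1, dy\<^sub>t\<^sub>+\<^sub>1 | \<theta>\<^sub>t\<^sub>+\<^sub>1)\<close>.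
\<close>

record ('d, 'b) problem =
  horizon :: nat
  pexp :: real
  rexp :: real
  Xs :: "nat \<Rightarrow> (real ^ 'd) set"
  Ys :: "nat \<Rightarrow> (real ^ 'd) set"
  xref :: "nat \<Rightarrow> real ^ 'd"
  yref :: "nat \<Rightarrow> real ^ 'd"
  mu :: "(nat \<Rightarrow> real ^ 'd) measure"
  nu :: "(nat \<Rightarrow> real ^ 'd) measure"
  muk :: "nat \<Rightarrow> (nat \<Rightarrow> real ^ 'd) \<Rightarrow> (real ^ 'd) measure"
  nuk :: "nat \<Rightarrow> (nat \<Rightarrow> real ^ 'd) \<Rightarrow> (real ^ 'd) measure"
  Theta :: "nat \<Rightarrow> 'b set"
  dTheta :: "nat \<Rightarrow> 'b \<Rightarrow> 'b \<Rightarrow> real"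
  gam :: "nat \<Rightarrow> 'b \<Rightarrow> ((real ^ 'd) \<times> (real ^ 'd)) measure"
  cost :: "real ^ 'd \<Rightarrow> real ^ 'd \<Rightarrow> (nat \<Rightarrow> real ^ 'd) \<Rightarrow> (nat \<Rightarrow> real ^ 'd) \<Rightarrow> real"
  hfun :: "(nat \<Rightarrow> real ^ 'd) \<Rightarrow> (nat \<Rightarrow> real ^ 'd) \<Rightarrow> real"
  Gfun :: "real ^ 'd \<Rightarrow> real ^ 'd \<Rightarrow> real \<Rightarrow> real"

text \<open>Borel spaces \<open>\<X>\<^sub>t\<close> and \<open>\<X>\<^sub>s\<^sub>:\<^sub>t\<close>, for an arbitrary family \<open>Z\<close> of state spaces (\<open>Xs\<close> or \<open>Ys\<close>).\<close>

definition state_space :: "(nat \<Rightarrow> (real ^ 'd) set) \<Rightarrow> nat \<Rightarrow> (real ^ 'd::finite) measure" where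
  "state_space Z t = restrict_space borel (Z t)"

definition path_space :: "(nat \<Rightarrow> (real ^ 'd) set) \<Rightarrow> nat set \<Rightarrow> ('d::finite) path measure" where
  "path_space Z I = PiM I (state_space Z)"

text \<open>\<open>x\<^sub>t\<close> as a function of \<open>x\<^sub>1\<^sub>:\<^sub>T\<close>, where \<open>x\<^sub>0\<close> is the fixed initial state.\<close>

definition coord :: "(nat \<Rightarrow> (real ^ 'd) set) \<Rightarrow> ('d::finite) path \<Rightarrow> nat \<Rightarrow> real ^ 'd" where
  "coord Z x t = (if t = 0 then the_elem (Z 0) else x t)"

text \<open>\<open>\<kappa> t x\<close>, for \<open>t < T\<close>, is a regular conditional law of \<open>x\<^sub>t\<^sub>+\<^sub>1\<close> given \<open>x\<^sub>1\<^sub>:\<^sub>t\<close> under \<open>m\<close>; for \<open>t = 0\<close>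
  it is the law of \<open>x\<^sub>1\<close>.\<close>

definition regular_kernels ::
  "nat \<Rightarrow> (nat \<Rightarrow> (real ^ 'd) set) \<Rightarrow> ('d::finite) path measure \<Rightarrow>
   (nat \<Rightarrow> 'd path \<Rightarrow> (real ^ 'd) measure) \<Rightarrow> bool" where
  "regular_kernels T Z m \<kappa> \<longleftrightarrow>
     (\<forall>t<T.
        \<kappa> t \<in> path_space Z {1..t} \<rightarrow>\<^sub>M prob_algebra (state_space Z (Suc t)) \<and>
        (\<forall>A\<in>sets (path_space Z {1..t}). \<forall>B\<in>sets (state_space Z (Suc t)).
           emeasure m {x \<in> space m. restrict x {1..t} \<in> A \<and> x (Suc t) \<in> B} =
           (\<integral>\<^sup>+x. indicator A (restrict x {1..t}) * emeasure (\<kappa> t (restrict x {1..t})) B \<partial>m)))"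

text \<open>The kernel of \<open>x\<^sub>t\<^sub>+\<^sub>1\<^sub>:\<^sub>T\<close> given \<open>x\<^sub>1\<^sub>:\<^sub>t\<close>, for \<open>n = T - t\<close>: the composition of the one-step kernels.
  If these are regular conditional kernels of \<open>m\<close>, so is the composition.\<close>

primrec tail_kernel ::
  "nat \<Rightarrow> (nat \<Rightarrow> (real ^ 'd) set) \<Rightarrow> (nat \<Rightarrow> 'd path \<Rightarrow> (real ^ 'd) measure) \<Rightarrow>
   nat \<Rightarrow> nat \<Rightarrow> ('d::finite) path \<Rightarrow> 'd path measure" where
  "tail_kernel T Z \<kappa> 0 t x = return (path_space Z {}) (\<lambda>_. undefined)"
| "tail_kernel T Z \<kappa> (Suc n) t x =
     do {
       u \<leftarrow> \<kappa> t x;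
       x' \<leftarrow> tail_kernel T Z \<kappa> n (Suc t) (x(Suc t := u));
       return (path_space Z {Suc t..T}) (x'(Suc t := u))
     }"

text \<open>The same composition for \<open>\<gamma>(dx\<^sub>s\<^sub>+\<^sub>1, dy\<^sub>s\<^sub>+\<^sub>1 | \<theta>\<^sub>s\<^sub>+\<^sub>1(x\<^sub>1\<^sub>:\<^sub>s, y\<^sub>1\<^sub>:\<^sub>s))\<close>.  A policy \<open>\<theta>\<close> maps \<open>s + 1\<close>,
  \<open>x\<^sub>1\<^sub>:\<^sub>s\<close> and \<open>y\<^sub>1\<^sub>:\<^sub>s\<close> to a parameter in \<open>\<Theta>\<^sub>s\<^sub>+\<^sub>1\<close>; a constant policy gives \<open>\<gamma>(\<cdot> | \<theta>\<^sub>t\<^sub>+\<^sub>1\<^sub>:\<^sub>T)\<close>.\<close>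

type_synonym ('d, 'b) policy = "nat \<Rightarrow> 'd path \<Rightarrow> 'd path \<Rightarrow> 'b"

primrec joint_kernel ::
  "('d::finite, 'b) problem \<Rightarrow> ('d, 'b) policy \<Rightarrow> nat \<Rightarrow> nat \<Rightarrow> 'd path \<Rightarrow> 'd path \<Rightarrow>
   ('d path \<times> 'd path) measure" where
  "joint_kernel S \<theta> 0 t x y =
     return (path_space (Xs S) {} \<Otimes>\<^sub>M path_space (Ys S) {}) (\<lambda>_. undefined, \<lambda>_. undefined)"
| "joint_kernel S \<theta> (Suc n) t x y =
     do {
       uv \<leftarrow> gam S (Suc t) (\<theta> (Suc t) x y);
       xy' \<leftarrow> joint_kernel S \<theta> n (Suc t) (x(Suc t := fst uv)) (y(Suc t := snd uv));
       return (path_space (Xs S) {Suc t..horizon S} \<Otimes>\<^sub>M path_space (Ys S) {Suc t..horizon S})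
         ((fst xy')(Suc t := fst uv), (snd xy')(Suc t := snd uv))
     }"

definition policy_kernel ::
  "('d::finite, 'b) problem \<Rightarrow> ('d, 'b) policy \<Rightarrow> nat \<Rightarrow> 'd path \<Rightarrow> 'd path \<Rightarrow>
   ('d path \<times> 'd path) measure" where
  "policy_kernel S \<theta> t = joint_kernel S \<theta> (horizon S - t) t"

text \<open>\<open>hist S t\<close> is \<open>\<X>\<^sub>1\<^sub>:\<^sub>t \<times> \<Y>\<^sub>1\<^sub>:\<^sub>t\<close>, with metric \<open>hist_dist S t\<close> and reference point \<open>hist_ref S t\<close>.\<close>

definition hist :: "('d::finite, 'b) problem \<Rightarrow> nat \<Rightarrow> ('d path \<times> 'd path) set" where
  "hist S t = (\<Pi>\<^sub>E s\<in>{1..t}. Xs S s) \<times> (\<Pi>\<^sub>E s\<in>{1..t}. Ys S s)"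

definition hist_dist ::
  "('d::finite, 'b) problem \<Rightarrow> nat \<Rightarrow> 'd path \<times> 'd path \<Rightarrow> 'd path \<times> 'd path \<Rightarrow> real" where
  "hist_dist S t = pair_dist (pexp S) (path_dist (pexp S) {1..t}) (path_dist (pexp S) {1..t})"

definition hist_ref :: "('d::finite, 'b) problem \<Rightarrow> nat \<Rightarrow> 'd path \<times> 'd path" where
  "hist_ref S t = (restrict (xref S) {1..t}, restrict (yref S) {1..t})"

text \<open>\<open>\<P>\<^sub>p(\<X>\<^sub>t\<^sub>+\<^sub>1\<^sub>:\<^sub>T \<times> \<Y>\<^sub>t\<^sub>+\<^sub>1\<^sub>:\<^sub>T)\<close> and its Wasserstein distance.\<close>

definition tail_dist ::
  "('d::finite, 'b) problem \<Rightarrow> nat \<Rightarrow> 'd path \<times> 'd path \<Rightarrow> 'd path \<times> 'd path \<Rightarrow> real" where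
  "tail_dist S t =
     pair_dist (pexp S) (path_dist (pexp S) {Suc t..horizon S}) (path_dist (pexp S) {Suc t..horizon S})"

definition tail_laws :: "('d::finite, 'b) problem \<Rightarrow> nat \<Rightarrow> ('d path \<times> 'd path) measure set" where
  "tail_laws S t =
     P_moment (pexp S)
       (path_space (Xs S) {Suc t..horizon S} \<Otimes>\<^sub>M path_space (Ys S) {Suc t..horizon S})
       (tail_dist S t)
       (restrict (xref S) {Suc t..horizon S}, restrict (yref S) {Suc t..horizon S})"

text \<open>Concatenation of \<open>x\<^sub>1\<^sub>:\<^sub>t\<close> and \<open>x\<^sub>t\<^sub>+\<^sub>1\<^sub>:\<^sub>T\<close>.\<close>

definition cat :: "nat \<Rightarrow> nat \<Rightarrow> ('d::finite) path \<Rightarrow> 'd path \<Rightarrow> 'd path" where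
  "cat T t x x' = merge {1..t} {Suc t..T} (x, x')"

section \<open>Objective and dynamic programming recursion\<close>

definition D_corr :: "('d::finite, 'b) problem \<Rightarrow> nat \<Rightarrow> 'd path \<Rightarrow> 'd path \<Rightarrow> 'b set" where
  "D_corr S t x y =
     {\<theta> \<in> Theta S (Suc t). gam S (Suc t) \<theta> \<in> couplings (muk S t x) (nuk S t y)}"

text \<open>The functional \<open>J(x\<^sub>1\<^sub>:\<^sub>t, y\<^sub>1\<^sub>:\<^sub>t; \<cdot>)\<close>, as a function of the law \<open>K\<close> of \<open>(x\<^sub>t\<^sub>+\<^sub>1\<^sub>:\<^sub>T, y\<^sub>t\<^sub>+\<^sub>1\<^sub>:\<^sub>T)\<close>.\<close>

definition J_cost ::
  "('d::finite, 'b) problem \<Rightarrow> nat \<Rightarrow> 'd path \<Rightarrow> 'd path \<Rightarrow> ('d path \<times> 'd path) measure \<Rightarrow> real" where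
  "J_cost S t x y K =
     (\<integral>z. cost S (coord (Xs S) x t) (coord (Ys S) y t)
             (cat (horizon S) t x (fst z)) (cat (horizon S) t y (snd z)) \<partial>K) +
     Gfun S (coord (Xs S) x t) (coord (Ys S) y t)
       (\<integral>z. hfun S (cat (horizon S) t x (fst z)) (cat (horizon S) t y (snd z)) \<partial>K)"

text \<open>\<open>g_fun S \<theta> t\<close>, \<open>b_fun S \<theta> t\<close> are \<open>g\<^sub>t\<close>, \<open>b\<^sub>t\<close>; they depend on \<open>\<theta>\<close> through
  \<open>\<theta>\<^sub>t\<^sub>+\<^sub>1, \<dots>, \<theta>\<^sub>T\<close> only.\<close>

definition g_fun ::
  "('d::finite, 'b) problem \<Rightarrow> ('d, 'b) policy \<Rightarrow> nat \<Rightarrow> 'd path \<Rightarrow> 'd path \<Rightarrow> real" where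
  "g_fun S \<theta> t x y =
     (\<integral>z. hfun S (cat (horizon S) t x (fst z)) (cat (horizon S) t y (snd z))
        \<partial>policy_kernel S \<theta> t x y)"

definition b_fun ::
  "('d::finite, 'b) problem \<Rightarrow> ('d, 'b) policy \<Rightarrow> nat \<Rightarrow> real ^ 'd \<Rightarrow> real ^ 'd \<Rightarrow>
   'd path \<Rightarrow> 'd path \<Rightarrow> real" where
  "b_fun S \<theta> t w v x y =
     (\<integral>z. cost S w v (cat (horizon S) t x (fst z)) (cat (horizon S) t y (snd z))
        \<partial>policy_kernel S \<theta> t x y)"

definition f_fun ::
  "('d::finite, 'b) problem \<Rightarrow> ('d, 'b) policy \<Rightarrow> nat \<Rightarrow> 'd path \<Rightarrow> 'd path \<Rightarrow> 'b \<Rightarrow> real" where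
  "f_fun S \<theta> t x y \<eta> =
     Gfun S (coord (Xs S) x t) (coord (Ys S) y t)
       (\<integral>uv. g_fun S \<theta> (Suc t) (x(Suc t := fst uv)) (y(Suc t := snd uv)) \<partial>gam S (Suc t) \<eta>) +
     (\<integral>uv. b_fun S \<theta> (Suc t) (coord (Xs S) x t) (coord (Ys S) y t)
              (x(Suc t := fst uv)) (y(Suc t := snd uv)) \<partial>gam S (Suc t) \<eta>)"

definition DP_optimizer ::
  "('d::finite, 'b) problem \<Rightarrow> ('d, 'b) policy \<Rightarrow> nat \<Rightarrow> 'd path \<Rightarrow> 'd path \<Rightarrow> 'b \<Rightarrow> bool" where
  "DP_optimizer S \<theta> t x y \<eta> \<longleftrightarrow>
     is_arg_min (f_fun S \<theta> t x y) (\<lambda>\<eta>'. \<eta>' \<in> D_corr S t x y) \<eta>"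

text \<open>\<open>\<theta>\<close> is built backward from optimizers: at every time \<open>s \<ge> t\<close> it solves the dynamic programming
  equation whose \<open>f\<^sub>s\<close> is formed with \<open>\<theta>\<close> itself at the later times.\<close>

definition optimal_from ::
  "('d::finite, 'b) problem \<Rightarrow> nat \<Rightarrow> ('d, 'b) policy \<Rightarrow> bool" where
  "optimal_from S t \<theta> \<longleftrightarrow>
     (\<forall>s. t \<le> s \<and> s < horizon S \<longrightarrow>
        (\<forall>(x, y)\<in>hist S s. DP_optimizer S \<theta> s x y (\<theta> (Suc s) x y)))"

text \<open>The value function \<open>V\<^sub>t\<close> attached to a policy is its cost from time \<open>t\<close> on; that it solves the
  dynamic programming equation for an optimal policy is not part of the definition.  The terminal
  condition on \<open>V\<^sub>T\<close> is \<open>value_fun_horizon\<close> below.\<close>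

definition value_fun ::
  "('d::finite, 'b) problem \<Rightarrow> ('d, 'b) policy \<Rightarrow> nat \<Rightarrow> 'd path \<Rightarrow> 'd path \<Rightarrow> real" where
  "value_fun S \<theta> t x y = J_cost S t x y (policy_kernel S \<theta> t x y)"

lemma cat_horizon:
  assumes "x \<in> (\<Pi>\<^sub>E s\<in>{1..T}. Z s)"
  shows "cat T T x x' = x"
proof
  fix i
  show "cat T T x x' i = x i"
    using assms by (auto simp: cat_def merge_def PiE_def extensional_def)
qed

lemma integral_policy_kernel_horizon:
  fixes F :: "('d::finite) path \<times> 'd path \<Rightarrow> real"
  shows "(\<integral>z. F z \<partial>policy_kernel S \<theta> (horizon S) x y) = F (\<lambda>_. undefined, \<lambda>_. undefined)"
proof -
  let ?M = "path_space (Xs S) {} \<Otimes>\<^sub>M path_space (Ys S) {}"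
  have sp: "space ?M = {(\<lambda>_. undefined, \<lambda>_. undefined)}"
    by (auto simp: path_space_def space_pair_measure space_PiM)
  have "F \<in> borel_measurable ?M"
    by (subst measurable_cong[of _ _ "\<lambda>_. F (\<lambda>_. undefined, \<lambda>_. undefined)"]) (auto simp: sp)
  then show ?thesis
    using sp by (simp add: policy_kernel_def integral_return)
qed

lemma g_fun_horizon:
  "(x, y) \<in> hist S (horizon S) \<Longrightarrow> g_fun S \<theta> (horizon S) x y = hfun S x y"
  by (auto simp: g_fun_def integral_policy_kernel_horizon cat_horizon hist_def)

lemma b_fun_horizon:
  "(x, y) \<in> hist S (horizon S) \<Longrightarrow> b_fun S \<theta> (horizon S) w v x y = cost S w v x y"
  by (auto simp: b_fun_def integral_policy_kernel_horizon cat_horizon hist_def)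

lemma value_fun_horizon:
  assumes "(x, y) \<in> hist S (horizon S)"
  shows "value_fun S \<theta> (horizon S) x y =
    cost S (coord (Xs S) x (horizon S)) (coord (Ys S) y (horizon S)) x y +
    Gfun S (coord (Xs S) x (horizon S)) (coord (Ys S) y (horizon S)) (hfun S x y)"
  using assms
  by (auto simp: value_fun_def J_cost_def integral_policy_kernel_horizon cat_horizon hist_def)

section \<open>Standing assumptions\<close>

definition marginal_setting ::
  "nat \<Rightarrow> (nat \<Rightarrow> (real ^ 'd) set) \<Rightarrow> ('d::finite) path \<Rightarrow> 'd path measure \<Rightarrow>
   (nat \<Rightarrow> 'd path \<Rightarrow> (real ^ 'd) measure) \<Rightarrow> bool" where
  "marginal_setting T Z zref m \<kappa> \<longleftrightarrow>
     is_singleton (Z 0) \<and> (\<forall>t\<in>{1..T}. closed (Z t)) \<and> zref \<in> (\<Pi>\<^sub>E t\<in>{1..T}. Z t) \<and>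
     sets m = sets (path_space Z {1..T}) \<and> prob_space m \<and> regular_kernels T Z m \<kappa>"

definition setting :: "('d::finite, 'b::real_vector) problem \<Rightarrow> bool" where
  "setting S \<longleftrightarrow>
     1 \<le> horizon S \<and> 1 \<le> pexp S \<and>
     marginal_setting (horizon S) (Xs S) (xref S) (mu S) (muk S) \<and>
     marginal_setting (horizon S) (Ys S) (yref S) (nu S) (nuk S) \<and>
     (\<forall>t<horizon S. polish_tvs (Theta S (Suc t)) (dTheta S (Suc t)))"

definition O1 :: "('d::finite, 'b) problem \<Rightarrow> bool" where
  "O1 S \<longleftrightarrow>
     (\<forall>t\<le>horizon S.
        C_growth (pexp S) (hist S (horizon S)) (hist_dist S (horizon S)) (hist_ref S (horizon S))
          (\<lambda>(x, y). cost S (coord (Xs S) x t) (coord (Ys S) y t) x y))"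

definition O2 :: "('d::finite, 'b) problem \<Rightarrow> bool" where
  "O2 S \<longleftrightarrow>
     0 < rexp S \<and> 1 / rexp S \<le> pexp S \<and>
     C_growth (1 / rexp S) (hist S (horizon S)) (hist_dist S (horizon S)) (hist_ref S (horizon S))
       (\<lambda>(x, y). hfun S x y)"

definition O3 :: "('d::finite, 'b) problem \<Rightarrow> bool" where
  "O3 S \<longleftrightarrow>
     (\<forall>t\<le>horizon S.
        continuous_on (Xs S t \<times> Ys S t \<times> UNIV) (\<lambda>(a, b, g). Gfun S a b g) \<and>
        (\<exists>C>0. \<forall>a\<in>Xs S t. \<forall>b\<in>Ys S t. \<forall>g.
           \<bar>Gfun S a b g\<bar> \<le> C * (1 + \<bar>g\<bar> powr (pexp S * rexp S) +
             pair_dist (pexp S) dist dist (a, b)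
               (coord (Xs S) (xref S) t, coord (Ys S) (yref S) t) powr pexp S)))"

definition K1_marginal ::
  "nat \<Rightarrow> real \<Rightarrow> (nat \<Rightarrow> (real ^ 'd) set) \<Rightarrow> ('d::finite) path \<Rightarrow>
   (nat \<Rightarrow> 'd path \<Rightarrow> (real ^ 'd) measure) \<Rightarrow> bool" where
  "K1_marginal T p Z zref \<kappa> \<longleftrightarrow>
     (\<forall>t<T. cont_map (\<Pi>\<^sub>E s\<in>{1..t}. Z s) (path_dist p {1..t})
              (P_moment p (state_space Z (Suc t)) dist (zref (Suc t))) (wasserstein p dist) (\<kappa> t))"

definition K2_marginal ::
  "nat \<Rightarrow> real \<Rightarrow> real \<Rightarrow> (nat \<Rightarrow> (real ^ 'd) set) \<Rightarrow> ('d::finite) path \<Rightarrow>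
   (nat \<Rightarrow> 'd path \<Rightarrow> (real ^ 'd) measure) \<Rightarrow> bool" where
  "K2_marginal T p r Z zref \<kappa> \<longleftrightarrow>
     (\<forall>t<T. \<forall>a\<in>{1 / r, p}. \<exists>C>0. \<forall>x\<in>(\<Pi>\<^sub>E s\<in>{1..t}. Z s).
        (\<integral>\<^sup>+x'. ennreal (path_dist p {1..T} (cat T t x x') zref powr a)
            \<partial>tail_kernel T Z \<kappa> (T - t) t x)
        \<le> ennreal (C * (1 + path_dist p {1..t} x zref powr a)))"

definition K1 :: "('d::finite, 'b) problem \<Rightarrow> bool" where
  "K1 S \<longleftrightarrow> K1_marginal (horizon S) (pexp S) (Xs S) (xref S) (muk S) \<and>
            K1_marginal (horizon S) (pexp S) (Ys S) (yref S) (nuk S)"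

definition K2 :: "('d::finite, 'b) problem \<Rightarrow> bool" where
  "K2 S \<longleftrightarrow> K2_marginal (horizon S) (pexp S) (rexp S) (Xs S) (xref S) (muk S) \<and>
            K2_marginal (horizon S) (pexp S) (rexp S) (Ys S) (yref S) (nuk S)"

definition P1 :: "('d::finite, 'b) problem \<Rightarrow> bool" where
  "P1 S \<longleftrightarrow>
     (\<forall>t<horizon S.
        cont_map (Theta S (Suc t)) (dTheta S (Suc t))
          (P_moment (pexp S) (state_space (Xs S) (Suc t) \<Otimes>\<^sub>M state_space (Ys S) (Suc t))
             (pair_dist (pexp S) dist dist) (xref S (Suc t), yref S (Suc t)))
          (wasserstein (pexp S) (pair_dist (pexp S) dist dist))
          (gam S (Suc t)))"

definition P2 :: "('d::finite, 'b::real_vector) problem \<Rightarrow> bool" where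
  "P2 S \<longleftrightarrow>
     (\<forall>t<horizon S.
        upper_hemicontinuous (hist S t) (hist_dist S t)
          (Metric_space.mtopology (Theta S (Suc t)) (dTheta S (Suc t))) (\<lambda>(x, y). D_corr S t x y) \<and>
        lower_hemicontinuous (hist S t) (hist_dist S t)
          (Metric_space.mtopology (Theta S (Suc t)) (dTheta S (Suc t))) (\<lambda>(x, y). D_corr S t x y) \<and>
        (\<forall>(x, y)\<in>hist S t.
           D_corr S t x y \<noteq> {} \<and> convex (D_corr S t x y) \<and>
           compactin (Metric_space.mtopology (Theta S (Suc t)) (dTheta S (Suc t)))
             (D_corr S t x y)))"

text \<open>\<open>f\<^sub>t\<close> depends on the optimizers \<open>\<theta>\<^sup>*\<close> at the times after \<open>t\<close>.\<close>

definition P3 :: "('d::finite, 'b::real_vector) problem \<Rightarrow> bool" where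
  "P3 S \<longleftrightarrow>
     (\<forall>t<horizon S. \<forall>\<theta>. optimal_from S (Suc t) \<theta> \<longrightarrow>
        (\<forall>(x, y)\<in>hist S t. strictly_quasiconvex (Theta S (Suc t)) (f_fun S \<theta> t x y)))"

end

theory Submission
  imports Defs
begin

text \<open>
  Backward induction on the time \<open>t\<close>.  The invariant is that for every continuous \<open>F\<close> of growth \<open>p\<close> on
  the full paths the average of \<open>F\<close> under the equilibrium kernel from time \<open>t\<close> on is continuous in
  \<open>(x\<^sub>1\<^sub>:\<^sub>t, y\<^sub>1\<^sub>:\<^sub>t)\<close>.  These averages again have growth \<open>p\<close> because an equilibrium kernel couples the
  kernels of \<open>\<mu>\<close> and \<open>\<nu>\<close>, to which (K2) applies.  Since integrals of functions of growth \<open>p\<close> pass to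
  limits in \<open>W\<^sub>p\<close>, \<open>f\<^sub>t\<close> is jointly continuous; Berge's argument with the strict quasiconvexity of
  \<open>f\<^sub>t\<close> then makes the minimizer unique and continuous, and this reproduces the invariant at time \<open>t\<close>.

  Continuity of the equilibrium kernel in \<open>W\<^sub>p\<close> needs no gluing of couplings along the time steps:
  convergence of the integrals of all continuous functions of growth \<open>p\<close> implies \<open>W\<^sub>p\<close> convergence.
\<close>

section \<open>Measurability and integration\<close>

text \<open>Since c depends on the current state and G is nonlinear, \<open>V_{t+1}\<close> does not
  determine \<open>f_t\<close>, and an induction on value functions does not close. Hence all
  averages of functions on full paths are carried at once: \<open>f_t\<close> needs those of h and
  of c(x_t, y_t, .), a different integrand for each t, and continuity of the kernel needs all of
  them. Two obstacles shape the rest. A monadic composition of kernels has the expected integrals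
  only for measurable kernels, while optimizers are picked by choice; their continuity, a
  consequence of uniqueness, makes the kernel measurable, so measurability travels with the
  induction. And growth p of h would not be enough for G(x_t, y_t, .), which grows with exponent pr:
  moments of order 1/r are kept next to those of order p, with (1/r)(pr) = p. The passage from
  integrals to W_p rests on an explicit coupling: a partition of unity with cells of small diameter
  reduces closeness of two laws to closeness of finitely many integrals.\<close>

lemma sets_eq_measurable_ident:
  assumes "space M = space N" "(\<lambda>x. x) \<in> M \<rightarrow>\<^sub>M N" "(\<lambda>x. x) \<in> N \<rightarrow>\<^sub>M M"
  shows "sets M = sets N"
proof -
  have "A \<in> sets M'" if "A \<in> sets N'" "(\<lambda>x. x) \<in> M' \<rightarrow>\<^sub>M N'" "space M' = space N'" for A and M' N' :: "'a measure"
    using measurable_sets[OF that(2) that(1)] sets.sets_into_space[OF that(1)] that(3)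
    by (simp add: vimage_def Int_absorb2 Int_def[symmetric])
  from this[of _ M N] this[of _ N M] show ?thesis
    using assms by auto
qed

text \<open>Second countability makes the Borel sets of a product generated by rectangles
  (\<open>borel_prod\<close>). With this, functions continuous on \<open>A \<times> B\<close> are
  measurable for every measure on the product, couplings included.\<close>

lemma sets_pair_restrict_borel:
  fixes A :: "'a::second_countable_topology set" and B :: "'b::second_countable_topology set"
  shows "sets (restrict_space borel A \<Otimes>\<^sub>M restrict_space borel B) = sets (restrict_space borel (A \<times> B))"
proof (rule sets_eq_measurable_ident)
  show "space (restrict_space borel A \<Otimes>\<^sub>M restrict_space borel B) = space (restrict_space borel (A \<times> B))"
    by (simp add: space_pair_measure space_restrict_space)
  show "(\<lambda>x. x) \<in> restrict_space borel A \<Otimes>\<^sub>M restrict_space borel B \<rightarrow>\<^sub>M restrict_space borel (A \<times> B)"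
  proof (rule measurable_restrict_space2)
    have "(\<lambda>x. (fst x, snd x)) \<in> restrict_space borel A \<Otimes>\<^sub>M restrict_space borel B \<rightarrow>\<^sub>M (borel \<Otimes>\<^sub>M borel)"
      by (intro measurable_Pair measurable_fst'' measurable_snd'' measurable_restrict_space1 measurable_ident_sets refl)
    then show "(\<lambda>x. x) \<in> restrict_space borel A \<Otimes>\<^sub>M restrict_space borel B \<rightarrow>\<^sub>M borel"
      by (simp add: borel_prod)
  qed (auto simp: space_pair_measure space_restrict_space)
  have "(\<lambda>x. (fst x, snd x)) \<in> restrict_space (borel :: ('a \<times> 'b) measure) (A \<times> B)
      \<rightarrow>\<^sub>M restrict_space borel A \<Otimes>\<^sub>M restrict_space borel B"
    by (intro measurable_Pair measurable_restrict_space2 measurable_restrict_space1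
        borel_measurable_continuous_onI continuous_on_fst continuous_on_snd continuous_on_id)
      (auto simp: space_restrict_space)
  then show "(\<lambda>x. x) \<in> restrict_space (borel :: ('a \<times> 'b) measure) (A \<times> B)
      \<rightarrow>\<^sub>M restrict_space borel A \<Otimes>\<^sub>M restrict_space borel B"
    by simp
qed

lemma measurable_continuous_on_sets:
  fixes f :: "'a::topological_space \<Rightarrow> 'b::topological_space"
  assumes "continuous_on A f" "sets M = sets (restrict_space borel A)"
  shows "f \<in> borel_measurable M"
  using borel_measurable_continuous_on_restrict[OF assms(1)] measurable_cong_sets[OF assms(2) refl]
  by blast

lemmas lebesgue_integral_cong = Bochner_Integration.integral_cong
  and lebesgue_integral_nonneg = Bochner_Integration.integral_nonneg
  and lebesgue_integrable_bound = Bochner_Integration.integrable_bound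

lemma real_integral_eq_nn_integrals:
  fixes f :: "'a \<Rightarrow> real"
  assumes "f \<in> borel_measurable M" "(\<integral>\<^sup>+x. ennreal \<bar>f x\<bar> \<partial>M) < \<infinity>"
  shows "integrable M f"
    "(\<integral>x. f x \<partial>M) = enn2real (\<integral>\<^sup>+x. ennreal (f x) \<partial>M) - enn2real (\<integral>\<^sup>+x. ennreal (- f x) \<partial>M)"
proof -
  show *: "integrable M f"
    using assms by (intro integrableI_bounded) (auto simp: real_norm_def)
  show "(\<integral>x. f x \<partial>M) = enn2real (\<integral>\<^sup>+x. ennreal (f x) \<partial>M) - enn2real (\<integral>\<^sup>+x. ennreal (- f x) \<partial>M)"
    by (rule real_lebesgue_integral_def[OF *])
qed

text \<open>The bind formula is known for extended integrals; it is applied to the positive and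
  negative parts, which finiteness allows to subtract. \<open>fin\<close> is asked at every point,
  not almost everywhere, so that \<open>enn2real\<close> is exact pointwise.\<close>

lemma integral_bind_real:
  fixes F :: "'b \<Rightarrow> real"
  assumes F[measurable]: "F \<in> borel_measurable B"
    and N[measurable]: "N \<in> M \<rightarrow>\<^sub>M subprob_algebra B"
    and fin: "\<And>x. x \<in> space M \<Longrightarrow> (\<integral>\<^sup>+y. ennreal \<bar>F y\<bar> \<partial>N x) < \<infinity>"
    and fin2: "(\<integral>\<^sup>+x. \<integral>\<^sup>+y. ennreal \<bar>F y\<bar> \<partial>N x \<partial>M) < \<infinity>"
    and ne: "space M \<noteq> {}"
  shows "(\<integral>y. F y \<partial>(M \<bind> N)) = (\<integral>x. (\<integral>y. F y \<partial>N x) \<partial>M)"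
proof -
  have sB: "sets (M \<bind> N) = sets B"
    using ne by (intro sets_bind sets_kernel[OF N])
  have FB: "F \<in> borel_measurable (M \<bind> N)"
    using F measurable_cong_sets[OF sB refl] by blast
  have FN: "F \<in> borel_measurable (N x)" if "x \<in> space M" for x
    using F measurable_cong_sets[OF sets_kernel[OF N that] refl] by blast
  let ?P = "\<lambda>x. \<integral>\<^sup>+y. ennreal (F y) \<partial>N x" and ?Q = "\<lambda>x. \<integral>\<^sup>+y. ennreal (- F y) \<partial>N x"
  have PQ[measurable]: "?P \<in> borel_measurable M" "?Q \<in> borel_measurable M"
    by measurable
  have Pl: "?P x \<le> (\<integral>\<^sup>+y. ennreal \<bar>F y\<bar> \<partial>N x)" "?Q x \<le> (\<integral>\<^sup>+y. ennreal \<bar>F y\<bar> \<partial>N x)" for x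
    by (intro nn_integral_mono ennreal_leI; simp)+
  have Pf: "?P x < \<infinity>" "?Q x < \<infinity>" if "x \<in> space M" for x
    using Pl[of x] fin[OF that] by (auto intro: le_less_trans)
  have PI: "(\<integral>\<^sup>+x. ?P x \<partial>M) < \<infinity>" "(\<integral>\<^sup>+x. ?Q x \<partial>M) < \<infinity>"
    by (rule le_less_trans[OF nn_integral_mono[OF Pl(1)] fin2], rule le_less_trans[OF nn_integral_mono[OF Pl(2)] fin2])
  have e: "integrable M (\<lambda>x. enn2real (R x)) \<and> (\<integral>x. enn2real (R x) \<partial>M) = enn2real (\<integral>\<^sup>+x. R x \<partial>M)"
    if [measurable]: "R \<in> borel_measurable M" and "\<And>x. x \<in> space M \<Longrightarrow> R x < \<infinity>" "(\<integral>\<^sup>+x. R x \<partial>M) < \<infinity>" for R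
  proof -
    have "(\<integral>\<^sup>+x. ennreal (enn2real (R x)) \<partial>M) = (\<integral>\<^sup>+x. R x \<partial>M)"
      using that(2) by (intro nn_integral_cong) (simp add: ennreal_enn2real)
    then show ?thesis
      using that(3) by (auto intro!: integrableI_nonneg simp: integral_eq_nn_integral)
  qed
  note e = e[OF PQ(1) Pf(1) PI(1)] e[OF PQ(2) Pf(2) PI(2)]
  have "(\<integral>y. F y \<partial>(M \<bind> N)) = enn2real (\<integral>\<^sup>+x. ?P x \<partial>M) - enn2real (\<integral>\<^sup>+x. ?Q x \<partial>M)"
    using fin2 FB by (subst real_integral_eq_nn_integrals) (auto simp: nn_integral_bind[OF _ N])
  also have "\<dots> = (\<integral>x. enn2real (?P x) - enn2real (?Q x) \<partial>M)"
    using e by (subst Bochner_Integration.integral_diff) auto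
  also have "\<dots> = (\<integral>x. (\<integral>y. F y \<partial>N x) \<partial>M)"
    using fin FN by (intro lebesgue_integral_cong refl) (simp add: real_integral_eq_nn_integrals(2))
  finally show ?thesis .
qed

text \<open>Closed subsets of E are stable under intersection and generate the Borel sets, and the
  mass of a closed set is a pointwise limit of integrals of bounded continuous functions. Weak
  continuity of a kernel thus yields the measurability that \<open>bind\<close> demands.\<close>

lemma measurable_prob_kernel_continuous:
  fixes K :: "'a::topological_space \<Rightarrow> 'b::metric_space measure"
  assumes N: "sets N = sets (restrict_space borel E)" and M: "sets M = sets (restrict_space borel H)"
    and E: "closed E"
    and K: "\<And>a. a \<in> H \<Longrightarrow> prob_space (K a)" "\<And>a. a \<in> H \<Longrightarrow> sets (K a) = sets N"
    and cont: "\<And>\<phi>::'b \<Rightarrow> real. continuous_on UNIV \<phi> \<Longrightarrow> (\<And>x. \<bar>\<phi> x\<bar> \<le> 1) \<Longrightarrow>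
        continuous_on H (\<lambda>a. \<integral>x. \<phi> x \<partial>K a)"
  shows "K \<in> M \<rightarrow>\<^sub>M prob_algebra N"
proof -
  have spM: "space M = H" using sets_eq_imp_space_eq[OF M] by (simp add: space_restrict_space)
  have spN: "space N = E" using sets_eq_imp_space_eq[OF N] by (simp add: space_restrict_space)
  let ?G = "{A. closed A \<and> A \<subseteq> E}"
  have "sets borel = sigma_sets UNIV (Collect closed :: 'b set set)"
    by (subst borel_eq_closed) (auto intro: sets_measure_of)
  then have "sets (restrict_space (borel :: 'b measure) E) = sigma_sets E ((\<inter>) E ` Collect closed)"
    using sigma_sets_Int[of E UNIV "Collect closed"] borel_closed[OF E] by (simp add: sets_restrict_space)
  also have "(\<inter>) E ` Collect closed = ?G"
    using E by auto
  finally have gen: "sets N = sigma_sets E ?G" using N by simp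
  show ?thesis
  proof (rule measurable_prob_algebra_generated[OF gen])
    show "Int_stable ?G" by (auto simp: Int_stable_def)
    show "?G \<subseteq> Pow E" by auto
    fix A assume A: "A \<in> ?G"
    show "(\<lambda>a. emeasure (K a) A) \<in> borel_measurable M"
    \<comment> \<open>The distance to the empty set is 0 by convention, so the functions
      \<open>\<phi> n\<close> below would not approximate its indicator.\<close>
    proof (cases "A = {}")
      case False
      \<comment> \<open>For positive n this is 1 on A and 0 at distance at least 1/n from A;
        closedness of A makes the limit the indicator.\<close>
      define \<phi> where "\<phi> n x = max 0 (1 - real n * infdist x A)" for n :: nat and x
      have c: "continuous_on UNIV (\<phi> n)" for n
        unfolding \<phi>_def by (intro continuous_intros)
      have b: "\<bar>\<phi> n x\<bar> \<le> 1" for n x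
        by (auto simp: \<phi>_def infdist_nonneg)
      have m: "(\<lambda>a. \<integral>x. \<phi> n x \<partial>K a) \<in> borel_measurable M" for n
        by (rule measurable_continuous_on_sets[OF cont M]) (use c b in auto)
      have A': "A \<in> sets N" using A gen by (auto intro: sigma_sets.Basic)
      have lim: "(\<lambda>n. \<phi> n x) \<longlonglongrightarrow> indicator A x" for x
      proof (cases "x \<in> A")
        case True then show ?thesis by (simp add: \<phi>_def)
      next
        case x: False
        then have "infdist x A > 0"
          using A False in_closed_iff_infdist_zero[of A x] infdist_nonneg[of x A] by force
        then have "\<forall>\<^sub>F n in sequentially. real n * infdist x A \<ge> 1"
          using filterlim_at_top_mult_tendsto_pos[OF tendsto_const _ filterlim_real_sequentially, of "infdist x A"]
          by (auto simp: filterlim_at_top mult.commute)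
        then have "\<forall>\<^sub>F n in sequentially. \<phi> n x = 0"
          by eventually_elim (simp add: \<phi>_def)
        then show ?thesis using x by (simp add: tendsto_eventually)
      qed
      have "(\<lambda>n. \<integral>x. \<phi> n x \<partial>K a) \<longlonglongrightarrow> measure (K a) A" if a: "a \<in> H" for a
      proof -
        interpret prob_space "K a" using K a by simp
        have ms: "\<phi> n \<in> borel_measurable (K a)" for n
          using K(2)[OF a] N by (intro measurable_continuous_on_sets[OF continuous_on_subset[OF c subset_UNIV]]) auto
        have "(\<lambda>n. \<integral>x. \<phi> n x \<partial>K a) \<longlonglongrightarrow> (\<integral>x. indicator A x \<partial>K a)"
          using A' K(2)[OF a] b lim ms
          by (intro integral_dominated_convergence[where w="\<lambda>_. 1"]) auto
        then show ?thesis using A' K(2)[OF a] by simp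
      qed
      then have "(\<lambda>a. measure (K a) A) \<in> borel_measurable M"
        by (intro borel_measurable_LIMSEQ_real[OF _ m]) (simp add: spM)
      then have "(\<lambda>a. ennreal (measure (K a) A)) \<in> borel_measurable M" by simp
      also have "?this \<longleftrightarrow> ?thesis"
        using K by (intro measurable_cong) (simp add: spM prob_space.finite_measure finite_measure.emeasure_eq_measure)
      finally show ?thesis .
    qed simp
  qed (use K spM in auto)
qed

section \<open>Wasserstein convergence and integrals of functions of growth p\<close>

text \<open>Only the cost \<open>D\<^sup>p\<close> enters, so instead of the triangle inequality for \<open>D\<close> (Minkowski's inequality for
  the product metrics) it suffices to have the quasi-triangle inequality with a constant \<open>K\<close>.\<close>

locale cost_space =
  fixes E :: "'u::{metric_space, second_countable_topology} set"
    and M :: "'u measure" and D :: "'u \<Rightarrow> 'u \<Rightarrow> real" and u0 :: 'u and p K :: real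
  assumes sets_M: "sets M = sets (restrict_space borel E)"
    and p_ge: "1 \<le> p" and ref: "u0 \<in> E" and K_pos: "0 < K"
    and cost_cont: "continuous_on (E \<times> E) (\<lambda>z. D (fst z) (snd z) powr p)"
    and cost_self: "u \<in> E \<Longrightarrow> D u u = 0"
    and cost_sym: "D u v = D v u"
    and cost_tri: "\<lbrakk>u \<in> E; v \<in> E; w \<in> E\<rbrakk> \<Longrightarrow> D u v powr p \<le> K * (D u w powr p + D w v powr p)"
    and cost_ball: "compact {u \<in> E. D u u0 powr p \<le> R}"
    and cost_conv: "\<lbrakk>u \<in> E; \<And>n. s n \<in> E; (\<lambda>n. D u (s n) powr p) \<longlonglongrightarrow> 0\<rbrakk> \<Longrightarrow> s \<longlonglongrightarrow> u"
begin

abbreviation "cst u v \<equiv> D u v powr p"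
abbreviation "rho u \<equiv> D u u0 powr p"
abbreviation "PP \<equiv> P_moment p M D u0"

lemma space_M: "space M = E"
  using sets_eq_imp_space_eq[OF sets_M] by (simp add: space_restrict_space)

lemma PP_D:
  assumes "\<alpha> \<in> PP"
  shows "sets \<alpha> = sets M" "prob_space \<alpha>" "space \<alpha> = E" "sets \<alpha> = sets (restrict_space borel E)"
  using assms sets_eq_imp_space_eq[of \<alpha> M] sets_M by (auto simp: P_moment_def space_M)

lemma rho_cont: "continuous_on E rho"
proof -
  have "continuous_on E (\<lambda>u. (u, u0))" by (intro continuous_intros)
  then show ?thesis
    using continuous_on_compose2[OF cost_cont, of E "\<lambda>u. (u, u0)"] ref by auto
qed

lemma measurable_PP:
  assumes "\<alpha> \<in> PP" "continuous_on E (\<phi> :: 'u \<Rightarrow> real)"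
  shows "\<phi> \<in> borel_measurable \<alpha>"
  using measurable_continuous_on_sets[OF assms(2) PP_D(4)[OF assms(1)]] .

lemma integrable_rho:
  assumes "\<alpha> \<in> PP"
  shows "integrable \<alpha> rho"
  using assms measurable_PP[OF assms rho_cont]
  by (intro integrableI_nonneg) (auto simp: P_moment_def)

lemma integrable_growth:
  assumes "\<alpha> \<in> PP" "continuous_on E \<phi>" "\<And>u. u \<in> E \<Longrightarrow> \<bar>\<phi> u\<bar> \<le> C * (1 + rho u)"
  shows "integrable \<alpha> \<phi>"
proof -
  interpret prob_space \<alpha> using PP_D[OF assms(1)] by simp
  have "integrable \<alpha> (\<lambda>u. C * (1 + rho u))"
    using integrable_rho[OF assms(1)] by simp
  then show ?thesis
    using measurable_PP[OF assms(1,2)]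
  proof (rule lebesgue_integrable_bound, intro AE_I2)
    fix u assume "u \<in> space \<alpha>"
    then show "norm (\<phi> u) \<le> norm (C * (1 + rho u))"
      using assms(3)[of u] PP_D(3)[OF assms(1)] by simp
  qed
qed

section \<open>Couplings and the infimum defining W_p\<close>

lemma coupling_D:
  assumes "\<alpha> \<in> PP" "\<beta> \<in> PP" "\<pi> \<in> couplings \<alpha> \<beta>"
  shows "sets \<pi> = sets (restrict_space borel (E \<times> E))" "space \<pi> = E \<times> E" "prob_space \<pi>"
    "fst \<in> \<pi> \<rightarrow>\<^sub>M \<alpha>" "snd \<in> \<pi> \<rightarrow>\<^sub>M \<beta>" "distr \<pi> \<alpha> fst = \<alpha>" "distr \<pi> \<beta> snd = \<beta>"
proof -
  have s: "sets \<pi> = sets (\<alpha> \<Otimes>\<^sub>M \<beta>)" and d: "distr \<pi> \<alpha> fst = \<alpha>" "distr \<pi> \<beta> snd = \<beta>"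
    using assms(3) by (auto simp: couplings_def)
  show "distr \<pi> \<alpha> fst = \<alpha>" "distr \<pi> \<beta> snd = \<beta>" using d .
  have "sets (\<alpha> \<Otimes>\<^sub>M \<beta>) = sets (restrict_space borel E \<Otimes>\<^sub>M restrict_space borel E)"
    using assms PP_D(4) by (intro sets_pair_measure_cong) auto
  then show s': "sets \<pi> = sets (restrict_space borel (E \<times> E))"
    using s sets_pair_restrict_borel by blast
  show "space \<pi> = E \<times> E"
    using sets_eq_imp_space_eq[OF s'] by (simp add: space_restrict_space)
  show m: "fst \<in> \<pi> \<rightarrow>\<^sub>M \<alpha>" "snd \<in> \<pi> \<rightarrow>\<^sub>M \<beta>"
    by (simp_all add: measurable_cong_sets[OF s refl])
  show "prob_space \<pi>"
    using prob_space_distrD[OF m(1)] PP_D(2)[OF assms(1)] d by simp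
qed

lemma cost_measurable:
  assumes "sets \<pi> = sets (restrict_space borel (E \<times> E))"
  shows "(\<lambda>z. cst (fst z) (snd z)) \<in> borel_measurable \<pi>"
  by (rule measurable_continuous_on_sets[OF cost_cont assms])

text \<open>The product has finite cost by the quasi-triangle inequality through \<open>u0\<close>.
  Hence the infimum in \<open>wasserstein\<close> is finite and \<open>enn2real\<close> does not
  turn an infinite value into 0.\<close>

lemma product_coupling:
  assumes "\<alpha> \<in> PP" "\<beta> \<in> PP"
  shows "\<alpha> \<Otimes>\<^sub>M \<beta> \<in> couplings \<alpha> \<beta>"
    "(\<integral>\<^sup>+z. ennreal (cst (fst z) (snd z)) \<partial>(\<alpha> \<Otimes>\<^sub>M \<beta>)) < \<infinity>"
proof -
  interpret A: prob_space \<alpha> using PP_D[OF assms(1)] by simp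
  interpret B: prob_space \<beta> using PP_D[OF assms(2)] by simp
  have "distr (\<alpha> \<Otimes>\<^sub>M \<beta>) \<beta> snd = \<beta>"
  proof (rule measure_eqI)
    fix A assume A: "A \<in> sets (distr (\<alpha> \<Otimes>\<^sub>M \<beta>) \<beta> snd)"
    then have "snd -` A \<inter> space (\<alpha> \<Otimes>\<^sub>M \<beta>) = space \<alpha> \<times> A"
      using sets.sets_into_space[of A \<beta>] by (auto simp: space_pair_measure)
    then show "emeasure (distr (\<alpha> \<Otimes>\<^sub>M \<beta>) \<beta> snd) A = emeasure \<beta> A"
      using A by (simp add: emeasure_distr B.emeasure_pair_measure_Times A.emeasure_space_1)
  qed simp
  then show c: "\<alpha> \<Otimes>\<^sub>M \<beta> \<in> couplings \<alpha> \<beta>"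
    by (simp add: couplings_def B.distr_pair_fst)
  note ra = integrable_rho[OF assms(1)] and rb = integrable_rho[OF assms(2)]
  have ms: "(\<lambda>z. cst (fst z) (snd z)) \<in> borel_measurable (\<alpha> \<Otimes>\<^sub>M \<beta>)"
    using cost_measurable coupling_D(1)[OF assms c] by blast
  have "integrable (\<alpha> \<Otimes>\<^sub>M \<beta>) (\<lambda>z. K * (rho (fst z) + rho (snd z)))"
    using integrable_distr[OF coupling_D(4)[OF assms c], of rho] integrable_distr[OF coupling_D(5)[OF assms c], of rho]
      coupling_D(6,7)[OF assms c] ra rb by simp
  then have "integrable (\<alpha> \<Otimes>\<^sub>M \<beta>) (\<lambda>z. cst (fst z) (snd z))"
    using ms
  proof (rule lebesgue_integrable_bound, intro AE_I2)
    fix z assume "z \<in> space (\<alpha> \<Otimes>\<^sub>M \<beta>)"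
    moreover have "cst u0 (snd z) = rho (snd z)" by (subst cost_sym) (rule refl)
    ultimately show "norm (cst (fst z) (snd z)) \<le> norm (K * (rho (fst z) + rho (snd z)))"
      using cost_tri[of "fst z" "snd z" u0] coupling_D(2)[OF assms c] ref K_pos
      by (simp add: abs_of_nonneg mem_Times_iff)
  qed
  then show "(\<integral>\<^sup>+z. ennreal (cst (fst z) (snd z)) \<partial>(\<alpha> \<Otimes>\<^sub>M \<beta>)) < \<infinity>"
    by (subst nn_integral_eq_integral) auto
qed

text \<open>A nearly optimal coupling is all that is used later, so the infimum need not be
  attained; comparing p-th powers removes the outer root.\<close>

lemma wasserstein_coupling:
  assumes "\<alpha> \<in> PP" "\<beta> \<in> PP" "wasserstein p D \<alpha> \<beta> powr p < e"
  obtains \<pi> where "\<pi> \<in> couplings \<alpha> \<beta>" "(\<integral>\<^sup>+z. ennreal (cst (fst z) (snd z)) \<partial>\<pi>) < ennreal e"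
proof -
  let ?I = "INF \<pi>\<in>couplings \<alpha> \<beta>. \<integral>\<^sup>+z. ennreal (cst (fst z) (snd z)) \<partial>\<pi>"
  have "?I < \<infinity>"
    using product_coupling[OF assms(1,2)] by (meson INF_lower le_less_trans)
  moreover have "enn2real ?I < e"
    using assms(3) p_ge by (simp add: wasserstein_def powr_powr)
  ultimately have "ennreal (enn2real ?I) < ennreal e" "ennreal (enn2real ?I) = ?I"
    by (simp_all add: ennreal_less_iff)
  then have "?I < ennreal e" by simp
  then show thesis
    using that by (auto simp: INF_less_iff)
qed

lemma wasserstein_le:
  assumes "\<pi> \<in> couplings \<alpha> \<beta>" "(\<integral>\<^sup>+z. ennreal (cst (fst z) (snd z)) \<partial>\<pi>) \<le> ennreal e" "0 \<le> e"
  shows "wasserstein p D \<alpha> \<beta> \<le> e powr (1 / p)"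
proof -
  have "(INF \<pi>\<in>couplings \<alpha> \<beta>. \<integral>\<^sup>+z. ennreal (cst (fst z) (snd z)) \<partial>\<pi>) \<le> ennreal e"
    using assms by (meson INF_lower order_trans)
  then have "enn2real (INF \<pi>\<in>couplings \<alpha> \<beta>. \<integral>\<^sup>+z. ennreal (cst (fst z) (snd z)) \<partial>\<pi>) \<le> e"
    using assms(3) by (simp add: enn2real_leI)
  then show ?thesis
    using p_ge by (auto simp: wasserstein_def intro!: powr_mono2)
qed

section \<open>Limits of integrals along W_p convergence\<close>

lemma tail_integral_small:
  assumes "\<alpha> \<in> PP" "0 < e"
  obtains R where "0 \<le> R" "(\<integral>u. indicator {u. R < rho u} u * (1 + rho u) \<partial>\<alpha>) < e"
proof -
  interpret prob_space \<alpha> using PP_D[OF assms(1)] by simp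
  note [measurable] = measurable_PP[OF assms(1) rho_cont]
  have i: "integrable \<alpha> (\<lambda>u. 1 + rho u)" using integrable_rho[OF assms(1)] by simp
  have l: "(\<lambda>n. indicator {u. real n < rho u} u * (1 + rho u)) \<longlonglongrightarrow> 0" for u
  proof (rule tendsto_eventually)
    show "\<forall>\<^sub>F n in sequentially. indicator {u. real n < rho u} u * (1 + rho u) = 0"
      using eventually_ge_at_top[of "nat \<lceil>rho u\<rceil>"] by eventually_elim (auto simp: indicator_def nat_ceiling_le_eq)
  qed
  have "(\<lambda>n. \<integral>u. indicator {u. real n < rho u} u * (1 + rho u) \<partial>\<alpha>) \<longlonglongrightarrow> (\<integral>u. 0 \<partial>\<alpha>)"
  proof (rule integral_dominated_convergence[OF _ _ i])
    show "AE u in \<alpha>. (\<lambda>n. indicator {u. real n < rho u} u * (1 + rho u)) \<longlonglongrightarrow> 0"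
      using l by simp
    show "AE u in \<alpha>. norm (indicator {u. real n < rho u} u * (1 + rho u)) \<le> 1 + rho u" for n
      by (auto simp: indicator_def)
  qed auto
  then have "\<forall>\<^sub>F n in sequentially. (\<integral>u. indicator {u. real n < rho u} u * (1 + rho u) \<partial>\<alpha>) < e"
    using assms(2) by (auto intro: order_tendstoD)
  then obtain n where "(\<integral>u. indicator {u. real n < rho u} u * (1 + rho u) \<partial>\<alpha>) < e"
    by (auto simp: eventually_sequentially)
  then show thesis
    using that[of "real n"] by simp
qed

text \<open>Only u is confined to a compact ball; v is merely close to u in cost and may lie
  outside. In a counterexample sequence a subsequence of the u converges, the v are dragged to the
  same limit by \<open>cost_tri\<close> and \<open>cost_conv\<close>, and continuity of F is
  contradicted there.\<close>

lemma modulus_on_ball: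
  fixes F :: "'z::metric_space \<Rightarrow> 'u \<Rightarrow> real"
  assumes F: "continuous_on (H \<times> E) (\<lambda>(z, u). F z u)" and z: "z \<in> H" "\<And>n. zn n \<in> H" "zn \<longlonglongrightarrow> z"
    and e: "0 < e"
  shows "\<exists>d>0. \<exists>N. \<forall>n\<ge>N. \<forall>u\<in>E. \<forall>v\<in>E. rho u \<le> R \<and> cst u v < d \<longrightarrow> \<bar>F z u - F (zn n) v\<bar> \<le> e"
proof (rule ccontr)
  assume neg: "\<not> ?thesis"
  have "\<exists>n u v. k \<le> n \<and> u \<in> E \<and> v \<in> E \<and> rho u \<le> R \<and> cst u v < 1 / Suc k \<and> e < \<bar>F z u - F (zn n) v\<bar>" for k
  proof (rule ccontr)
    assume "\<not> ?thesis"
    then have "\<forall>n\<ge>k. \<forall>u\<in>E. \<forall>v\<in>E. rho u \<le> R \<and> cst u v < 1 / Suc k \<longrightarrow> \<bar>F z u - F (zn n) v\<bar> \<le> e"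
      by (meson not_le)
    moreover have "0 < 1 / real (Suc k)" by simp
    ultimately show False using neg by blast
  qed
  then obtain n u v where *: "\<And>k. n k \<ge> k \<and> u k \<in> E \<and> v k \<in> E \<and> rho (u k) \<le> R \<and>
      cst (u k) (v k) < 1 / Suc k \<and> \<bar>F z (u k) - F (zn (n k)) (v k)\<bar> > e"
    by metis
  have "\<forall>k. u k \<in> {u \<in> E. rho u \<le> R}" using * by simp
  then obtain w r where w0: "w \<in> {u \<in> E. rho u \<le> R}" "strict_mono (r :: nat \<Rightarrow> nat)" "(u \<circ> r) \<longlonglongrightarrow> w"
    by (rule seq_compactE[OF compact_imp_seq_compact[OF cost_ball[of R]]]) blast
  then have w: "w \<in> E" "strict_mono r" "(\<lambda>k. u (r k)) \<longlonglongrightarrow> w"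
    by (auto simp: comp_def)
  \<comment> \<open>The chosen indices need not increase, but they tend to infinity, which suffices
    for the convergence of \<open>zn\<close> along them.\<close>
  have nr: "n (r k) \<ge> k" for k
    using *[of "r k"] seq_suble[OF w(2), of k] by linarith
  have lz: "(\<lambda>k. zn (n (r k))) \<longlonglongrightarrow> z"
    by (rule filterlim_compose[OF z(3)], rule filterlim_at_top_mono[OF filterlim_ident]) (use nr in simp)
  have c1: "(\<lambda>k. cst w (u (r k))) \<longlonglongrightarrow> 0"
  proof -
    have "(\<lambda>k. (w, u (r k))) \<longlonglongrightarrow> (w, w)"
      using w by (auto intro: tendsto_Pair simp: comp_def)
    then have "(\<lambda>k. cst w (u (r k))) \<longlonglongrightarrow> cst w w"
      using continuous_on_tendsto_compose[OF cost_cont, of "\<lambda>k. (w, u (r k))" "(w, w)"] w * by auto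
    then show ?thesis using cost_self w by simp
  qed
  have c2: "(\<lambda>k. cst (u (r k)) (v (r k))) \<longlonglongrightarrow> 0"
  proof (rule tendsto_sandwich[OF _ _ tendsto_const])
    show "(\<lambda>k. 1 / real (Suc k)) \<longlonglongrightarrow> 0"
      by (rule LIMSEQ_Suc[OF lim_1_over_n])
    show "\<forall>\<^sub>F k in sequentially. cst (u (r k)) (v (r k)) \<le> 1 / real (Suc k)"
    proof (rule always_eventually, rule)
      fix k
      have "1 / real (Suc (r k)) \<le> 1 / real (Suc k)"
        using seq_suble[OF w(2), of k] by (intro divide_left_mono) auto
      then show "cst (u (r k)) (v (r k)) \<le> 1 / real (Suc k)"
        using *[of "r k"] by linarith
    qed
  qed auto
  have "(\<lambda>k. K * (cst w (u (r k)) + cst (u (r k)) (v (r k)))) \<longlonglongrightarrow> K * (0 + 0)"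
    by (intro tendsto_intros c1 c2)
  then have up: "(\<lambda>k. K * (cst w (u (r k)) + cst (u (r k)) (v (r k)))) \<longlonglongrightarrow> 0" by simp
  have "cst w (v (r k)) \<le> K * (cst w (u (r k)) + cst (u (r k)) (v (r k)))" for k
    using cost_tri[of w "v (r k)" "u (r k)"] w(1) *[of "r k"] cost_sym[of "v (r k)" "u (r k)"] by simp
  then have "(\<lambda>k. cst w (v (r k))) \<longlonglongrightarrow> 0"
    by (intro tendsto_sandwich[OF always_eventually always_eventually tendsto_const up]) auto
  then have lv: "(\<lambda>k. v (r k)) \<longlonglongrightarrow> w"
    using cost_conv[of w "\<lambda>k. v (r k)"] w * by auto
  have "(\<lambda>k. F z (u (r k))) \<longlonglongrightarrow> F z w"
    using continuous_on_tendsto_compose[OF F tendsto_Pair[OF tendsto_const w(3)], of z] w(1) * z by simp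
  moreover have "(\<lambda>k. F (zn (n (r k))) (v (r k))) \<longlonglongrightarrow> F z w"
    using continuous_on_tendsto_compose[OF F tendsto_Pair[OF lz lv]] w(1) * z by simp
  ultimately have "(\<lambda>k. \<bar>F z (u (r k)) - F (zn (n (r k))) (v (r k))\<bar>) \<longlonglongrightarrow> \<bar>F z w - F z w\<bar>"
    by (intro tendsto_intros)
  then have "\<forall>\<^sub>F k in sequentially. \<bar>F z (u (r k)) - F (zn (n (r k))) (v (r k))\<bar> < e"
    using e by (auto intro: order_tendstoD)
  then obtain k where "\<bar>F z (u (r k)) - F (zn (n (r k))) (v (r k))\<bar> < e"
    by (auto simp: eventually_sequentially)
  then show False
    using *[of "r k"] by linarith
qed

text \<open>Three regimes. For u outside the ball the growth bounds leave the tail term, the part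
  due to v being handled by \<open>cost_tri\<close>; inside with v near, the modulus applies; inside
  with v far, the ratio of the cost to d is at least 1, so the growth bound is paid by the cost.
  Integrated against a cheap coupling, the right side is small.\<close>

lemma modulus_pointwise:
  assumes a: "\<bar>a\<bar> \<le> C * (1 + rho u)" "\<bar>b\<bar> \<le> C * (1 + rho v)" "0 \<le> C" "u \<in> E" "v \<in> E" and e: "0 < e" "0 < d"
    and R: "0 \<le> R" and m: "rho u \<le> R \<Longrightarrow> cst u v < d \<Longrightarrow> \<bar>a - b\<bar> \<le> e"
  shows "\<bar>a - b\<bar> \<le> e + C * (2 + K) * (indicator {u. R < rho u} u * (1 + rho u)) +
    (C * (2 + K) * (1 + R) / d + C * K) * cst u v"
proof -
  have "rho v \<le> K * (cst u v + rho u)"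
    using cost_tri[of v u0 u] cost_sym[of v u] cost_sym[of u0 u] a ref by simp
  then have "C * rho v \<le> C * (K * (cst u v + rho u))" using a by (intro mult_left_mono)
  moreover have "0 \<le> C * K * 1" using a K_pos by auto
  moreover have "0 \<le> C * rho u" using a by simp
  \<comment> \<open>\<open>2 + K\<close> dominates both the coefficient 2 of the constant and the
    coefficient \<open>1 + K\<close> of \<open>rho u\<close> in the sum of the two growth
    bounds.\<close>
  ultimately have b: "\<bar>a - b\<bar> \<le> C * (2 + K) * (1 + rho u) + C * K * cst u v"
    using a(1,2) by (simp add: algebra_simps)
  have CK: "0 \<le> C * (2 + K)" using a K_pos by auto
  have n: "0 \<le> (C * (2 + K) * (1 + R) / d + C * K) * cst u v"
    using a e R K_pos by (intro mult_nonneg_nonneg add_nonneg_nonneg divide_nonneg_pos) auto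
  show ?thesis
  proof (cases "R < rho u")
    case True
    have "0 \<le> C * (2 + K) * (1 + R) / d"
      using R e by (intro divide_nonneg_pos mult_nonneg_nonneg[OF CK]) auto
    then have "0 \<le> C * (2 + K) * (1 + R) / d * cst u v" by (intro mult_nonneg_nonneg) auto
    with True show ?thesis using b e by (simp add: algebra_simps)
  next
    case False
    show ?thesis
    proof (cases "cst u v < d")
      case True
      then show ?thesis using m False n by simp
    next
      case d: False
      have "(1 + rho u) * 1 \<le> (1 + R) * (cst u v / d)"
        using R e d False by (intro mult_mono) auto
      from mult_left_mono[OF this CK]
      have "C * (2 + K) * (1 + rho u) \<le> C * (2 + K) * (1 + R) / d * cst u v"
        by (simp add: mult.assoc)
      then show ?thesis using b e False by (simp add: algebra_simps)
    qed
  qed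
qed

text \<open>Both integrals are written over a nearly optimal coupling of \<open>\<alpha>\<close> and
  \<open>A n\<close>, where \<open>modulus_pointwise\<close> bounds the difference by a small
  constant, a tail and a multiple of the transport cost. Only the tail of the fixed measure
  \<open>\<alpha>\<close> enters, never those of the \<open>A n\<close>.\<close>

theorem integral_tendsto:
  fixes F :: "'z::metric_space \<Rightarrow> 'u \<Rightarrow> real"
  assumes F: "continuous_on (H \<times> E) (\<lambda>(z, u). F z u)" and z: "z \<in> H" "\<And>n. zn n \<in> H" "zn \<longlonglongrightarrow> z"
    and \<alpha>: "\<alpha> \<in> PP" and A: "\<And>n. A n \<in> PP" and W: "(\<lambda>n. wasserstein p D \<alpha> (A n)) \<longlonglongrightarrow> 0"
    and C: "0 \<le> C" "\<And>u. u \<in> E \<Longrightarrow> \<bar>F z u\<bar> \<le> C * (1 + rho u)" "\<And>n u. u \<in> E \<Longrightarrow> \<bar>F (zn n) u\<bar> \<le> C * (1 + rho u)"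
  shows "(\<lambda>n. \<integral>u. F (zn n) u \<partial>A n) \<longlonglongrightarrow> (\<integral>u. F z u \<partial>\<alpha>)"
proof -
  \<comment> \<open>The added term makes the comparison strict, so that
    \<open>wasserstein_coupling\<close> yields a coupling even where the distance is 0.\<close>
  define e where "e n = wasserstein p D \<alpha> (A n) powr p + 1 / real (Suc n)" for n
  have "(\<lambda>n. wasserstein p D \<alpha> (A n) powr p) \<longlonglongrightarrow> 0"
    using p_ge by (intro tendsto_zero_powrI[OF W tendsto_const]) (auto simp: wasserstein_def)
  then have e0: "e \<longlonglongrightarrow> 0 + 0"
    unfolding e_def by (intro tendsto_add LIMSEQ_Suc[OF lim_1_over_n])
  have en: "0 \<le> e n" for n by (simp add: e_def)
  have "\<exists>\<pi>. \<pi> \<in> couplings \<alpha> (A n) \<and> (\<integral>\<^sup>+z. ennreal (cst (fst z) (snd z)) \<partial>\<pi>) < ennreal (e n)" for n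
    by (rule wasserstein_coupling[OF \<alpha> A[of n], of "e n"]) (auto simp: e_def)
  then obtain \<pi> where \<pi>: "\<And>n. \<pi> n \<in> couplings \<alpha> (A n)"
    "\<And>n. (\<integral>\<^sup>+z. ennreal (cst (fst z) (snd z)) \<partial>\<pi> n) < ennreal (e n)" by metis
  note cD = coupling_D[OF \<alpha> A \<pi>(1)]
  have ci: "integrable (\<pi> n) (\<lambda>z. cst (fst z) (snd z))" for n
    using \<pi>(2)[of n] cost_measurable[OF cD(1)] by (intro integrableI_nonneg) (auto intro: less_trans)
  have cI: "(\<integral>z. cst (fst z) (snd z) \<partial>\<pi> n) \<le> e n" for n
    using \<pi>(2)[of n] en[of n] by (subst (asm) nn_integral_eq_integral[OF ci]) (auto simp: ennreal_less_iff)
  have Fz: "continuous_on E (F z')" if "z' \<in> H" for z'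
  proof -
    have "continuous_on E (\<lambda>u. (z', u))" by (intro continuous_intros)
    then show ?thesis using continuous_on_compose2[OF F, of E "\<lambda>u. (z', u)"] that by auto
  qed
  have i1: "integrable \<alpha> (F z)" by (rule integrable_growth[OF \<alpha> Fz[OF z(1)] C(2)])
  have i2: "integrable (A n) (F (zn n))" for n by (rule integrable_growth[OF A Fz[OF z(2)] C(3)])
  have i1': "integrable (\<pi> n) (\<lambda>x. F z (fst x))" "(\<integral>x. F z (fst x) \<partial>\<pi> n) = (\<integral>u. F z u \<partial>\<alpha>)" for n
    using integrable_distr[OF cD(4)[of n], of "F z"] integral_distr[OF cD(4)[of n], of "F z"] i1 cD(6)[of n]
    by auto
  have i2': "integrable (\<pi> n) (\<lambda>x. F (zn n) (snd x))" "(\<integral>x. F (zn n) (snd x) \<partial>\<pi> n) = (\<integral>u. F (zn n) u \<partial>A n)" for n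
    using integrable_distr[OF cD(5)[of n], of "F (zn n)"] integral_distr[OF cD(5)[of n], of "F (zn n)"] i2[of n] cD(7)[of n]
    by auto
  show ?thesis
  proof (rule LIMSEQ_I)
    fix \<epsilon> :: real assume \<epsilon>: "0 < \<epsilon>"
    define C1 where "C1 = C * (2 + K)"
    have C1: "0 \<le> C1" using C(1) K_pos by (simp add: C1_def)
    \<comment> \<open>The shift by 1 keeps the denominator positive, as \<open>C1\<close> may
      vanish.\<close>
    obtain R where R: "0 \<le> R" "(\<integral>u. indicator {u. R < rho u} u * (1 + rho u) \<partial>\<alpha>) < \<epsilon> / (3 * (C1 + 1))" (is "?T < _")
      using tail_integral_small[OF \<alpha>, of "\<epsilon> / (3 * (C1 + 1))"] \<epsilon> C1 by auto
    have "C1 * ?T \<le> C1 * (\<epsilon> / (3 * (C1 + 1)))" using R C1 by (intro mult_left_mono) auto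
    also have "\<dots> \<le> \<epsilon> / 3" using C1 \<epsilon> by (simp add: field_simps)
    finally have T: "C1 * ?T \<le> \<epsilon> / 3" .
    have "0 < \<epsilon> / 6" using \<epsilon> by simp
    from modulus_on_ball[OF F z this, of R] obtain d N where d: "0 < d"
      "\<And>n u v. \<lbrakk>n \<ge> N; u \<in> E; v \<in> E; rho u \<le> R; cst u v < d\<rbrakk> \<Longrightarrow> \<bar>F z u - F (zn n) v\<bar> \<le> \<epsilon> / 6"
      by blast
    define C2 where "C2 = C1 * (1 + R) / d + C * K"
    have C2: "0 \<le> C2" using C1 R d C(1) K_pos by (simp add: C2_def)
    have "(\<lambda>n. C2 * e n) \<longlonglongrightarrow> C2 * 0" using e0 by (intro tendsto_intros) simp
    then have "\<forall>\<^sub>F n in sequentially. C2 * e n < \<epsilon> / 3"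
      using \<epsilon> by (intro order_tendstoD(2)[where y="C2 * 0"]) auto
    then obtain N' where N': "\<And>n. n \<ge> N' \<Longrightarrow> C2 * e n < \<epsilon> / 3" by (auto simp: eventually_sequentially)
    have "norm ((\<integral>u. F (zn n) u \<partial>A n) - (\<integral>u. F z u \<partial>\<alpha>)) < \<epsilon>" if n: "n \<ge> max N N'" for n
    proof -
      interpret prob_space "\<pi> n" by (rule cD(3))
      interpret a: prob_space \<alpha> using PP_D[OF \<alpha>] by simp
      let ?t = "\<lambda>u. indicator {u. R < rho u} u * (1 + rho u)"
      note [measurable] = measurable_PP[OF \<alpha> rho_cont]
      have "integrable \<alpha> (\<lambda>u. 1 + rho u)" using integrable_rho[OF \<alpha>] by simp
      then have ti: "integrable \<alpha> ?t"
        by (rule lebesgue_integrable_bound) (auto simp: indicator_def)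
      have ti': "integrable (\<pi> n) (\<lambda>x. ?t (fst x))" "(\<integral>x. ?t (fst x) \<partial>\<pi> n) = ?T"
        using integrable_distr[OF cD(4)[of n], of ?t] integral_distr[OF cD(4)[of n], of ?t] ti cD(6)[of n]
        by auto
      have "\<bar>(\<integral>u. F z u \<partial>\<alpha>) - (\<integral>u. F (zn n) u \<partial>A n)\<bar> = \<bar>\<integral>x. F z (fst x) - F (zn n) (snd x) \<partial>\<pi> n\<bar>"
        using i1' i2' by simp
      also have "\<dots> \<le> (\<integral>x. \<bar>F z (fst x) - F (zn n) (snd x)\<bar> \<partial>\<pi> n)"
        by (rule integral_abs_bound)
      also have "\<dots> \<le> (\<integral>x. \<epsilon> / 6 + C1 * ?t (fst x) + C2 * cst (fst x) (snd x) \<partial>\<pi> n)"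
      proof (rule integral_mono)
        fix x assume "x \<in> space (\<pi> n)"
        then have x: "fst x \<in> E" "snd x \<in> E" by (simp_all add: cD(2) mem_Times_iff)
        show "\<bar>F z (fst x) - F (zn n) (snd x)\<bar> \<le> \<epsilon> / 6 + C1 * ?t (fst x) + C2 * cst (fst x) (snd x)"
          unfolding C1_def C2_def using d n \<epsilon> R x
          by (intro modulus_pointwise C) auto
      qed (use ti' ci i1' i2' in auto)
      also have "\<dots> = \<epsilon> / 6 + C1 * ?T + C2 * (\<integral>x. cst (fst x) (snd x) \<partial>\<pi> n)"
        using ti' ci by (simp add: prob_space)
      also have "\<dots> \<le> \<epsilon> / 6 + \<epsilon> / 3 + C2 * e n"
        using T cI C2 by (intro add_mono mult_left_mono) auto
      also have "\<dots> < \<epsilon>" using N'[of n] n \<epsilon> by simp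
      finally show ?thesis by simp
    qed
    then show "\<exists>no. \<forall>n\<ge>no. norm ((\<integral>u. F (zn n) u \<partial>A n) - (\<integral>u. F z u \<partial>\<alpha>)) < \<epsilon>" by blast
  qed
qed

section \<open>W_p convergence from convergence of integrals\<close>

lemma partition_of_ball:
  assumes \<eta>: "0 < \<eta>" and R: "0 \<le> R"
  obtains I :: "'u set" and \<phi> :: "'u \<Rightarrow> 'u \<Rightarrow> real" where "finite I"
    "\<And>i. continuous_on E (\<phi> i)" "\<And>i u. 0 \<le> \<phi> i u"
    "\<And>u. u \<in> E \<Longrightarrow> (\<Sum>i\<in>I. \<phi> i u) \<le> 1"
    "\<And>u. u \<in> E \<Longrightarrow> rho u \<le> R \<Longrightarrow> (\<Sum>i\<in>I. \<phi> i u) = 1"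
    "\<And>i u v. \<lbrakk>i \<in> I; u \<in> E; v \<in> E; \<phi> i u \<noteq> 0; \<phi> i v \<noteq> 0\<rbrakk> \<Longrightarrow> cst u v \<le> \<eta>"
proof -
  let ?B = "{u \<in> E. rho u \<le> R + 1}"
  \<comment> \<open>The cost is continuous and vanishes at \<open>(k, k)\<close>, so it is small
    near that point; this bounds the cost diameter of the cells.\<close>
  have "\<exists>r>0. \<forall>u\<in>E. \<forall>v\<in>E. dist k u < r \<and> dist k v < r \<longrightarrow> cst u v < \<eta>" if k: "k \<in> E" for k
  proof -
    obtain d where d: "0 < d" "\<And>z. z \<in> E \<times> E \<Longrightarrow> dist z (k, k) < d \<Longrightarrow> dist (cst (fst z) (snd z)) (cst k k) < \<eta>"
      using cost_cont \<eta> k unfolding continuous_on_iff by (metis SigmaI fst_conv snd_conv)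
    have "cst u v < \<eta>" if "u \<in> E" "v \<in> E" "dist k u < d / 2" "dist k v < d / 2" for u v
    proof -
      have "dist (u, v) (k, k) \<le> dist u k + dist v k"
        using sqrt_sum_squares_le_sum[of "dist u k" "dist v k"] by (simp add: dist_Pair_Pair)
      then have "dist (u, v) (k, k) < d" using that by (simp add: dist_commute)
      then have "dist (cst u v) (cst k k) < \<eta>" using d(2)[of "(u, v)"] that by simp
      then show ?thesis using cost_self[OF k] p_ge by (simp add: dist_real_def)
    qed
    then show ?thesis using d(1) by (intro exI[of _ "d / 2"]) auto
  qed
  then obtain r where r: "\<And>k. k \<in> E \<Longrightarrow> r k > 0"
    "\<And>k u v. \<lbrakk>k \<in> E; u \<in> E; v \<in> E; dist k u < r k; dist k v < r k\<rbrakk> \<Longrightarrow> cst u v < \<eta>"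
    by metis
  have "?B \<subseteq> (\<Union>k\<in>?B. ball k (r k))" using r(1) by force
  then obtain I where I: "I \<subseteq> ?B" "finite I" "?B \<subseteq> (\<Union>k\<in>I. ball k (r k))"
    using compactE_image[OF cost_ball[of "R + 1"], of ?B "\<lambda>k. ball k (r k)"] by (metis (no_types, lifting) open_ball)
  define \<psi> where "\<psi> i u = max 0 (r i - dist i u)" for i u
  \<comment> \<open>An extra function for the complement of the ball: it vanishes where
    \<open>rho u \<le> R\<close>, so that the cells alone sum to 1 there, and is positive beyond, so
    that the total \<open>s\<close> has no zero in E and may be divided by.\<close>
  define \<psi>0 where "\<psi>0 u = max 0 (rho u - R)" for u
  define s where "s u = \<psi>0 u + (\<Sum>i\<in>I. \<psi> i u)" for u
  have nn: "0 \<le> \<psi> i u" "0 \<le> \<psi>0 u" for i u by (auto simp: \<psi>_def \<psi>0_def)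
  have sn: "0 \<le> s u" "(\<Sum>i\<in>I. \<psi> i u) \<le> s u" for u
    using nn by (auto simp: s_def intro!: add_nonneg_nonneg sum_nonneg)
  have sp: "0 < s u" if "u \<in> E" for u
  proof (cases "rho u \<le> R + 1")
    case True
    then have "u \<in> (\<Union>k\<in>I. ball k (r k))" using I(3) that by blast
    then obtain i where i: "i \<in> I" "dist i u < r i" by auto
    have "\<psi> i u \<le> (\<Sum>i\<in>I. \<psi> i u)" by (rule member_le_sum[OF i(1)]) (use nn I in auto)
    moreover have "0 < \<psi> i u" using i by (simp add: \<psi>_def)
    ultimately show ?thesis using nn(2)[of u] by (simp add: s_def)
  next
    case False
    then have "0 < \<psi>0 u" by (simp add: \<psi>0_def)
    then show ?thesis using nn by (auto simp: s_def intro!: add_pos_nonneg sum_nonneg)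
  qed
  have sc: "continuous_on E s"
    unfolding s_def \<psi>_def \<psi>0_def by (intro continuous_intros rho_cont)
  have sm: "(\<Sum>i\<in>I. \<psi> i u / s u) = (\<Sum>i\<in>I. \<psi> i u) / s u" for u by (simp add: sum_divide_distrib)
  show thesis
  proof (rule that[of I "\<lambda>i u. \<psi> i u / s u"])
    show "continuous_on E (\<lambda>u. \<psi> i u / s u)" for i
      using sp sc unfolding \<psi>_def by (intro continuous_intros) (auto simp: less_imp_neq[symmetric] dest: sp)
    show "(\<Sum>i\<in>I. \<psi> i u / s u) \<le> 1" if "u \<in> E" for u
      using sp[OF that] sn(2)[of u] by (simp add: sm)
    show "(\<Sum>i\<in>I. \<psi> i u / s u) = 1" if "u \<in> E" "rho u \<le> R" for u
      using sp[OF that(1)] that(2) unfolding sm by (simp add: s_def \<psi>0_def)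
    show "cst u v \<le> \<eta>" if "i \<in> I" "u \<in> E" "v \<in> E" "\<psi> i u / s u \<noteq> 0" "\<psi> i v / s v \<noteq> 0" for i u v
      using that I(1) by (intro less_imp_le r(2)[of i]) (auto simp: \<psi>_def split: if_splits simp: max_def)
  qed (use I nn sn in auto)
qed

text \<open>The coupling has density \<open>w\<close> with respect to \<open>\<alpha> \<Otimes>\<^sub>M \<beta>\<close>.  It transports the mass \<open>m i\<close> inside the cell
  \<open>i\<close>, at cost at most \<open>\<eta>\<close>, and couples the rest, of densities \<open>k\<close> and \<open>l\<close>, independently.  The factor
  \<open>1 - \<eta>\<close> in \<open>m\<close> keeps the mass of the rest positive, so that one can divide by it.\<close>

lemma partition_coupling:
  fixes \<phi> :: "'i \<Rightarrow> 'u \<Rightarrow> real"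
  assumes \<alpha>: "\<alpha> \<in> PP" and \<beta>: "\<beta> \<in> PP" and \<eta>: "0 < \<eta>" "\<eta> < 1" and I: "finite I"
    and c: "\<And>i. continuous_on E (\<phi> i)" and nn: "\<And>i u. 0 \<le> \<phi> i u"
    and le1: "\<And>u. u \<in> E \<Longrightarrow> (\<Sum>i\<in>I. \<phi> i u) \<le> 1"
    and diam: "\<And>i u v. \<lbrakk>i \<in> I; u \<in> E; v \<in> E; \<phi> i u \<noteq> 0; \<phi> i v \<noteq> 0\<rbrakk> \<Longrightarrow> cst u v \<le> \<eta>"
  defines "a \<equiv> \<lambda>i. \<integral>u. \<phi> i u \<partial>\<alpha>" and "b \<equiv> \<lambda>i. \<integral>u. \<phi> i u \<partial>\<beta>"
  defines "m \<equiv> \<lambda>i. (1 - \<eta>) * min (a i) (b i)"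
  defines "k \<equiv> \<lambda>u. 1 - (\<Sum>i\<in>I. m i / a i * \<phi> i u)" and "l \<equiv> \<lambda>u. 1 - (\<Sum>i\<in>I. m i / b i * \<phi> i u)"
  shows "0 \<le> \<eta> + K * ((\<integral>u. rho u * k u \<partial>\<alpha>) + (\<integral>u. rho u * l u \<partial>\<beta>))" (is ?nonneg)
    and "wasserstein p D \<alpha> \<beta> \<le> (\<eta> + K * ((\<integral>u. rho u * k u \<partial>\<alpha>) + (\<integral>u. rho u * l u \<partial>\<beta>))) powr (1 / p)" (is ?bound)
proof -
  interpret A: prob_space \<alpha> using PP_D[OF \<alpha>] by simp
  interpret B: prob_space \<beta> using PP_D[OF \<beta>] by simp
  interpret P: pair_sigma_finite \<alpha> \<beta> ..
  have sp: "space \<alpha> = E" "space \<beta> = E" using PP_D \<alpha> \<beta> by auto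
  have phi1: "\<phi> i u \<le> 1" if "i \<in> I" "u \<in> E" for i u
    using member_le_sum[of i I "\<lambda>i. \<phi> i u"] nn I that le1[of u] by fastforce
  have ig: "integrable \<gamma> (\<phi> i)" if "\<gamma> \<in> PP" "i \<in> I" for \<gamma> i
    by (rule integrable_growth[OF that(1) c, of _ 1]) (use phi1[OF that(2)] nn in \<open>auto intro!: add_increasing2\<close>)
  have aI: "(\<integral>u. \<phi> i u \<partial>\<alpha>) = a i" and bI: "(\<integral>u. \<phi> i u \<partial>\<beta>) = b i" for i
    by (simp_all add: a_def b_def)
  have ab: "0 \<le> a i" "0 \<le> b i" for i unfolding a_def b_def using nn by (auto intro!: lebesgue_integral_nonneg)
  have m0: "0 \<le> m i" for i unfolding m_def using ab[of i] \<eta> by auto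
  \<comment> \<open>Division by zero gives 0, and \<open>m i\<close> is 0 as soon as one of the two
    masses is; hence the identities also hold for a cell without mass.\<close>
  have ma: "m i / a i \<le> 1" "m i / b i \<le> 1" "m i / a i * a i = m i" "m i / b i * b i = m i" for i
  proof -
    have "min (a i) (b i) * (1 - \<eta>) \<le> a i * 1" "min (a i) (b i) * (1 - \<eta>) \<le> b i * 1"
      using ab[of i] \<eta> by (intro mult_mono; simp)+
    then show "m i / a i \<le> 1" "m i / b i \<le> 1"
      using ab[of i] by (auto simp: m_def divide_le_eq_1 mult.commute)
    show "m i / a i * a i = m i" "m i / b i * b i = m i"
      using ab[of i] by (auto simp: m_def min_def)
  qed
  have kl: "0 \<le> k u" "k u \<le> 1" "0 \<le> l u" "l u \<le> 1" if "u \<in> E" for u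
  proof -
    have "(\<Sum>i\<in>I. m i / a i * \<phi> i u) \<le> (\<Sum>i\<in>I. \<phi> i u)" "(\<Sum>i\<in>I. m i / b i * \<phi> i u) \<le> (\<Sum>i\<in>I. \<phi> i u)"
      using ma nn by (intro sum_mono mult_left_le_one_le; use ab m0 in simp)+
    then show "0 \<le> k u" "0 \<le> l u" using le1[OF that] by (auto simp: k_def l_def)
    show "k u \<le> 1" "l u \<le> 1" using m0 ab nn by (auto simp: k_def l_def intro!: sum_nonneg)
  qed
  have kc: "continuous_on E k" "continuous_on E l"
    unfolding k_def l_def by (intro continuous_intros c)+
  have ki: "integrable \<alpha> k" "integrable \<beta> l"
    using \<alpha> \<beta> kl by (auto intro!: integrable_growth[where C=1] kc simp: add_increasing2)
  have rki: "integrable \<alpha> (\<lambda>u. rho u * k u)" "integrable \<beta> (\<lambda>u. rho u * l u)"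
  proof -
    have "\<bar>rho u * k u\<bar> \<le> 1 * (1 + rho u)" "\<bar>rho u * l u\<bar> \<le> 1 * (1 + rho u)" if "u \<in> E" for u
      using kl[OF that] mult_left_le[of "k u" "rho u"] mult_left_le[of "l u" "rho u"] by auto
    then show "integrable \<alpha> (\<lambda>u. rho u * k u)" "integrable \<beta> (\<lambda>u. rho u * l u)"
      using \<alpha> \<beta> by (auto intro!: integrable_growth[where C=1] continuous_on_mult kc rho_cont)
  qed
  \<comment> \<open>The mass left over after the cells, the same for both marginals; the independent
    coupling of the rest has to be normalized by it.\<close>
  define r where "r = 1 - (\<Sum>i\<in>I. m i)"
  have Ik: "(\<integral>u. k u \<partial>\<alpha>) = r" "(\<integral>u. l u \<partial>\<beta>) = r"
  proof -
    have "(\<integral>u. k u \<partial>\<alpha>) = 1 - (\<Sum>i\<in>I. m i / a i * a i)"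
      unfolding k_def using ig[OF \<alpha>] by (simp add: A.prob_space aI)
    then show "(\<integral>u. k u \<partial>\<alpha>) = r" unfolding ma r_def .
    have "(\<integral>u. l u \<partial>\<beta>) = 1 - (\<Sum>i\<in>I. m i / b i * b i)"
      unfolding l_def using ig[OF \<beta>] by (simp add: B.prob_space bI)
    then show "(\<integral>u. l u \<partial>\<beta>) = r" unfolding ma r_def .
  qed
  have "(\<Sum>i\<in>I. a i) = (\<integral>u. (\<Sum>i\<in>I. \<phi> i u) \<partial>\<alpha>)"
    unfolding a_def using ig[OF \<alpha>] by simp
  also have "\<dots> \<le> (\<integral>u. 1 \<partial>\<alpha>)" using ig[OF \<alpha>] le1 sp by (intro integral_mono) auto
  finally have sa: "(\<Sum>i\<in>I. a i) \<le> 1" by (simp add: A.prob_space)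
  have "(\<Sum>i\<in>I. m i) \<le> (\<Sum>i\<in>I. (1 - \<eta>) * a i)"
    unfolding m_def using \<eta> by (intro sum_mono mult_left_mono) auto
  also have "\<dots> \<le> (1 - \<eta>) * 1" unfolding sum_distrib_left[symmetric] using sa \<eta> by (intro mult_left_mono) auto
  finally have r: "0 < r" "(\<Sum>i\<in>I. m i) \<le> 1" using \<eta> by (auto simp: r_def)
  \<comment> \<open>Inside a cell the mass \<open>m i\<close> is spread as the product of the two
    normalized laws of density \<open>\<phi> i\<close>, hence the weight.\<close>
  define t where "t i = m i / (a i * b i)" for i
  have t0: "0 \<le> t i" for i using m0 ab by (simp add: t_def)
  define w where "w u v = (\<Sum>i\<in>I. t i * \<phi> i u * \<phi> i v) + k u * l v / r" for u v
  have w0: "0 \<le> w u v" if "u \<in> E" "v \<in> E" for u v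
    unfolding w_def using that t0 nn kl r by (intro add_nonneg_nonneg sum_nonneg) auto
  have mab: "t i * b i = m i / a i" "t i * a i = m i / b i" for i
    using ab[of i] by (auto simp: t_def m_def min_def)
  have wI1: "integrable \<beta> (\<lambda>v. w u v)" "(\<integral>v. w u v \<partial>\<beta>) = 1" for u
  proof -
    show "integrable \<beta> (\<lambda>v. w u v)"
      unfolding w_def using ig[OF \<beta>] ki by auto
    have "(\<integral>v. w u v \<partial>\<beta>) = (\<Sum>i\<in>I. t i * \<phi> i u * b i) + k u * r / r"
      unfolding w_def using ig[OF \<beta>] ki Ik by (simp add: bI)
    also have "(\<Sum>i\<in>I. t i * \<phi> i u * b i) = (\<Sum>i\<in>I. m i / a i * \<phi> i u)"
      by (intro sum.cong refl, subst mab(1)[symmetric]) (simp add: ac_simps)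
    finally show "(\<integral>v. w u v \<partial>\<beta>) = 1" using r by (simp add: k_def)
  qed
  have wI2: "integrable \<alpha> (\<lambda>u. w u v)" "(\<integral>u. w u v \<partial>\<alpha>) = 1" for v
  proof -
    show "integrable \<alpha> (\<lambda>u. w u v)"
      unfolding w_def using ig[OF \<alpha>] ki by auto
    have "(\<integral>u. w u v \<partial>\<alpha>) = (\<Sum>i\<in>I. t i * a i * \<phi> i v) + r * l v / r"
      unfolding w_def using ig[OF \<alpha>] ki Ik by (simp add: aI)
    then show "(\<integral>u. w u v \<partial>\<alpha>) = 1" using r unfolding mab by (simp add: l_def)
  qed
  have wn1: "(\<integral>\<^sup>+v. ennreal (w u v) \<partial>\<beta>) = 1" if "u \<in> E" for u
    using wI1[of u] w0[OF that] by (subst nn_integral_eq_integral) (auto simp: sp intro!: AE_I2)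
  have wn2: "(\<integral>\<^sup>+u. ennreal (w u v) \<partial>\<alpha>) = 1" if "v \<in> E" for v
    using wI2[of v] w0[OF _ that] by (subst nn_integral_eq_integral) (auto simp: sp intro!: AE_I2)
  have [measurable]: "\<phi> i \<in> borel_measurable \<alpha>" "\<phi> i \<in> borel_measurable \<beta>" "k \<in> borel_measurable \<alpha>"
    "l \<in> borel_measurable \<beta>" for i
    using \<alpha> \<beta> c kc measurable_PP by auto
  have [measurable]: "(\<lambda>z. w (fst z) (snd z)) \<in> borel_measurable (\<alpha> \<Otimes>\<^sub>M \<beta>)"
    unfolding w_def by measurable
  have [measurable]: "(\<lambda>z. cst (fst z) (snd z)) \<in> borel_measurable (\<alpha> \<Otimes>\<^sub>M \<beta>)"
    using cost_measurable coupling_D(1)[OF \<alpha> \<beta> product_coupling(1)[OF \<alpha> \<beta>]] by blast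
  define \<pi> where "\<pi> = density (\<alpha> \<Otimes>\<^sub>M \<beta>) (\<lambda>z. ennreal (w (fst z) (snd z)))"
  have marginal: "distr \<pi> \<gamma> f = \<gamma>" if f[measurable]: "f \<in> \<alpha> \<Otimes>\<^sub>M \<beta> \<rightarrow>\<^sub>M \<gamma>"
    and eq: "\<And>X. X \<in> sets \<gamma> \<Longrightarrow>
      (\<integral>\<^sup>+z. ennreal (w (fst z) (snd z)) * indicator X (f z) \<partial>(\<alpha> \<Otimes>\<^sub>M \<beta>)) = (\<integral>\<^sup>+u. indicator X u \<partial>\<gamma>)"
    for f and \<gamma> :: "'u measure"
  proof (rule measure_eqI)
    fix X assume "X \<in> sets (distr \<pi> \<gamma> f)"
    then have X[measurable]: "X \<in> sets \<gamma>" by simp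
    have "emeasure (distr \<pi> \<gamma> f) X = (\<integral>\<^sup>+z. ennreal (w (fst z) (snd z)) * indicator X (f z) \<partial>(\<alpha> \<Otimes>\<^sub>M \<beta>))"
      unfolding \<pi>_def by (subst emeasure_distr) (auto simp: emeasure_density indicator_def intro!: nn_integral_cong)
    then show "emeasure (distr \<pi> \<gamma> f) X = emeasure \<gamma> X" using eq[OF X] by simp
  qed simp
  \<comment> \<open>By Tonelli, in one order or the other, a marginal condition becomes the
    statement that the density integrates to 1 in the other variable, which is \<open>wn1\<close> or
    \<open>wn2\<close>.\<close>
  have "distr \<pi> \<alpha> fst = \<alpha>"
  proof (rule marginal)
    fix X assume [measurable]: "X \<in> sets \<alpha>"
    show "(\<integral>\<^sup>+z. ennreal (w (fst z) (snd z)) * indicator X (fst z) \<partial>(\<alpha> \<Otimes>\<^sub>M \<beta>)) = (\<integral>\<^sup>+u. indicator X u \<partial>\<alpha>)"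
      by (subst B.nn_integral_fst[symmetric], measurable, intro nn_integral_cong) (auto simp: indicator_def wn1 sp)
  qed simp
  moreover have "distr \<pi> \<beta> snd = \<beta>"
  proof (rule marginal)
    fix X assume [measurable]: "X \<in> sets \<beta>"
    show "(\<integral>\<^sup>+z. ennreal (w (fst z) (snd z)) * indicator X (snd z) \<partial>(\<alpha> \<Otimes>\<^sub>M \<beta>)) = (\<integral>\<^sup>+u. indicator X u \<partial>\<beta>)"
      by (subst P.nn_integral_snd[symmetric], measurable, intro nn_integral_cong) (auto simp: indicator_def wn2 sp)
  qed simp
  ultimately have cpl: "\<pi> \<in> couplings \<alpha> \<beta>" by (simp add: couplings_def \<pi>_def)
  define L where "L = (\<integral>u. rho u * l u \<partial>\<beta>)"
  have L0: "0 \<le> L" unfolding L_def using kl sp by (intro integral_nonneg_AE AE_I2) auto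
  \<comment> \<open>An integrable majorant of the cost density: in the cells the cost is at most
    \<open>\<eta>\<close>, on the rest the quasi-triangle inequality through \<open>u0\<close>
    splits it into a function of u plus a function of v.\<close>
  define q where "q u v = \<eta> * (\<Sum>i\<in>I. t i * \<phi> i u * \<phi> i v)
      + K / r * (rho u * k u * l v + k u * (rho v * l v))" for u v
  have wq: "w u v * cst u v \<le> q u v" if u: "u \<in> E" and v: "v \<in> E" for u v
  proof -
    have "t i * \<phi> i u * \<phi> i v * cst u v \<le> \<eta> * (t i * \<phi> i u * \<phi> i v)" if "i \<in> I" for i
    proof (cases "\<phi> i u = 0 \<or> \<phi> i v = 0")
      case False
      then show ?thesis
        using mult_left_mono[OF diam[OF that u v], of "t i * \<phi> i u * \<phi> i v"] t0[of i] nn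
        by (simp add: mult.commute)
    qed auto
    then have 1: "(\<Sum>i\<in>I. t i * \<phi> i u * \<phi> i v) * cst u v
       \<le> \<eta> * (\<Sum>i\<in>I. t i * \<phi> i u * \<phi> i v)"
      unfolding sum_distrib_left sum_distrib_right by (rule sum_mono)
    have "cst u0 v = rho v" by (subst cost_sym) (rule refl)
    then have "cst u v \<le> K * (rho u + rho v)"
      using cost_tri[OF u v ref] by simp
    then have "k u * l v / r * cst u v \<le> k u * l v / r * (K * (rho u + rho v))"
      using kl[OF u] kl[OF v] r by (intro mult_left_mono) auto
    also have "\<dots> = K / r * (rho u * k u * l v + k u * (rho v * l v))" by (simp add: algebra_simps add_divide_distrib)
    finally show ?thesis using 1 unfolding w_def q_def by (simp add: algebra_simps)
  qed
  have q1: "integrable \<beta> (\<lambda>v. q u v)" for u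
    unfolding q_def using ig[OF \<beta>] ki rki by auto
  have q1': "(\<integral>v. q u v \<partial>\<beta>) = \<eta> * (\<Sum>i\<in>I. m i / a i * \<phi> i u) + K * (rho u * k u) + K / r * L * k u" for u
  proof -
    have "(\<integral>v. q u v \<partial>\<beta>) = \<eta> * (\<Sum>i\<in>I. t i * \<phi> i u * b i) + K / r * (rho u * k u * r + k u * L)"
      unfolding q_def using ig[OF \<beta>] ki rki Ik by (simp add: bI L_def)
    also have "(\<Sum>i\<in>I. t i * \<phi> i u * b i) = (\<Sum>i\<in>I. m i / a i * \<phi> i u)"
      by (intro sum.cong refl, subst mab(1)[symmetric]) (simp add: ac_simps)
    finally show ?thesis using r by (simp add: field_simps)
  qed
  let ?Q = "\<lambda>u. \<integral>v. q u v \<partial>\<beta>"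
  have Qi: "integrable \<alpha> ?Q" unfolding q1' using ig[OF \<alpha>] ki rki by auto
  have "(\<integral>u. ?Q u \<partial>\<alpha>) = \<eta> * (\<Sum>i\<in>I. m i / a i * a i) + K * (\<integral>u. rho u * k u \<partial>\<alpha>) + K / r * L * r"
    unfolding q1' using ig[OF \<alpha>] ki rki Ik by (simp add: aI)
  also have "\<dots> = \<eta> * (\<Sum>i\<in>I. m i) + K * ((\<integral>u. rho u * k u \<partial>\<alpha>) + L)"
    using r unfolding ma by (simp add: algebra_simps)
  also have "\<dots> \<le> \<eta> * 1 + K * ((\<integral>u. rho u * k u \<partial>\<alpha>) + L)"
    using r \<eta> by (intro add_mono mult_left_mono order_refl) auto
  finally have Q: "(\<integral>u. ?Q u \<partial>\<alpha>) \<le> \<eta> + K * ((\<integral>u. rho u * k u \<partial>\<alpha>) + L)" by simp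
  have "(\<integral>\<^sup>+z. ennreal (cst (fst z) (snd z)) \<partial>\<pi>) =
    (\<integral>\<^sup>+z. ennreal (w (fst z) (snd z)) * ennreal (cst (fst z) (snd z)) \<partial>(\<alpha> \<Otimes>\<^sub>M \<beta>))"
    unfolding \<pi>_def by (rule nn_integral_density) auto
  also have "\<dots> = (\<integral>\<^sup>+u. \<integral>\<^sup>+v. ennreal (w u v) * ennreal (cst u v) \<partial>\<beta> \<partial>\<alpha>)"
    by (subst B.nn_integral_fst[symmetric]) auto
  also have "\<dots> \<le> (\<integral>\<^sup>+u. \<integral>\<^sup>+v. ennreal (q u v) \<partial>\<beta> \<partial>\<alpha>)"
    using wq w0 by (intro nn_integral_mono) (auto simp: sp ennreal_mult'[symmetric] intro!: ennreal_leI)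
  also have "\<dots> = (\<integral>\<^sup>+u. ennreal (?Q u) \<partial>\<alpha>)"
  proof (intro nn_integral_cong nn_integral_eq_integral q1 AE_I2)
    fix u v assume "u \<in> space \<alpha>" "v \<in> space \<beta>"
    then have uv: "u \<in> E" "v \<in> E" by (auto simp: sp)
    then have "0 \<le> w u v * cst u v" using w0[of u v] by simp
    then show "0 \<le> q u v" using wq[OF uv] by linarith
  qed
  also have "\<dots> = ennreal (\<integral>u. ?Q u \<partial>\<alpha>)"
  proof (intro nn_integral_eq_integral Qi AE_I2)
    fix u assume "u \<in> space \<alpha>"
    then have u: "u \<in> E" by (simp add: sp)
    show "0 \<le> ?Q u"
      unfolding q1' using \<eta> m0 ab nn kl[OF u] K_pos r L0
      by (intro add_nonneg_nonneg mult_nonneg_nonneg sum_nonneg divide_nonneg_nonneg) auto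
  qed
  also have "\<dots> \<le> ennreal (\<eta> + K * ((\<integral>u. rho u * k u \<partial>\<alpha>) + L))"
    using Q by (rule ennreal_leI)
  finally have *: "(\<integral>\<^sup>+z. ennreal (cst (fst z) (snd z)) \<partial>\<pi>) \<le> ennreal (\<eta> + K * ((\<integral>u. rho u * k u \<partial>\<alpha>) + L))" .
  have "0 \<le> (\<integral>u. rho u * k u \<partial>\<alpha>)" using kl sp by (intro integral_nonneg_AE AE_I2) auto
  then show n: ?nonneg using \<eta> K_pos L0 by (simp add: L_def)
  show ?bound using wasserstein_le[OF cpl *] n by (simp add: L_def)
qed

lemma min_ratio_tendsto:
  fixes a :: real
  assumes "b \<longlonglongrightarrow> a" "0 < a"
  shows "(\<lambda>n. c * min a (b n) / a) \<longlonglongrightarrow> c" "(\<lambda>n. c * min a (b n) / b n) \<longlonglongrightarrow> c"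
proof -
  have "(\<lambda>n. c * min a (b n) / a) \<longlonglongrightarrow> c * min a a / a" "(\<lambda>n. c * min a (b n) / b n) \<longlonglongrightarrow> c * min a a / a"
    using assms by (intro tendsto_intros; simp)+
  then show "(\<lambda>n. c * min a (b n) / a) \<longlonglongrightarrow> c" "(\<lambda>n. c * min a (b n) / b n) \<longlonglongrightarrow> c"
    using assms by simp_all
qed

text \<open>For a fixed partition the bound of \<open>partition_coupling\<close> involves
  \<open>A n\<close> only through the integrals of \<open>rho\<close>, of the
  \<open>\<phi> i\<close> and of their products with \<open>rho\<close>, finitely many functions of
  growth p. Its limit is the bound for \<open>\<alpha>\<close> against itself, which is small by the
  choice of the partition: it comes only from \<open>\<eta>\<close> and from the part of
  \<open>\<alpha>\<close> outside the ball.\<close>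

theorem wasserstein_tendsto:
  assumes \<alpha>: "\<alpha> \<in> PP" and A: "\<And>n. A n \<in> PP"
    and test: "\<And>\<phi> C. continuous_on E \<phi> \<Longrightarrow> (\<And>u. u \<in> E \<Longrightarrow> \<bar>\<phi> u\<bar> \<le> C * (1 + rho u)) \<Longrightarrow>
      (\<lambda>n. \<integral>u. \<phi> u \<partial>A n) \<longlonglongrightarrow> (\<integral>u. \<phi> u \<partial>\<alpha>)"
  shows "(\<lambda>n. wasserstein p D \<alpha> (A n)) \<longlonglongrightarrow> 0"
proof (rule LIMSEQ_I)
  fix \<epsilon> :: real assume \<epsilon>: "0 < \<epsilon>"
  interpret a: prob_space \<alpha> using PP_D[OF \<alpha>] by simp
  note [measurable] = measurable_PP[OF \<alpha> rho_cont]
  \<comment> \<open>Half of \<open>\<epsilon>\<close>, so that the non-strict bound by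
    \<open>e powr (1 / p)\<close> at the end is strictly below \<open>\<epsilon>\<close>.\<close>
  define e where "e = (\<epsilon> / 2) powr p"
  have e: "0 < e" "e powr (1 / p) = \<epsilon> / 2" using \<epsilon> p_ge by (auto simp: e_def powr_powr)
  define m1 where "m1 = (\<integral>u. rho u \<partial>\<alpha>)"
  have m1: "0 \<le> m1" unfolding m1_def by (intro lebesgue_integral_nonneg) auto
  \<comment> \<open>The limit of the bound will be at most \<open>\<eta> * c\<close> plus
    \<open>2 * K\<close> times a tail integral; with \<open>\<eta> * c \<le> e / 4\<close> and the
    tail below \<open>e / (8 * K)\<close> it stays below e.\<close>
  define c where "c = 1 + 2 * K * m1"
  have c: "0 < c" using K_pos m1 by (simp add: c_def add_pos_nonneg)
  define \<eta> where "\<eta> = min (1 / 2) (e / (4 * c))"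
  have \<eta>: "0 < \<eta>" "\<eta> < 1" using e c by (auto simp: \<eta>_def)
  have "\<eta> * c \<le> e / (4 * c) * c"
    using c by (intro mult_right_mono) (auto simp: \<eta>_def)
  then have \<eta>': "\<eta> * (1 + 2 * K * m1) \<le> e / 4" using c by (simp add: c_def[symmetric])
  have "0 < e / (8 * K)" using e K_pos by simp
  from tail_integral_small[OF \<alpha> this] obtain R where R: "0 \<le> R"
    "(\<integral>u. indicator {u. R < rho u} u * (1 + rho u) \<partial>\<alpha>) < e / (8 * K)" (is "?T < _") by blast
  obtain I :: "'u set" and \<phi> :: "'u \<Rightarrow> 'u \<Rightarrow> real" where I: "finite I" and \<phi>:
    "\<And>i. continuous_on E (\<phi> i)" "\<And>i u. 0 \<le> \<phi> i u"
    "\<And>u. u \<in> E \<Longrightarrow> (\<Sum>i\<in>I. \<phi> i u) \<le> 1"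
    "\<And>u. u \<in> E \<Longrightarrow> rho u \<le> R \<Longrightarrow> (\<Sum>i\<in>I. \<phi> i u) = 1"
    "\<And>i u v. \<lbrakk>i \<in> I; u \<in> E; v \<in> E; \<phi> i u \<noteq> 0; \<phi> i v \<noteq> 0\<rbrakk> \<Longrightarrow> cst u v \<le> \<eta>"
    by (rule partition_of_ball[OF \<eta>(1) R(1)]) blast
  have phi1: "\<phi> i u \<le> 1" if "i \<in> I" "u \<in> E" for i u
    using member_le_sum[of i I "\<lambda>i. \<phi> i u"] \<phi>(2) I that \<phi>(3)[of u] by fastforce
  have gr: "\<bar>\<phi> i u\<bar> \<le> 1 * (1 + rho u)" "\<bar>rho u * \<phi> i u\<bar> \<le> 1 * (1 + rho u)" if "i \<in> I" "u \<in> E" for i u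
    using phi1[OF that] \<phi>(2)[of i u] mult_left_le[of "\<phi> i u" "rho u"] by (auto intro: add_increasing2)
  have rc: "continuous_on E (\<lambda>u. rho u * \<phi> i u)" for i by (intro continuous_on_mult rho_cont \<phi>)
  have ig: "integrable \<gamma> (\<phi> i)" "integrable \<gamma> (\<lambda>u. rho u * \<phi> i u)" if "\<gamma> \<in> PP" "i \<in> I" for \<gamma> i
    using gr[OF that(2)] by (auto intro!: integrable_growth[OF that(1), of _ 1] \<phi>(1) rc)
  define a where "a i = (\<integral>u. \<phi> i u \<partial>\<alpha>)" for i
  define P where "P i = (\<integral>u. rho u * \<phi> i u \<partial>\<alpha>)" for i
  define b where "b n i = (\<integral>u. \<phi> i u \<partial>A n)" for n i
  define Q where "Q n i = (\<integral>u. rho u * \<phi> i u \<partial>A n)" for n i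
  define m where "m n i = (1 - \<eta>) * min (a i) (b n i)" for n i
  have bl: "(\<lambda>n. b n i) \<longlonglongrightarrow> a i" if "i \<in> I" for i
    unfolding a_def b_def using gr(1)[OF that] by (intro test[of _ 1] \<phi>)
  have Ql: "(\<lambda>n. Q n i) \<longlonglongrightarrow> P i" if "i \<in> I" for i
    unfolding P_def Q_def using gr(2)[OF that] by (intro test[of _ 1] rc)
  have a0: "0 \<le> a i" "0 \<le> b n i" for n i
    unfolding a_def b_def using \<phi>(2) by (auto intro!: lebesgue_integral_nonneg)
  have lim: "(\<lambda>n. m n i / a i * P i) \<longlonglongrightarrow> (1 - \<eta>) * P i" "(\<lambda>n. m n i / b n i * Q n i) \<longlonglongrightarrow> (1 - \<eta>) * P i"
    if i: "i \<in> I" for i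
  proof -
    have "(\<lambda>n. m n i / a i * P i) \<longlonglongrightarrow> (1 - \<eta>) * P i \<and> (\<lambda>n. m n i / b n i * Q n i) \<longlonglongrightarrow> (1 - \<eta>) * P i"
    \<comment> \<open>A cell without \<open>\<alpha>\<close>-mass may carry \<open>A n\<close>-mass,
      but then nothing is transported in it; away from this case the ratios converge.\<close>
    proof (cases "a i = 0")
      case True
      have "AE u in \<alpha>. \<phi> i u = 0"
        using True integral_nonneg_eq_0_iff_AE[OF ig(1)[OF \<alpha> i]] \<phi>(2) by (simp add: a_def)
      then have "P i = (\<integral>u. 0 \<partial>\<alpha>)"
        unfolding P_def by (intro integral_cong_AE measurable_PP[OF \<alpha> rc]) auto
      then have "P i = 0" by simp
      moreover have "m n i = 0" for n using True a0(2)[of n i] by (simp add: m_def)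
      ultimately show ?thesis by simp
    next
      case False
      then have "0 < a i" using a0(1)[of i] by linarith
      from min_ratio_tendsto[OF bl[OF i] this, of "1 - \<eta>"]
      show ?thesis unfolding m_def by (intro conjI tendsto_mult tendsto_const Ql[OF i])
    qed
    then show "(\<lambda>n. m n i / a i * P i) \<longlonglongrightarrow> (1 - \<eta>) * P i" "(\<lambda>n. m n i / b n i * Q n i) \<longlonglongrightarrow> (1 - \<eta>) * P i" by auto
  qed
  define X where "X = m1 - (1 - \<eta>) * (\<Sum>i\<in>I. P i)"
  have split: "(\<integral>u. rho u * (1 - (\<Sum>i\<in>I. w i * \<phi> i u)) \<partial>\<gamma>) =
      (\<integral>u. rho u \<partial>\<gamma>) - (\<Sum>i\<in>I. w i * (\<integral>u. rho u * \<phi> i u \<partial>\<gamma>))" if \<gamma>: "\<gamma> \<in> PP" for w \<gamma>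
  proof -
    have "(\<integral>u. rho u * (1 - (\<Sum>i\<in>I. w i * \<phi> i u)) \<partial>\<gamma>) = (\<integral>u. rho u - (\<Sum>i\<in>I. w i * (rho u * \<phi> i u)) \<partial>\<gamma>)"
      by (intro lebesgue_integral_cong refl) (simp add: right_diff_distrib sum_distrib_left ac_simps)
    then show ?thesis using ig(2)[OF \<gamma>] integrable_rho[OF \<gamma>] by simp
  qed
  note X1 = split[OF \<alpha>, folded m1_def P_def] and X2 = split[OF A, folded Q_def]
  define Z where "Z n = \<eta> + K * ((m1 - (\<Sum>i\<in>I. m n i / a i * P i)) + ((\<integral>u. rho u \<partial>A n) - (\<Sum>i\<in>I. m n i / b n i * Q n i)))" for n
  have Z: "0 \<le> Z n" "wasserstein p D \<alpha> (A n) \<le> Z n powr (1 / p)" for n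
    using partition_coupling[OF \<alpha> A[of n] \<eta> I \<phi>(1-3,5)]
    unfolding a_def[symmetric] b_def[symmetric] m_def[symmetric] X1 X2 Z_def[symmetric] by auto
  have "(\<lambda>n. \<integral>u. rho u \<partial>A n) \<longlonglongrightarrow> m1"
    unfolding m1_def by (rule test[of _ 1]) (auto intro: rho_cont)
  then have "Z \<longlonglongrightarrow> \<eta> + K * ((m1 - (\<Sum>i\<in>I. (1 - \<eta>) * P i)) + (m1 - (\<Sum>i\<in>I. (1 - \<eta>) * P i)))"
    unfolding Z_def by (intro tendsto_intros lim)
  then have Zl: "Z \<longlonglongrightarrow> \<eta> + 2 * K * X"
    by (simp add: X_def sum_distrib_left algebra_simps)
  have "m1 - (\<Sum>i\<in>I. P i) = (\<integral>u. rho u - (\<Sum>i\<in>I. rho u * \<phi> i u) \<partial>\<alpha>)"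
    using ig(2)[OF \<alpha>] integrable_rho[OF \<alpha>] by (simp add: m1_def P_def)
  also have "\<dots> \<le> ?T"
  proof (rule integral_mono)
    have "integrable \<alpha> (\<lambda>u. 1 + rho u)" using integrable_rho[OF \<alpha>] by simp
    then show "integrable \<alpha> (\<lambda>u. indicator {u. R < rho u} u * (1 + rho u))"
      by (rule lebesgue_integrable_bound) (auto simp: indicator_def)
    fix u assume "u \<in> space \<alpha>"
    then have u: "u \<in> E" using PP_D(3)[OF \<alpha>] by simp
    have "rho u - (\<Sum>i\<in>I. rho u * \<phi> i u) = rho u * (1 - (\<Sum>i\<in>I. \<phi> i u))"
      by (simp add: right_diff_distrib sum_distrib_left)
    moreover have "0 \<le> rho u * (\<Sum>i\<in>I. \<phi> i u)" using \<phi>(2) by (intro mult_nonneg_nonneg sum_nonneg) auto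
    ultimately show "rho u - (\<Sum>i\<in>I. rho u * \<phi> i u) \<le> indicator {u. R < rho u} u * (1 + rho u)"
      using \<phi>(4)[OF u] by (cases "R < rho u") (auto simp: right_diff_distrib)
  qed (use ig(2)[OF \<alpha>] integrable_rho[OF \<alpha>] in auto)
  finally have PT: "m1 - (\<Sum>i\<in>I. P i) \<le> ?T" .
  have T0: "0 \<le> ?T" by (intro lebesgue_integral_nonneg) auto
  \<comment> \<open>The two sources of cost outside the cells: the factor \<open>1 - \<eta>\<close>
    loses \<open>\<eta> * m1\<close>, and the cells miss what lies outside the ball.\<close>
  have "X = \<eta> * m1 + (1 - \<eta>) * (m1 - (\<Sum>i\<in>I. P i))" by (simp add: X_def algebra_simps)
  also have "\<dots> \<le> \<eta> * m1 + (1 - \<eta>) * ?T" using PT \<eta> by (intro add_left_mono mult_left_mono) auto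
  also have "\<dots> \<le> \<eta> * m1 + 1 * ?T" using T0 \<eta> by (intro add_left_mono mult_right_mono) auto
  also have "\<dots> \<le> \<eta> * m1 + e / (8 * K)" using R by simp
  finally have "2 * K * X \<le> 2 * K * (\<eta> * m1 + e / (8 * K))" using K_pos by (intro mult_left_mono) auto
  also have "\<dots> = 2 * K * \<eta> * m1 + e / 4" using K_pos by (simp add: field_simps)
  finally have "\<eta> + 2 * K * X \<le> \<eta> * (1 + 2 * K * m1) + e / 4" by (simp add: algebra_simps)
  then have "\<eta> + 2 * K * X < e" using \<eta>' e by linarith
  then have "\<forall>\<^sub>F n in sequentially. Z n < e" using Zl by (intro order_tendstoD)
  then obtain N where N: "\<And>n. n \<ge> N \<Longrightarrow> Z n < e" by (auto simp: eventually_sequentially)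
  have "norm (wasserstein p D \<alpha> (A n) - 0) < \<epsilon>" if "n \<ge> N" for n
  proof -
    have "Z n powr (1 / p) \<le> e powr (1 / p)" using N[OF that] Z(1)[of n] p_ge by (intro powr_mono2) auto
    then have "wasserstein p D \<alpha> (A n) \<le> \<epsilon> / 2" using Z(2)[of n] e by simp
    moreover have "0 \<le> wasserstein p D \<alpha> (A n)" by (simp add: wasserstein_def)
    ultimately show ?thesis using \<epsilon> by simp
  qed
  then show "\<exists>no. \<forall>n\<ge>no. norm (wasserstein p D \<alpha> (A n) - 0) < \<epsilon>" by blast
qed

end

section \<open>Path spaces\<close>

lemma tendsto_fun_iff:
  fixes f :: "'a \<Rightarrow> 'i \<Rightarrow> 'b::topological_space"
  shows "(f \<longlongrightarrow> l) F \<longleftrightarrow> (\<forall>i. ((\<lambda>x. f x i) \<longlongrightarrow> l i) F)"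
  using limitin_componentwise[of "\<lambda>_. euclidean" UNIV f l F]
  by (simp add: euclidean_product_topology)

text \<open>Extensional functions form a full product with the factor \<open>{undefined}\<close> at
  every index outside I, so Tychonoff's theorem applies in the topology of the function
  space.\<close>

lemma compact_PiE:
  fixes Z :: "'i \<Rightarrow> 'b::topological_space set"
  assumes "\<And>i. i \<in> I \<Longrightarrow> compact (Z i)"
  shows "compact (PiE I Z)"
proof -
  have "PiE I Z = PiE UNIV (\<lambda>i. if i \<in> I then Z i else {undefined})"
    by (auto simp: PiE_def extensional_def Pi_def split: if_splits; metis singletonD)
  moreover have "compactin (product_topology (\<lambda>_. euclidean) UNIV) (PiE UNIV (\<lambda>i. if i \<in> I then Z i else {undefined}))"
    using assms by (subst compactin_PiE) auto
  ultimately show ?thesis by (simp add: euclidean_product_topology)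
qed

text \<open>Countability of the index set identifies the product sigma-algebra with the Borel sets
  of the product topology. This gives paths a topology compatible with \<open>path_space\<close>, so
  that continuity proves measurability.\<close>

lemma sets_path_space:
  fixes Z :: "nat \<Rightarrow> (real ^ 'd::finite) set"
  shows "sets (path_space Z I) = sets (restrict_space borel (PiE I Z))"
proof (rule sets_eq_measurable_ident)
  have sp: "space (path_space Z I) = PiE I Z"
    by (simp add: path_space_def space_PiM state_space_def space_restrict_space)
  then show "space (path_space Z I) = space (restrict_space borel (PiE I Z))"
    by (simp add: space_restrict_space)
  show "(\<lambda>x. x) \<in> path_space Z I \<rightarrow>\<^sub>M restrict_space borel (PiE I Z)"
  proof (rule measurable_restrict_space2)
    have "(\<lambda>x. x) \<in> path_space Z I \<rightarrow>\<^sub>M PiM UNIV (\<lambda>_. borel :: (real ^ 'd) measure)"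
    proof (rule measurable_PiM_single')
      fix i :: nat
      show "(\<lambda>x. x i) \<in> borel_measurable (path_space Z I)"
      proof (cases "i \<in> I")
        case True
        have "(\<lambda>x. x i) \<in> path_space Z I \<rightarrow>\<^sub>M state_space Z i"
          unfolding path_space_def by (rule measurable_component_singleton[OF True])
        then show ?thesis
          unfolding state_space_def by (simp add: measurable_restrict_space2_iff)
      next
        case False
        have "(\<lambda>x. undefined) \<in> borel_measurable (path_space Z I)" by simp
        then show ?thesis
          using False by (subst measurable_cong[where g="\<lambda>_. undefined"]) (auto simp: sp)
      qed
    qed auto
    then show "(\<lambda>x. x) \<in> borel_measurable (path_space Z I)"
      using measurable_cong_sets[OF refl sets_PiM_equal_borel] by blast
  qed (auto simp: sp)
  show "(\<lambda>x. x) \<in> restrict_space borel (PiE I Z) \<rightarrow>\<^sub>M path_space Z I"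
    unfolding path_space_def
  proof (rule measurable_PiM_single')
    fix i assume "i \<in> I"
    then show "(\<lambda>x. x i) \<in> restrict_space borel (PiE I Z) \<rightarrow>\<^sub>M state_space Z i"
      unfolding state_space_def
      by (intro measurable_restrict_space2 borel_measurable_continuous_on_restrict
            continuous_on_subset[OF continuous_on_product_coordinates subset_UNIV])
         (auto simp: space_restrict_space)
  qed (auto simp: space_restrict_space state_space_def)
qed

section \<open>Powers of the product metrics\<close>

lemma powr_quasi_triangle:
  assumes "0 \<le> (x::real)" "0 \<le> y" "0 \<le> z" "z \<le> x + y" "0 \<le> p"
  shows "z powr p \<le> 2 powr p * (x powr p + y powr p)"
proof -
  have "z powr p \<le> (2 * max x y) powr p" using assms by (intro powr_mono2) auto
  also have "\<dots> = 2 powr p * max x y powr p" using assms by (simp add: powr_mult)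
  also have "\<dots> \<le> 2 powr p * (x powr p + y powr p)"
    by (intro mult_left_mono) (auto simp: max_def)
  finally show ?thesis .
qed

lemma norm_powr_quasi_triangle:
  fixes a b c :: "'a::real_normed_vector"
  assumes "0 \<le> p"
  shows "norm (a - b) powr p \<le> 2 powr p * (norm (a - c) powr p + norm (c - b) powr p)"
  using norm_triangle_ineq[of "a - c" "c - b"] assms by (intro powr_quasi_triangle) auto

text \<open>This is the p-th power of \<open>jdist\<close> (see \<open>jdist_powr\<close>); without
  the outer root it is a finite sum of continuous terms.\<close>

definition pcost :: "real \<Rightarrow> nat set \<Rightarrow> ('d::finite) path \<times> 'd path \<Rightarrow> 'd path \<times> 'd path \<Rightarrow> real" where
  "pcost p I z z' = (\<Sum>s\<in>I. norm (fst z s - fst z' s) powr p + norm (snd z s - snd z' s) powr p)"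

abbreviation jdist :: "real \<Rightarrow> nat set \<Rightarrow> ('d::finite) path \<times> 'd path \<Rightarrow> 'd path \<times> 'd path \<Rightarrow> real" where
  "jdist p I \<equiv> pair_dist p (path_dist p I) (path_dist p I)"

abbreviation jset :: "(nat \<Rightarrow> (real ^ 'd) set) \<Rightarrow> (nat \<Rightarrow> (real ^ 'd) set) \<Rightarrow> nat set \<Rightarrow> (('d::finite) path \<times> 'd path) set" where
  "jset Z W I \<equiv> PiE I Z \<times> PiE I W"

lemma path_dist_powr: "1 \<le> p \<Longrightarrow> path_dist p I x x' powr p = (\<Sum>s\<in>I. norm (x s - x' s) powr p)"
  by (simp add: path_dist_def powr_powr sum_nonneg)

lemma path_dist_nonneg: "0 \<le> path_dist p I x x'"
  by (simp add: path_dist_def)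

lemma pair_dist_powr: "1 \<le> p \<Longrightarrow> pair_dist p d1 d2 z z' powr p = d1 (fst z) (fst z') powr p + d2 (snd z) (snd z') powr p"
  by (auto simp: pair_dist_def powr_powr)

lemma pair_dist_nonneg: "0 \<le> pair_dist p d1 d2 z z'"
  by (simp add: pair_dist_def)

lemma jdist_powr: "1 \<le> p \<Longrightarrow> jdist p I z z' powr p = pcost p I z z'"
  by (simp add: pair_dist_powr path_dist_powr pcost_def sum.distrib)

lemma pcost_nonneg: "0 \<le> pcost p I z z'"
  by (auto simp: pcost_def intro!: sum_nonneg)

lemma pcost_self: "pcost p I z z = 0"
  by (simp add: pcost_def)

lemma pcost_tri:
  assumes "0 \<le> p"
  shows "pcost p I z z' \<le> 2 powr p * (pcost p I z w + pcost p I w z')"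
proof -
  have "pcost p I z z' \<le> (\<Sum>s\<in>I. 2 powr p * (norm (fst z s - fst w s) powr p + norm (fst w s - fst z' s) powr p) +
      2 powr p * (norm (snd z s - snd w s) powr p + norm (snd w s - snd z' s) powr p))"
    unfolding pcost_def by (intro sum_mono add_mono norm_powr_quasi_triangle assms)
  also have "\<dots> = 2 powr p * (pcost p I z w + pcost p I w z')"
    unfolding pcost_def sum.distrib[symmetric] sum_distrib_left by (intro sum.cong refl) (simp add: algebra_simps)
  finally show ?thesis .
qed

lemma continuous_on_norm_powr:
  assumes "continuous_on S f" "continuous_on S g" "0 < p"
  shows "continuous_on S (\<lambda>z. norm (f z - g z) powr p :: real)"
  using assms by (intro continuous_on_powr' continuous_intros) auto

lemma continuous_on_pcost:
  fixes S :: "(('d::finite path \<times> 'd path) \<times> 'd path \<times> 'd path) set"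
  assumes "0 < p"
  shows "continuous_on S (\<lambda>z. pcost p I (fst z) (snd z))"
proof -
  have "continuous_on S (\<lambda>z :: ('d path \<times> 'd path) \<times> 'd path \<times> 'd path. fst (fst z) s)"
    "continuous_on S (\<lambda>z :: ('d path \<times> 'd path) \<times> 'd path \<times> 'd path. fst (snd z) s)"
    "continuous_on S (\<lambda>z :: ('d path \<times> 'd path) \<times> 'd path \<times> 'd path. snd (fst z) s)"
    "continuous_on S (\<lambda>z :: ('d path \<times> 'd path) \<times> 'd path \<times> 'd path. snd (snd z) s)" for s
    by (rule continuous_on_product_then_coordinatewise,
        intro continuous_on_fst continuous_on_snd continuous_on_id)+
  then show ?thesis
    unfolding pcost_def by (intro continuous_on_sum continuous_on_add continuous_on_norm_powr assms)
qed

lemma pcost_coord_le: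
  assumes "finite I" "s \<in> I"
  shows "norm (fst z s - fst z' s) powr p \<le> pcost p I z z'" (is ?fst) "norm (snd z s - snd z' s) powr p \<le> pcost p I z z'" (is ?snd)
proof -
  have "norm (fst z s - fst z' s) powr p + norm (snd z s - snd z' s) powr p \<le> pcost p I z z'"
    unfolding pcost_def by (rule member_le_sum[OF assms(2)]) (use assms in auto)
  then show ?fst ?snd
    by (smt (verit) powr_ge_zero)+
qed

lemma tendsto_of_norm_powr:
  fixes x :: "nat \<Rightarrow> 'a::real_normed_vector"
  assumes "(\<lambda>n. norm (l - x n) powr p) \<longlonglongrightarrow> 0" "0 < p"
  shows "x \<longlonglongrightarrow> l"
proof -
  have "(\<lambda>n. (norm (l - x n) powr p) powr (1 / p)) \<longlonglongrightarrow> 0"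
    using assms by (intro tendsto_zero_powrI[OF assms(1) tendsto_const]) auto
  then have "(\<lambda>n. norm (x n - l)) \<longlonglongrightarrow> 0"
    using assms(2) by (simp add: powr_powr norm_minus_commute)
  then show ?thesis by (simp add: tendsto_norm_zero_iff LIM_zero_iff)
qed

text \<open>Extensionality freezes all coordinates outside I, so the finitely many terms of
  \<open>pcost\<close> control convergence in the product topology. This bridge lets continuity with
  respect to the path metrics be handled by \<open>continuous_on\<close>.\<close>

lemma pcost_tendsto_iff:
  assumes "finite I" "0 < p" "z \<in> jset Z W I" "\<And>n. zn n \<in> jset Z W I"
  shows "(\<lambda>n. pcost p I z (zn n)) \<longlonglongrightarrow> 0 \<longleftrightarrow> zn \<longlonglongrightarrow> z"
proof
  assume L: "(\<lambda>n. pcost p I z (zn n)) \<longlonglongrightarrow> 0"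
  have nl: "(\<lambda>n. norm (fst z s - fst (zn n) s) powr p) \<longlonglongrightarrow> 0" "(\<lambda>n. norm (snd z s - snd (zn n) s) powr p) \<longlonglongrightarrow> 0" if "s \<in> I" for s
    by (rule tendsto_sandwich[OF always_eventually always_eventually tendsto_const L];
        simp add: pcost_coord_le[OF assms(1) that])+
  have off: "fst (zn n) s = fst z s" "snd (zn n) s = snd z s" if "s \<notin> I" for s n
    using assms(3) assms(4)[of n] that by (auto simp: mem_Times_iff PiE_iff extensional_def)
  have "(\<lambda>n. fst (zn n) s) \<longlonglongrightarrow> fst z s \<and> (\<lambda>n. snd (zn n) s) \<longlonglongrightarrow> snd z s" for s
  proof (cases "s \<in> I")
    case True
    then show ?thesis using tendsto_of_norm_powr[OF nl(1) assms(2)] tendsto_of_norm_powr[OF nl(2) assms(2)] by simp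
  qed (simp add: off)
  then have "(\<lambda>n. fst (zn n)) \<longlonglongrightarrow> fst z" "(\<lambda>n. snd (zn n)) \<longlonglongrightarrow> snd z"
    by (simp_all add: tendsto_fun_iff)
  from tendsto_Pair[OF this] show "zn \<longlonglongrightarrow> z" by simp
next
  assume R: "zn \<longlonglongrightarrow> z"
  have "(\<lambda>n. pcost p I (fst (z, zn n)) (snd (z, zn n))) \<longlonglongrightarrow> pcost p I (fst (z, z)) (snd (z, z))"
    by (rule continuous_on_tendsto_compose[OF continuous_on_pcost[OF assms(2), of UNIV] tendsto_Pair[OF tendsto_const R]]) auto
  then show "(\<lambda>n. pcost p I z (zn n)) \<longlonglongrightarrow> 0" by (simp add: pcost_self)
qed

lemma compact_sublevel:
  fixes f :: "'a::topological_space \<Rightarrow> real"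
  assumes "compact K" "continuous_on K f" "K \<subseteq> E" "\<And>x. x \<in> E \<Longrightarrow> f x \<le> R \<Longrightarrow> x \<in> K"
  shows "compact {x \<in> E. f x \<le> R}"
proof -
  have "closedin (top_of_set K) (K \<inter> f -` {..R})"
    by (rule continuous_closedin_preimage[OF assms(2)]) simp
  moreover have "K \<inter> f -` {..R} = {x \<in> E. f x \<le> R}" using assms(3,4) by auto
  ultimately show ?thesis using closedin_compact[OF assms(1)] by simp
qed

lemma norm_powr_le_imp: "0 < p \<Longrightarrow> norm x powr p \<le> R \<Longrightarrow> norm x \<le> R powr (1 / p)"
  using powr_mono2[of "1 / p" "norm x powr p" R] by (simp add: powr_powr)

text \<open>Balls are compact because they are closed in a finite product of closed bounded subsets
  of the state spaces; closedness and finite dimension of these spaces enter here. The constant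
  \<open>2 powr p\<close> is that of \<open>powr_quasi_triangle\<close>.\<close>

lemma cost_space_paths:
  assumes p: "1 \<le> p" and I: "finite I" and cl: "\<And>i. i \<in> I \<Longrightarrow> closed (Z i)" "\<And>i. i \<in> I \<Longrightarrow> closed (W i)"
    and u0: "u0 \<in> jset Z W I"
  shows "cost_space (jset Z W I) (path_space Z I \<Otimes>\<^sub>M path_space W I) (jdist p I) u0 p (2 powr p)"
proof
  have "sets (path_space Z I \<Otimes>\<^sub>M path_space W I) = sets (restrict_space borel (PiE I Z) \<Otimes>\<^sub>M restrict_space borel (PiE I W))"
    by (intro sets_pair_measure_cong sets_path_space)
  then show "sets (path_space Z I \<Otimes>\<^sub>M path_space W I) = sets (restrict_space borel (jset Z W I))"
    using sets_pair_restrict_borel by blast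
  show "continuous_on (jset Z W I \<times> jset Z W I) (\<lambda>z. jdist p I (fst z) (snd z) powr p)"
    unfolding jdist_powr[OF p] using p by (intro continuous_on_pcost) simp
  show "jdist p I u u = 0" for u by (simp add: pair_dist_def path_dist_def)
  show "jdist p I u v = jdist p I v u" for u v by (simp add: pair_dist_def path_dist_def norm_minus_commute)
  show "jdist p I u v powr p \<le> 2 powr p * (jdist p I u w powr p + jdist p I w v powr p)" for u v w
    unfolding jdist_powr[OF p] using p by (intro pcost_tri) simp
  show "s \<longlonglongrightarrow> u" if "u \<in> jset Z W I" "\<And>n. s n \<in> jset Z W I" "(\<lambda>n. jdist p I u (s n) powr p) \<longlonglongrightarrow> 0" for u s
  proof -
    have "(\<lambda>n. pcost p I u (s n)) \<longlonglongrightarrow> 0" using that(3) unfolding jdist_powr[OF p] .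
    then show ?thesis using pcost_tendsto_iff[OF I _ that(1,2)] p by auto
  qed
  show "compact {u \<in> jset Z W I. jdist p I u u0 powr p \<le> R}" for R
  proof -
    let ?K = "jset (\<lambda>i. Z i \<inter> cball (fst u0 i) (R powr (1 / p))) (\<lambda>i. W i \<inter> cball (snd u0 i) (R powr (1 / p))) I"
    have "compact ?K"
      using cl by (intro compact_Times compact_PiE) (auto intro!: closed_Int_compact)
    moreover have "continuous_on ?K (\<lambda>u. pcost p I u u0)"
    proof -
      have "continuous_on ?K (\<lambda>u. (u, u0))" by (intro continuous_intros)
      then show ?thesis
        using continuous_on_compose2[OF continuous_on_pcost[of p UNIV I], of ?K "\<lambda>u. (u, u0)"] p by simp
    qed
    moreover have "u \<in> ?K" if "u \<in> jset Z W I" "pcost p I u u0 \<le> R" for u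
    proof -
      have "norm (fst u i - fst u0 i) \<le> R powr (1 / p)" "norm (snd u i - snd u0 i) \<le> R powr (1 / p)" if "i \<in> I" for i
        using pcost_coord_le[OF I that, of u u0 p] \<open>pcost p I u u0 \<le> R\<close> p by (intro norm_powr_le_imp; linarith)+
      then show ?thesis
        using that(1) by (auto simp: mem_Times_iff PiE_iff dist_norm norm_minus_commute)
    qed
    ultimately show ?thesis
      unfolding jdist_powr[OF p] by (intro compact_sublevel[of ?K]) (auto simp: PiE_iff)
  qed
qed (use p u0 in auto)

lemma cost_space_states:
  fixes A B :: "('a::euclidean_space) set"
  assumes p: "1 \<le> p" and cl: "closed A" "closed B" and u0: "u0 \<in> A \<times> B"
  shows "cost_space (A \<times> B) (restrict_space borel A \<Otimes>\<^sub>M restrict_space borel B) (pair_dist p dist dist) u0 p (2 powr p)"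
proof
  show "sets (restrict_space borel A \<Otimes>\<^sub>M restrict_space borel B) = sets (restrict_space borel (A \<times> B))"
    by (rule sets_pair_restrict_borel)
  have D: "pair_dist p dist dist u v powr p = norm (fst u - fst v) powr p + norm (snd u - snd v) powr p" for u v :: "'a \<times> 'a"
    using p by (simp add: pair_dist_powr dist_norm)
  have c: "continuous_on S (\<lambda>z. pair_dist p dist dist (fst z) (snd z) powr p)" for S :: "(('a \<times> 'a) \<times> ('a \<times> 'a)) set"
    unfolding D using p
    by (intro continuous_on_add continuous_on_norm_powr continuous_on_fst continuous_on_snd continuous_on_id) auto
  then show "continuous_on ((A \<times> B) \<times> A \<times> B) (\<lambda>z. pair_dist p dist dist (fst z) (snd z) powr p)" .
  show "pair_dist p dist dist u u = 0" for u by (simp add: pair_dist_def)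
  show "pair_dist p dist dist u v = pair_dist p dist dist v u" for u v :: "'a \<times> 'a" by (simp add: pair_dist_def dist_commute)
  show "pair_dist p dist dist u v powr p \<le> 2 powr p * (pair_dist p dist dist u w powr p + pair_dist p dist dist w v powr p)"
    for u v w :: "'a \<times> 'a"
    using norm_powr_quasi_triangle[of p "fst u" "fst v" "fst w"] norm_powr_quasi_triangle[of p "snd u" "snd v" "snd w"] p
    unfolding D by (simp add: algebra_simps)
  show "s \<longlonglongrightarrow> u" if L: "(\<lambda>n. pair_dist p dist dist u (s n) powr p) \<longlonglongrightarrow> 0" for u and s :: "nat \<Rightarrow> 'a \<times> 'a"
  proof -
    have nl: "(\<lambda>n. norm (fst u - fst (s n)) powr p) \<longlonglongrightarrow> 0" "(\<lambda>n. norm (snd u - snd (s n)) powr p) \<longlonglongrightarrow> 0"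
      by (intro tendsto_sandwich[OF always_eventually always_eventually tendsto_const L]; simp add: D)+
    have "(\<lambda>n. fst (s n)) \<longlonglongrightarrow> fst u" "(\<lambda>n. snd (s n)) \<longlonglongrightarrow> snd u"
      using tendsto_of_norm_powr[OF nl(1)] tendsto_of_norm_powr[OF nl(2)] p by simp_all
    from tendsto_Pair[OF this] show ?thesis by simp
  qed
  show "compact {u \<in> A \<times> B. pair_dist p dist dist u u0 powr p \<le> R}" for R
  proof -
    let ?K = "(A \<inter> cball (fst u0) (R powr (1 / p))) \<times> (B \<inter> cball (snd u0) (R powr (1 / p)))"
    have "compact ?K" using cl by (intro compact_Times closed_Int_compact) auto
    moreover have "continuous_on ?K (\<lambda>u. pair_dist p dist dist u u0 powr p)"
    proof -
      have "continuous_on ?K (\<lambda>u. (u, u0))" by (intro continuous_intros)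
      then show ?thesis
        using continuous_on_compose2[OF c[of UNIV], of ?K "\<lambda>u. (u, u0)"] p by simp
    qed
    moreover have "u \<in> ?K" if "u \<in> A \<times> B" "pair_dist p dist dist u u0 powr p \<le> R" for u
    proof -
      have "norm (fst u - fst u0) powr p \<le> R" "norm (snd u - snd u0) powr p \<le> R"
        using that(2) powr_ge_zero[of "norm (fst u - fst u0)" p] powr_ge_zero[of "norm (snd u - snd u0)" p]
        unfolding D by linarith+
      then have "norm (fst u - fst u0) \<le> R powr (1 / p)" "norm (snd u - snd u0) \<le> R powr (1 / p)"
        using p by (intro norm_powr_le_imp; simp)+
      then show ?thesis
        using that(1) by (auto simp: dist_norm norm_minus_commute)
    qed
    ultimately show ?thesis by (intro compact_sublevel[of ?K]) auto
  qed
qed (use p u0 in auto)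

section \<open>Composition of kernels and minimizers over varying sets\<close>

lemma space_path_space: "space (path_space Z I) = PiE I Z"
  by (simp add: path_space_def space_PiM state_space_def space_restrict_space)

lemma space_state_space: "space (state_space Z t) = Z t"
  by (simp add: state_space_def space_restrict_space)

lemma measurable_path_update:
  assumes "I = insert i J" "f \<in> M \<rightarrow>\<^sub>M path_space Z J" "g \<in> M \<rightarrow>\<^sub>M state_space Z i"
  shows "(\<lambda>x. (f x)(i := g x)) \<in> M \<rightarrow>\<^sub>M path_space Z I"
  using assms unfolding path_space_def by (intro measurable_fun_upd[where J=J]) auto

lemma atLeastAtMost_Suc_left: "t < T \<Longrightarrow> {Suc t..T} = insert (Suc t) {Suc (Suc t)..T}"
  by auto

lemma atLeast1AtMost_Suc: "{1..Suc t} = insert (Suc t) {1..t}"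
  by auto

lemma cat_update: "t < T \<Longrightarrow> cat T t x (x'(Suc t := u)) = cat T (Suc t) (x(Suc t := u)) x'"
  by (auto simp: cat_def merge_def fun_eq_iff)

text \<open>The induction needs joint measurability in the past and the new state, since the inner
  kernel sees both; hence the product space \<open>?M\<close>.\<close>

lemma tail_kernel_measurable:
  assumes \<kappa>: "\<And>t. t < T \<Longrightarrow> \<kappa> t \<in> path_space Z {1..t} \<rightarrow>\<^sub>M prob_algebra (state_space Z (Suc t))"
  shows "t + n = T \<Longrightarrow> tail_kernel T Z \<kappa> n t \<in> path_space Z {1..t} \<rightarrow>\<^sub>M prob_algebra (path_space Z {Suc t..T})"
proof (induction n arbitrary: t)
  case 0
  then have "tail_kernel T Z \<kappa> 0 t = (\<lambda>x. return (path_space Z {}) (\<lambda>_. undefined))" "{Suc t..T} = {}" by auto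
  then show ?case
    by (simp add: space_prob_algebra prob_space_return space_path_space)
next
  case (Suc n)
  then have tT: "t < T" "Suc t + n = T" by auto
  let ?M = "path_space Z {1..t} \<Otimes>\<^sub>M state_space Z (Suc t)" and ?R = "return (path_space Z {Suc t..T})"
  have "(\<lambda>z. tail_kernel T Z \<kappa> n (Suc t) ((fst z)(Suc t := snd z)))
      \<in> ?M \<rightarrow>\<^sub>M prob_algebra (path_space Z {Suc (Suc t)..T})"
    by (rule measurable_compose[OF _ Suc.IH[OF tT(2)]], rule measurable_path_update[OF atLeast1AtMost_Suc]) auto
  moreover have "(\<lambda>w. ?R ((snd w)(Suc t := snd (fst w))))
      \<in> ?M \<Otimes>\<^sub>M path_space Z {Suc (Suc t)..T} \<rightarrow>\<^sub>M prob_algebra (path_space Z {Suc t..T})"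
    by (rule measurable_compose[OF _ measurable_return_prob_space],
        rule measurable_path_update[OF atLeastAtMost_Suc_left[OF tT(1)]]) auto
  ultimately have "(\<lambda>z. tail_kernel T Z \<kappa> n (Suc t) ((fst z)(Suc t := snd z)) \<bind> (\<lambda>x'. ?R (x'(Suc t := snd z))))
      \<in> ?M \<rightarrow>\<^sub>M prob_algebra (path_space Z {Suc t..T})"
    by (intro measurable_bind_prob_space2) (simp_all add: case_prod_unfold)
  then have "(\<lambda>x. \<kappa> t x \<bind> (\<lambda>u. tail_kernel T Z \<kappa> n (Suc t) (x(Suc t := u)) \<bind> (\<lambda>x'. ?R (x'(Suc t := u)))))
      \<in> path_space Z {1..t} \<rightarrow>\<^sub>M prob_algebra (path_space Z {Suc t..T})"
    by (intro measurable_bind_prob_space2[OF \<kappa>[OF tT(1)]]) (simp add: case_prod_unfold)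
  then show ?case by (simp add: fun_eq_iff[symmetric])
qed

lemma path_space_update_space:
  "\<lbrakk>x \<in> PiE {1..t} Z; u \<in> Z (Suc t)\<rbrakk> \<Longrightarrow> x(Suc t := u) \<in> PiE {1..Suc t} Z"
  by (auto simp: PiE_iff extensional_def)

text \<open>One recursion step shared by \<open>tail_kernel\<close> and \<open>joint_kernel\<close>,
  with \<open>upd\<close> inserting the new coordinate. Extended integrals avoid integrability
  conditions, so the same formula serves absolute bounds and marginals.\<close>

lemma nn_integral_bind_update:
  fixes \<phi> :: "'c \<Rightarrow> ennreal"
  assumes "sets \<alpha> = sets M" "space M \<noteq> {}"
    and K: "K \<in> M \<rightarrow>\<^sub>M prob_algebra N"
    and upd: "(\<lambda>(u, x). upd u x) \<in> M \<Otimes>\<^sub>M N \<rightarrow>\<^sub>M P" and \<phi>: "\<phi> \<in> borel_measurable P"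
  shows "(\<lambda>u. K u \<bind> (\<lambda>x. return P (upd u x))) \<in> M \<rightarrow>\<^sub>M prob_algebra P"
    "u \<in> space M \<Longrightarrow> (\<integral>\<^sup>+y. \<phi> y \<partial>(K u \<bind> (\<lambda>x. return P (upd u x)))) = (\<integral>\<^sup>+x. \<phi> (upd u x) \<partial>K u)"
    "(\<integral>\<^sup>+y. \<phi> y \<partial>(\<alpha> \<bind> (\<lambda>u. K u \<bind> (\<lambda>x. return P (upd u x))))) = (\<integral>\<^sup>+u. \<integral>\<^sup>+x. \<phi> (upd u x) \<partial>K u \<partial>\<alpha>)"
proof -
  show *: "(\<lambda>u. K u \<bind> (\<lambda>x. return P (upd u x))) \<in> M \<rightarrow>\<^sub>M prob_algebra P"
    using measurable_compose[OF upd measurable_return_prob_space]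
    by (intro measurable_bind_prob_space2[OF K]) (simp add: case_prod_unfold)
  have **: "(\<integral>\<^sup>+y. \<phi> y \<partial>(K u \<bind> (\<lambda>x. return P (upd u x)))) = (\<integral>\<^sup>+x. \<phi> (upd u x) \<partial>K u)" if u: "u \<in> space M" for u
  proof -
    have sK: "sets (K u) = sets N" using measurable_space[OF K u] by (simp add: space_prob_algebra)
    have um: "upd u \<in> N \<rightarrow>\<^sub>M P" using measurable_compose[OF measurable_Pair1'[OF u] upd] by simp
    have "(\<lambda>x. return P (upd u x)) \<in> N \<rightarrow>\<^sub>M subprob_algebra P"
      by (rule measurable_compose[OF um return_measurable])
    then have "(\<lambda>x. return P (upd u x)) \<in> K u \<rightarrow>\<^sub>M subprob_algebra P"
      using measurable_cong_sets[OF sK refl] by blast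
    then have "(\<integral>\<^sup>+y. \<phi> y \<partial>(K u \<bind> (\<lambda>x. return P (upd u x)))) = (\<integral>\<^sup>+x. \<integral>\<^sup>+y. \<phi> y \<partial>return P (upd u x) \<partial>K u)"
      by (rule nn_integral_bind[OF \<phi>])
    also have "\<dots> = (\<integral>\<^sup>+x. \<phi> (upd u x) \<partial>K u)"
      using measurable_space[OF um] sets_eq_imp_space_eq[OF sK]
      by (intro nn_integral_cong nn_integral_return \<phi>) auto
    finally show ?thesis .
  qed
  then show "u \<in> space M \<Longrightarrow> (\<integral>\<^sup>+y. \<phi> y \<partial>(K u \<bind> (\<lambda>x. return P (upd u x)))) = (\<integral>\<^sup>+x. \<phi> (upd u x) \<partial>K u)" .
  have "(\<lambda>u. K u \<bind> (\<lambda>x. return P (upd u x))) \<in> \<alpha> \<rightarrow>\<^sub>M subprob_algebra P"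
    using measurable_prob_algebraD[OF *] measurable_cong_sets[OF assms(1) refl] by blast
  then have "(\<integral>\<^sup>+y. \<phi> y \<partial>(\<alpha> \<bind> (\<lambda>u. K u \<bind> (\<lambda>x. return P (upd u x))))) =
    (\<integral>\<^sup>+u. \<integral>\<^sup>+y. \<phi> y \<partial>(K u \<bind> (\<lambda>x. return P (upd u x))) \<partial>\<alpha>)"
    by (rule nn_integral_bind[OF \<phi>])
  also have "\<dots> = (\<integral>\<^sup>+u. \<integral>\<^sup>+x. \<phi> (upd u x) \<partial>K u \<partial>\<alpha>)"
    using ** sets_eq_imp_space_eq[OF assms(1)] by (intro nn_integral_cong) auto
  finally show "(\<integral>\<^sup>+y. \<phi> y \<partial>(\<alpha> \<bind> (\<lambda>u. K u \<bind> (\<lambda>x. return P (upd u x))))) = (\<integral>\<^sup>+u. \<integral>\<^sup>+x. \<phi> (upd u x) \<partial>K u \<partial>\<alpha>)" .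
qed

lemma tail_kernel_nn_integral:
  assumes \<kappa>: "\<And>t. t < T \<Longrightarrow> \<kappa> t \<in> path_space Z {1..t} \<rightarrow>\<^sub>M prob_algebra (state_space Z (Suc t))"
    and t: "t < T" and x: "x \<in> PiE {1..t} Z" and \<phi>: "\<phi> \<in> borel_measurable (path_space Z {Suc t..T})"
  shows "(\<integral>\<^sup>+x'. \<phi> x' \<partial>tail_kernel T Z \<kappa> (T - t) t x) =
    (\<integral>\<^sup>+u. \<integral>\<^sup>+x'. \<phi> (x'(Suc t := u)) \<partial>tail_kernel T Z \<kappa> (T - Suc t) (Suc t) (x(Suc t := u)) \<partial>\<kappa> t x)"
proof -
  have e: "T - t = Suc (T - Suc t)" using t by simp
  have "\<kappa> t x \<in> space (prob_algebra (state_space Z (Suc t)))"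
    using measurable_space[OF \<kappa>[OF t]] x by (simp add: space_path_space)
  then have s: "sets (\<kappa> t x) = sets (state_space Z (Suc t))" and "prob_space (\<kappa> t x)"
    by (auto simp: space_prob_algebra)
  then have "space (state_space Z (Suc t)) \<noteq> {}" using prob_space.not_empty sets_eq_imp_space_eq by metis
  moreover have "(\<lambda>u. tail_kernel T Z \<kappa> (T - Suc t) (Suc t) (x(Suc t := u)))
      \<in> state_space Z (Suc t) \<rightarrow>\<^sub>M prob_algebra (path_space Z {Suc (Suc t)..T})"
    using x by (intro measurable_compose[OF _ tail_kernel_measurable[OF \<kappa>]] measurable_path_update[OF atLeast1AtMost_Suc])
      (use t in \<open>auto simp: space_path_space\<close>)
  moreover have "(\<lambda>w. (snd w)(Suc t := fst w)) \<in> state_space Z (Suc t) \<Otimes>\<^sub>M path_space Z {Suc (Suc t)..T} \<rightarrow>\<^sub>M path_space Z {Suc t..T}"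
    by (rule measurable_path_update[OF atLeastAtMost_Suc_left[OF t]]) auto
  ultimately show ?thesis
    unfolding e tail_kernel.simps using \<phi>
    by (intro nn_integral_bind_update(3)[OF s, where N="path_space Z {Suc (Suc t)..T}"]) (auto simp: case_prod_unfold)
qed

text \<open>Only nonnegativity of the two distances is used, no triangle inequality. It therefore
  applies to \<open>wasserstein\<close> without a proof that this is a metric.\<close>

lemma cont_map_seq:
  fixes d :: "'a \<Rightarrow> 'a \<Rightarrow> real" and d' :: "'b \<Rightarrow> 'b \<Rightarrow> real"
  assumes "\<And>a b. 0 \<le> d a b" "\<And>a b. 0 \<le> d' a b"
  shows "cont_map A d B d' f \<longleftrightarrow> f \<in> A \<rightarrow> B \<and>
    (\<forall>a\<in>A. \<forall>s. (\<forall>n. s n \<in> A) \<and> (\<lambda>n. d a (s n)) \<longlonglongrightarrow> 0 \<longrightarrow> (\<lambda>n. d' (f a) (f (s n))) \<longlonglongrightarrow> 0)"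
proof safe
  assume c: "cont_map A d B d' f"
  then show "a \<in> A \<Longrightarrow> f a \<in> B" for a by (auto simp: cont_map_def)
  fix a s assume a: "a \<in> A" and s: "\<forall>n. s n \<in> A" "(\<lambda>n. d a (s n)) \<longlonglongrightarrow> 0"
  show "(\<lambda>n. d' (f a) (f (s n))) \<longlonglongrightarrow> 0"
  proof (rule LIMSEQ_I)
    fix e :: real assume "0 < e"
    then obtain \<delta> where \<delta>: "0 < \<delta>" "\<And>a'. a' \<in> A \<Longrightarrow> d a a' < \<delta> \<Longrightarrow> d' (f a) (f a') < e"
      using c a unfolding cont_map_def by blast
    obtain N where "\<And>n. n \<ge> N \<Longrightarrow> norm (d a (s n) - 0) < \<delta>" using LIMSEQ_D[OF s(2) \<delta>(1)] by blast
    then have "norm (d' (f a) (f (s n)) - 0) < e" if "n \<ge> N" for n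
      using \<delta>(2)[of "s n"] s(1) assms that by simp
    then show "\<exists>N. \<forall>n\<ge>N. norm (d' (f a) (f (s n)) - 0) < e" by blast
  qed
next
  assume f: "f \<in> A \<rightarrow> B" and
    s: "\<forall>a\<in>A. \<forall>s. (\<forall>n. s n \<in> A) \<and> (\<lambda>n. d a (s n)) \<longlonglongrightarrow> 0 \<longrightarrow> (\<lambda>n. d' (f a) (f (s n))) \<longlonglongrightarrow> 0"
  have "\<exists>\<delta>>0. \<forall>a'\<in>A. d a a' < \<delta> \<longrightarrow> d' (f a) (f a') < e" if "a \<in> A" "0 < e" for a e
  proof (rule ccontr)
    assume n: "\<not> ?thesis"
    have "\<exists>a'\<in>A. d a a' < 1 / Suc n \<and> e \<le> d' (f a) (f a')" for n
    proof (rule ccontr)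
      assume "\<not> ?thesis"
      then have "\<forall>a'\<in>A. d a a' < 1 / Suc n \<longrightarrow> d' (f a) (f a') < e" by (meson not_le)
      moreover have "0 < 1 / real (Suc n)" by simp
      ultimately show False using n by blast
    qed
    then obtain q where q: "\<And>n. q n \<in> A" "\<And>n. d a (q n) < 1 / Suc n" "\<And>n. e \<le> d' (f a) (f (q n))" by metis
    have "(\<lambda>n. d a (q n)) \<longlonglongrightarrow> 0"
      using q(2) assms(1) by (intro tendsto_sandwich[OF always_eventually always_eventually tendsto_const LIMSEQ_Suc[OF lim_1_over_n]])
        (auto intro: less_imp_le)
    then have "(\<lambda>n. d' (f a) (f (q n))) \<longlonglongrightarrow> 0" using s that q(1) by blast
    then have "\<forall>\<^sub>F n in sequentially. d' (f a) (f (q n)) < e" using that by (intro order_tendstoD)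
    then show False using q(3) by (auto simp: eventually_sequentially not_less[symmetric])
  qed
  then show "cont_map A d B d' f" using f by (auto simp: cont_map_def)
qed

section \<open>Minimizers over varying sets\<close>

lemma continuous_on_seqI:
  fixes f :: "'a::metric_space \<Rightarrow> 'b::metric_space"
  assumes "\<And>a s. a \<in> A \<Longrightarrow> (\<And>n. s n \<in> A) \<Longrightarrow> s \<longlonglongrightarrow> a \<Longrightarrow> (\<lambda>n. f (s n)) \<longlonglongrightarrow> f a"
  shows "continuous_on A f"
  using assms by (auto simp: continuous_on_sequentially comp_def)

text \<open>If the minimizers did not tend to \<open>\<theta>\<close>, some would stay away from it
  along indices tending to infinity. Upper hemicontinuity puts them close to \<open>D z\<close>, and
  compactness gives a limit l in \<open>D z\<close>; lower hemicontinuity supplies competitors in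
  \<open>D (zn n)\<close> tending to \<open>\<theta>\<close>. Comparing values in the limit gives
  \<open>f z l \<le> f z \<theta>\<close>, so l is \<open>\<theta>\<close> by uniqueness.
  \<open>jc\<close> is asked along all reindexings tending to infinity because the selected indices
  need not increase.\<close>

lemma (in Metric_space) berge_unique_argmin:
  fixes D :: "'z::metric_space \<Rightarrow> 'a set"
  assumes cpt: "compactin mtopology (D z)" and sub: "\<And>n. D (zn n) \<subseteq> M"
    and zn: "zn \<longlonglongrightarrow> z"
    and uhc: "\<And>U. openin mtopology U \<Longrightarrow> D z \<subseteq> U \<Longrightarrow> \<forall>\<^sub>F n in sequentially. D (zn n) \<subseteq> U"
    and lhc: "\<And>U. openin mtopology U \<Longrightarrow> D z \<inter> U \<noteq> {} \<Longrightarrow> \<forall>\<^sub>F n in sequentially. D (zn n) \<inter> U \<noteq> {}"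
    and jc: "\<And>r v vn. filterlim r sequentially sequentially \<Longrightarrow> v \<in> M \<Longrightarrow> (\<And>n. vn n \<in> M) \<Longrightarrow> (\<lambda>n. d v (vn n)) \<longlonglongrightarrow> 0 \<Longrightarrow>
      (\<lambda>n. f (zn (r n)) (vn n)) \<longlonglongrightarrow> (f z v :: real)"
    and m: "\<theta> \<in> D z" "\<And>w. w \<in> D z \<Longrightarrow> f z w \<le> f z \<theta> \<Longrightarrow> w = \<theta>"
    and mn: "\<And>n. \<theta>n n \<in> D (zn n)" "\<And>n w. w \<in> D (zn n) \<Longrightarrow> f (zn n) (\<theta>n n) \<le> f (zn n) w"
  shows "(\<lambda>n. d \<theta> (\<theta>n n)) \<longlonglongrightarrow> 0"
proof (rule ccontr)
  assume "\<not> ?thesis"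
  then obtain e where e: "0 < e" "\<And>N. \<exists>n\<ge>N. e \<le> d \<theta> (\<theta>n n)"
    unfolding LIMSEQ_def by (auto simp: dist_real_def not_less)
  have DM: "D z \<subseteq> M" using compactin_subset_topspace[OF cpt] by simp
  have "\<exists>n w \<zeta>. k \<le> n \<and> e \<le> d \<theta> (\<theta>n n) \<and> w \<in> D z \<and> d w (\<theta>n n) < 1 / Suc k \<and> \<zeta> \<in> D (zn n) \<and> d \<theta> \<zeta> < 1 / Suc k" for k
  proof -
    \<comment> \<open>A neighbourhood of \<open>D z\<close> whose points are all within 1/(k+1) of
      \<open>D z\<close>; upper hemicontinuity for it yields the points w.\<close>
    let ?U = "\<Union>w\<in>D z. mball w (1 / Suc k)"
    have "openin mtopology ?U" by (intro openin_Union) auto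
    moreover have "D z \<subseteq> ?U" using DM by auto
    ultimately have 1: "\<forall>\<^sub>F n in sequentially. D (zn n) \<subseteq> ?U" by (rule uhc)
    have "D z \<inter> mball \<theta> (1 / Suc k) \<noteq> {}" using m(1) DM by auto
    then have 2: "\<forall>\<^sub>F n in sequentially. D (zn n) \<inter> mball \<theta> (1 / Suc k) \<noteq> {}" by (intro lhc) auto
    obtain N where N: "\<And>n. n \<ge> N \<Longrightarrow> D (zn n) \<subseteq> ?U \<and> D (zn n) \<inter> mball \<theta> (1 / Suc k) \<noteq> {}"
      using eventually_conj[OF 1 2] by (auto simp: eventually_sequentially)
    obtain n where n: "n \<ge> max N k" "e \<le> d \<theta> (\<theta>n n)" using e(2) by blast
    have nN: "n \<ge> N" using n(1) by simp
    have "\<theta>n n \<in> ?U" using N[OF nN] mn(1)[of n] by blast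
    then obtain w where "w \<in> D z" "d w (\<theta>n n) < 1 / Suc k" by auto
    moreover have "D (zn n) \<inter> mball \<theta> (1 / Suc k) \<noteq> {}" using N[OF nN] by blast
    then obtain \<zeta> where "\<zeta> \<in> D (zn n)" "d \<theta> \<zeta> < 1 / Suc k" by auto
    ultimately show ?thesis using n by (metis max.bounded_iff)
  qed
  then obtain n w \<zeta> where q: "\<And>k. k \<le> n k" "\<And>k. e \<le> d \<theta> (\<theta>n (n k))" "\<And>k. w k \<in> D z"
    "\<And>k. d (w k) (\<theta>n (n k)) < 1 / Suc k" "\<And>k. \<zeta> k \<in> D (zn (n k))" "\<And>k. d \<theta> (\<zeta> k) < 1 / Suc k" by metis
  have "range w \<subseteq> D z" using q(3) by auto
  then obtain l r where l: "l \<in> D z" "strict_mono r" "limitin mtopology (w \<circ> r) l sequentially"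
    using cpt unfolding compactin_sequentially by blast
  have wl: "(\<lambda>k. d l (w (r k))) \<longlonglongrightarrow> 0"
    using l(3) unfolding limitin_metric_dist_null by (simp add: comp_def commute)
  have r0: "(\<lambda>k. 1 / real (Suc (r k))) \<longlonglongrightarrow> 0"
    using LIMSEQ_subseq_LIMSEQ[OF LIMSEQ_Suc[OF lim_1_over_n] l(2)] by (simp add: comp_def)
  have inM: "\<theta>n k \<in> M" "\<zeta> k \<in> M" "w k \<in> M" "l \<in> M" "\<theta> \<in> M" for k
    using mn(1)[of k] sub q(3)[of k] q(5)[of k] DM l(1) m(1) by blast+
  have nr: "filterlim (\<lambda>k. n (r k)) sequentially sequentially"
    using order_trans[OF seq_suble[OF l(2)] q(1)] by (intro filterlim_at_top_mono[OF filterlim_ident]) auto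
  have tl: "(\<lambda>k. d l (\<theta>n (n (r k)))) \<longlonglongrightarrow> 0"
  proof (rule tendsto_sandwich[OF always_eventually always_eventually tendsto_const])
    show "(\<lambda>k. d l (w (r k)) + 1 / real (Suc (r k))) \<longlonglongrightarrow> 0"
      using tendsto_add[OF wl r0] by simp
    show "\<forall>k. d l (\<theta>n (n (r k))) \<le> d l (w (r k)) + 1 / real (Suc (r k))"
      using triangle[of l "w (r _)" "\<theta>n (n (r _))"] q(4)[of "r _"] inM by (meson add_left_mono less_imp_le order_trans)
  qed simp
  have zl: "(\<lambda>k. d \<theta> (\<zeta> (r k))) \<longlonglongrightarrow> 0"
    using q(6) by (intro tendsto_sandwich[OF always_eventually always_eventually tendsto_const r0]) (auto intro: less_imp_le)
  have "f z l \<le> f z \<theta>"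
  proof (rule LIMSEQ_le)
    show "(\<lambda>k. f (zn (n (r k))) (\<theta>n (n (r k)))) \<longlonglongrightarrow> f z l" by (rule jc[OF nr _ _ tl]) (use inM in auto)
    show "(\<lambda>k. f (zn (n (r k))) (\<zeta> (r k))) \<longlonglongrightarrow> f z \<theta>" by (rule jc[OF nr _ _ zl]) (use inM in auto)
    show "\<exists>N. \<forall>k\<ge>N. f (zn (n (r k))) (\<theta>n (n (r k))) \<le> f (zn (n (r k))) (\<zeta> (r k))"
      using mn(2) q(5) by blast
  qed
  then have "l = \<theta>" using m(2) l(1) by blast
  then have "\<forall>\<^sub>F k in sequentially. d \<theta> (\<theta>n (n (r k))) < e" using tl e(1) by (intro order_tendstoD) auto
  then show False using q(2) by (auto simp: eventually_sequentially not_less[symmetric])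
qed

text \<open>Sequential continuity on all of M is the form in which the objective is known to be
  continuous, so compactness of the image is also proved through sequences.\<close>

lemma (in Metric_space) compactin_attains_min:
  fixes f :: "'a \<Rightarrow> real"
  assumes cpt: "compactin mtopology D" and ne: "D \<noteq> {}"
    and c: "\<And>v vn. v \<in> M \<Longrightarrow> (\<And>n. vn n \<in> M) \<Longrightarrow> (\<lambda>n. d v (vn n)) \<longlonglongrightarrow> 0 \<Longrightarrow> (\<lambda>n. f (vn n)) \<longlonglongrightarrow> f v"
  obtains v where "v \<in> D" "\<And>w. w \<in> D \<Longrightarrow> f v \<le> f w"
proof -
  have DM: "D \<subseteq> M" using compactin_subset_topspace[OF cpt] by simp
  have "seq_compact (f ` D)"
  proof (rule seq_compactI)
    fix s :: "nat \<Rightarrow> real" assume "\<forall>n. s n \<in> f ` D"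
    then have "\<forall>n. \<exists>v. v \<in> D \<and> s n = f v" by blast
    then obtain v where v: "\<And>n. v n \<in> D" "\<And>n. s n = f (v n)" by metis
    then have "range v \<subseteq> D" by auto
    then obtain l r where l: "l \<in> D" "strict_mono r" "limitin mtopology (v \<circ> r) l sequentially"
      using cpt unfolding compactin_sequentially by blast
    have "(\<lambda>k. d l (v (r k))) \<longlonglongrightarrow> 0"
      using l(3) unfolding limitin_metric_dist_null by (simp add: comp_def commute)
    then have "(\<lambda>k. f (v (r k))) \<longlonglongrightarrow> f l" using l(1) v(1) DM by (intro c) auto
    then show "\<exists>l\<in>f ` D. \<exists>r. strict_mono r \<and> (s \<circ> r) \<longlonglongrightarrow> l" using l v(2) by (auto simp: comp_def)
  qed
  then have "compact (f ` D)" by (simp add: compact_eq_seq_compact_metric)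
  then show thesis using that ne compact_attains_inf[of "f ` D"] by blast
qed

section \<open>The dynamic programming setting\<close>

definition extend :: "nat \<Rightarrow> ('d::finite) path \<times> 'd path \<Rightarrow> (real ^ 'd) \<times> (real ^ 'd) \<Rightarrow> 'd path \<times> 'd path" where
  "extend t z u = ((fst z)(Suc t := fst u), (snd z)(Suc t := snd u))"

definition glue :: "nat \<Rightarrow> nat \<Rightarrow> ('d::finite) path \<times> 'd path \<Rightarrow> 'd path \<times> 'd path \<Rightarrow> 'd path \<times> 'd path" where
  "glue T t z z' = (cat T t (fst z) (fst z'), cat T t (snd z) (snd z'))"

lemma cat_apply: "cat T t x x' i = (if i \<in> {1..t} then x i else if i \<in> {Suc t..T} then x' i else undefined)"
  by (simp add: cat_def merge_def)

text \<open>The state of time t + 1 may be counted with the past or with the future; this is what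
  turns averages from t on into averages from t + 1 on.\<close>

lemma glue_ext: "t < T \<Longrightarrow> glue T t z (extend t z' u) = glue T (Suc t) (extend t z u) z'"
  by (simp add: glue_def extend_def cat_update)

text \<open>Allows the current state in c to be read off the full path, which makes the cost at time
  t a function of full paths alone.\<close>

lemma coord_cat: "t \<le> s \<Longrightarrow> coord Z (cat T s x x') t = coord Z x t"
  by (simp add: coord_def cat_apply)

lemma coord_update: "coord Z (x(Suc t := u)) t = coord Z x t"
  by (simp add: coord_def)

text \<open>After division by s + t both fractions lie in [0, 1], where the power with exponent q at
  most 1 dominates the identity.\<close>

lemma powr_subadditive:
  assumes "0 \<le> (s::real)" "0 \<le> t" "0 < q" "q \<le> 1"
  shows "(s + t) powr q \<le> s powr q + t powr q"
proof (cases "s + t = 0")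
  case False
  then have st: "0 < s + t" using assms by simp
  have le: "x / (s + t) \<le> (x / (s + t)) powr q" if "0 \<le> x" "x \<le> s + t" for x
  proof (cases "x = 0")
    case False
    then have "(x / (s + t)) powr 1 \<le> (x / (s + t)) powr q"
      using that st assms by (intro powr_mono') auto
    then show ?thesis using that st False by simp
  qed simp
  have "(s + t) powr q * 1 = (s + t) powr q * (s / (s + t) + t / (s + t))"
    using st by (simp add: add_divide_distrib[symmetric])
  also have "\<dots> \<le> (s + t) powr q * ((s / (s + t)) powr q + (t / (s + t)) powr q)"
    using le[of s] le[of t] assms by (intro mult_left_mono add_mono) auto
  also have "\<dots> = s powr q + t powr q"
    using st assms by (simp add: powr_divide algebra_simps)
  finally show ?thesis by simp
qed (use assms in simp)

text \<open>For a at most p this separates a joint moment into moments of the two marginals, the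
  only ones that (K2) controls. It is subadditivity of the power a/p, applied to p-th
  powers.\<close>

lemma pair_dist_powr_le:
  assumes "1 \<le> p" "0 < a" "a \<le> p" "\<And>x y. 0 \<le> d1 x y" "\<And>x y. 0 \<le> d2 x y"
  shows "pair_dist p d1 d2 z z' powr a \<le> d1 (fst z) (fst z') powr a + d2 (snd z) (snd z') powr a"
  using powr_subadditive[of "d1 (fst z) (fst z') powr p" "d2 (snd z) (snd z') powr p" "a / p"] assms
  by (simp add: pair_dist_def powr_powr)

lemma pair_dist_component_le:
  assumes "1 \<le> p" "\<And>x y. 0 \<le> d1 x y" "\<And>x y. 0 \<le> d2 x y"
  shows "d1 (fst z) (fst z') \<le> pair_dist p d1 d2 z z'" (is ?fst) "d2 (snd z) (snd z') \<le> pair_dist p d1 d2 z z'" (is ?snd)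
proof -
  have "(d1 (fst z) (fst z') powr p) powr (1 / p) \<le> pair_dist p d1 d2 z z'"
    "(d2 (snd z) (snd z') powr p) powr (1 / p) \<le> pair_dist p d1 d2 z z'"
    unfolding pair_dist_def using assms(1) by (intro powr_mono2; simp)+
  then show ?fst ?snd
    using assms by (simp_all add: powr_powr)
qed

lemma path_dist_cong: "(\<And>s. s \<in> I \<Longrightarrow> x s = x2 s) \<Longrightarrow> (\<And>s. s \<in> I \<Longrightarrow> y s = y2 s) \<Longrightarrow> path_dist p I x y = path_dist p I x2 y2"
  by (simp add: path_dist_def cong: sum.cong)

lemma continuous_on_fun_apply: "continuous_on A f \<Longrightarrow> continuous_on A (\<lambda>x. f x i)"
  by (rule continuous_on_product_then_coordinatewise)

lemma continuous_on_path_update: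
  fixes f :: "'w::topological_space \<Rightarrow> 'i \<Rightarrow> 'a::topological_space"
  assumes "continuous_on A f" "continuous_on A g"
  shows "continuous_on A (\<lambda>w. (f w)(j := g w))"
proof (rule continuous_on_coordinatewise_then_product)
  fix i show "continuous_on A (\<lambda>w. ((f w)(j := g w)) i)"
    using assms(2) continuous_on_fun_apply[OF assms(1)] by (cases "i = j") auto
qed

lemma continuous_on_ext: "continuous_on A (\<lambda>w. extend t (fst w) (snd w))"
  unfolding extend_def
  by (intro continuous_on_Pair continuous_on_path_update continuous_on_fst continuous_on_snd continuous_on_id)

lemma continuous_on_cat:
  assumes "continuous_on A f" "continuous_on A g"
  shows "continuous_on A (\<lambda>w. cat T t (f w) (g w))"
proof (rule continuous_on_coordinatewise_then_product)
  fix i show "continuous_on A (\<lambda>w. cat T t (f w) (g w) i)"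
    unfolding cat_apply using continuous_on_fun_apply[OF assms(1)] continuous_on_fun_apply[OF assms(2)]
    by (cases "i \<in> {1..t}"; cases "i \<in> {Suc t..T}") (simp_all only: if_True if_False continuous_on_const)
qed

lemma continuous_on_glue: "continuous_on A (\<lambda>z'. glue T t z z')"
  unfolding glue_def
  by (intro continuous_on_Pair continuous_on_cat continuous_on_fst continuous_on_snd continuous_on_id continuous_on_const)

lemma restrict_cat: "x' \<in> extensional {Suc t..T} \<Longrightarrow> restrict (cat T t x x') {Suc t..T} = x'"
  by (auto simp: cat_apply fun_eq_iff extensional_def)

text \<open>Stated by extended integrals rather than by \<open>distr\<close>: the bind formula
  produces this form and the moment estimates use it directly.\<close>

definition has_marginal :: "'a measure \<Rightarrow> 'c measure \<Rightarrow> ('a \<Rightarrow> 'c) \<Rightarrow> 'c measure \<Rightarrow> bool" where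
  "has_marginal K M f Q \<longleftrightarrow> (\<forall>\<phi>\<in>borel_measurable M. (\<integral>\<^sup>+z. \<phi> (f z) \<partial>K) = (\<integral>\<^sup>+x. (\<phi> x :: ennreal) \<partial>Q))"

lemma has_marginalD:
  fixes \<phi> :: "_ \<Rightarrow> ennreal"
  shows "has_marginal K M f Q \<Longrightarrow> \<phi> \<in> borel_measurable M \<Longrightarrow> (\<integral>\<^sup>+z. \<phi> (f z) \<partial>K) = (\<integral>\<^sup>+x. \<phi> x \<partial>Q)"
  by (simp add: has_marginal_def)

locale dp_problem =
  fixes S :: "('d::finite, 'b::real_vector) problem"
  assumes setting: "setting S" and O1: "O1 S" and O2: "O2 S" and O3: "O3 S"
    and K2: "K2 S" and P1: "P1 S" and P2: "P2 S" and P3: "P3 S"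
begin

abbreviation "T \<equiv> horizon S"
abbreviation "p \<equiv> pexp S"
abbreviation "X \<equiv> Xs S"
abbreviation "Y \<equiv> Ys S"
abbreviation "H \<equiv> hist S"
abbreviation "ref \<equiv> hist_ref S"
abbreviation "PS I \<equiv> path_space X I \<Otimes>\<^sub>M path_space Y I"
abbreviation "SS t \<equiv> state_space X t \<Otimes>\<^sub>M state_space Y t"
abbreviation "hnorm t z \<equiv> hist_dist S t z (ref t)"
abbreviation "ker \<theta> t z \<equiv> policy_kernel S \<theta> t (fst z) (snd z)"
abbreviation "pol \<theta> t z \<equiv> \<theta> (Suc t) (fst z) (snd z)"
abbreviation "tail_ref t \<equiv> (restrict (xref S) {Suc t..T}, restrict (yref S) {Suc t..T})"
abbreviation "state_dist \<equiv> pair_dist p dist dist"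
abbreviation "sref t \<equiv> (xref S (Suc t), yref S (Suc t))"
abbreviation "state_laws t \<equiv> P_moment p (SS (Suc t)) state_dist (sref t)"
text \<open>\<open>\<Theta> t\<close> is \<open>\<Theta>\<^sub>t\<^sub>+\<^sub>1\<close>.\<close>

abbreviation "\<Theta> t \<equiv> Theta S (Suc t)"
abbreviation "d\<Theta> t \<equiv> dTheta S (Suc t)"

definition avg :: "('d, 'b) policy \<Rightarrow> nat \<Rightarrow> ('d path \<times> 'd path \<Rightarrow> real) \<Rightarrow> 'd path \<times> 'd path \<Rightarrow> real" where
  "avg \<theta> t F z = (\<integral>z'. F (glue T t z z') \<partial>ker \<theta> t z)"

definition test_fun :: "real \<Rightarrow> ('d path \<times> 'd path \<Rightarrow> real) \<Rightarrow> bool" where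
  "test_fun a F \<longleftrightarrow> continuous_on (H T) F \<and> (\<exists>C\<ge>0. \<forall>z\<in>H T. \<bar>F z\<bar> \<le> C * (1 + hnorm T z powr a))"

text \<open>The clauses on the marginals make (K2), a condition on the kernels of \<open>\<mu>\<close> and \<open>\<nu>\<close>,
  applicable to \<open>ker\<close>.\<close>

definition regular_from :: "('d, 'b) policy \<Rightarrow> nat \<Rightarrow> bool" where
  "regular_from \<theta> t \<longleftrightarrow>
     ker \<theta> t \<in> PS {1..t} \<rightarrow>\<^sub>M prob_algebra (PS {Suc t..T}) \<and>
     (\<forall>F. test_fun p F \<longrightarrow> continuous_on (H t) (avg \<theta> t F)) \<and>
     (\<forall>z\<in>H t.
        has_marginal (ker \<theta> t z) (path_space X {Suc t..T}) fst (tail_kernel T X (muk S) (T - t) t (fst z)) \<and>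
        has_marginal (ker \<theta> t z) (path_space Y {Suc t..T}) snd (tail_kernel T Y (nuk S) (T - t) t (snd z)))"

section \<open>Consequences of the standing assumptions\<close>

lemma p_ge: "1 \<le> p" and p_pos: "0 < p"
  using setting by (auto simp: setting_def)

lemma r_pos: "0 < 1 / rexp S" "1 / rexp S \<le> p" "0 < rexp S"
  using O2 by (auto simp: O2_def)

lemma closed_states: "t \<in> {1..T} \<Longrightarrow> closed (X t)" "t \<in> {1..T} \<Longrightarrow> closed (Y t)"
  using setting by (auto simp: setting_def marginal_setting_def)

lemma ref_paths: "xref S \<in> PiE {1..T} X" "yref S \<in> PiE {1..T} Y"
  using setting by (auto simp: setting_def marginal_setting_def)

lemma kernels_measurable:
  "t < T \<Longrightarrow> muk S t \<in> path_space X {1..t} \<rightarrow>\<^sub>M prob_algebra (state_space X (Suc t))"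
  "t < T \<Longrightarrow> nuk S t \<in> path_space Y {1..t} \<rightarrow>\<^sub>M prob_algebra (state_space Y (Suc t))"
  using setting by (auto simp: setting_def marginal_setting_def regular_kernels_def)

lemma initial_states: "the_elem (X 0) \<in> X 0" "the_elem (Y 0) \<in> Y 0"
  using setting by (auto simp: setting_def marginal_setting_def is_singleton_def)

lemma metric_Theta: "t < T \<Longrightarrow> Metric_space (\<Theta> t) (d\<Theta> t)"
  using setting by (auto simp: setting_def polish_tvs_def)

lemma hist_eq: "H t = jset X Y {1..t}" by (simp add: hist_def)
lemma hist_dist_eq: "hist_dist S t = jdist p {1..t}" by (simp add: hist_dist_def)
lemma tail_dist_eq: "tail_dist S t = jdist p {Suc t..T}" by (simp add: tail_dist_def)

lemma space_PS: "space (PS I) = jset X Y I"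
  by (simp add: space_pair_measure space_path_space)

lemma space_SS: "space (SS t) = X t \<times> Y t"
  by (simp add: space_pair_measure space_state_space)

lemma ref_in: "t \<le> T \<Longrightarrow> ref t \<in> H t"
  using ref_paths by (auto simp: hist_ref_def hist_def PiE_iff)

lemma tail_ref_in: "tail_ref t \<in> jset X Y {Suc t..T}"
  using ref_paths by (auto simp: PiE_iff)

lemma cost_space_hist: "t \<le> T \<Longrightarrow> cost_space (H t) (PS {1..t}) (hist_dist S t) (ref t) p (2 powr p)"
  unfolding hist_eq hist_dist_eq using ref_in[of t] p_ge closed_states
  by (intro cost_space_paths) (auto simp: hist_eq)

lemma cost_space_tail:
  "cost_space (jset X Y {Suc t..T}) (PS {Suc t..T}) (tail_dist S t) (tail_ref t) p (2 powr p)"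
  unfolding tail_dist_eq using tail_ref_in[of t] p_ge closed_states
  by (intro cost_space_paths) auto

lemma cost_space_state:
  assumes "t < T"
  shows "cost_space (X (Suc t) \<times> Y (Suc t)) (SS (Suc t)) state_dist (sref t) p (2 powr p)"
  unfolding state_space_def using ref_paths assms p_ge closed_states
  by (intro cost_space_states) (auto simp: PiE_iff)

lemma gam_laws: "t < T \<Longrightarrow> \<eta> \<in> \<Theta> t \<Longrightarrow> gam S (Suc t) \<eta> \<in> state_laws t"
  using P1 unfolding P1_def cont_map_def by blast

lemma gam_D:
  assumes "t < T" "\<eta> \<in> \<Theta> t"
  shows "sets (gam S (Suc t) \<eta>) = sets (SS (Suc t))" "prob_space (gam S (Suc t) \<eta>)"
    "space (gam S (Suc t) \<eta>) = X (Suc t) \<times> Y (Suc t)"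
  using cost_space.PP_D[OF cost_space_state[OF assms(1)] gam_laws[OF assms]] by auto

lemma gam_tendsto:
  assumes t: "t < T" and \<eta>: "\<eta> \<in> \<Theta> t" "\<And>n. \<eta>n n \<in> \<Theta> t"
    and l: "(\<lambda>n. d\<Theta> t \<eta> (\<eta>n n)) \<longlonglongrightarrow> 0"
  shows "(\<lambda>n. wasserstein p state_dist (gam S (Suc t) \<eta>) (gam S (Suc t) (\<eta>n n))) \<longlonglongrightarrow> 0"
proof -
  interpret Metric_space "\<Theta> t" "d\<Theta> t" by (rule metric_Theta[OF t])
  have "cont_map (\<Theta> t) (d\<Theta> t) (state_laws t) (wasserstein p state_dist) (gam S (Suc t))"
    using P1 t unfolding P1_def by blast
  then show ?thesis
    using \<eta> l by (subst (asm) cont_map_seq) (auto simp: wasserstein_def)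
qed

lemma hnorm_powr: "hnorm t z powr p = pcost p {1..t} z (ref t)"
  by (simp add: hist_dist_eq jdist_powr p_ge)

lemma hist_dist_nonneg: "0 \<le> hist_dist S t z z'"
  by (simp add: hist_dist_eq pair_dist_nonneg)

lemma hist_dist_root: "hist_dist S t z z' = pcost p {1..t} z z' powr (1 / p)"
proof -
  have "pcost p {1..t} z z' = hist_dist S t z z' powr p"
    by (simp only: hist_dist_eq jdist_powr[OF p_ge])
  then show ?thesis using p_pos hist_dist_nonneg[of t z z'] by (simp add: powr_powr)
qed

lemma hist_tendsto_iff:
  assumes "z \<in> H t" "\<And>n. zn n \<in> H t"
  shows "(\<lambda>n. hist_dist S t z (zn n)) \<longlonglongrightarrow> 0 \<longleftrightarrow> zn \<longlonglongrightarrow> z"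
proof -
  have "(\<lambda>n. hist_dist S t z (zn n)) \<longlonglongrightarrow> 0 \<longleftrightarrow> (\<lambda>n. pcost p {1..t} z (zn n)) \<longlonglongrightarrow> 0"
  proof
    assume "(\<lambda>n. hist_dist S t z (zn n)) \<longlonglongrightarrow> 0"
    from tendsto_zero_powrI[OF this tendsto_const _ p_pos]
    show "(\<lambda>n. pcost p {1..t} z (zn n)) \<longlonglongrightarrow> 0"
      by (simp add: hist_dist_eq jdist_powr p_ge pair_dist_nonneg)
  next
    assume "(\<lambda>n. pcost p {1..t} z (zn n)) \<longlonglongrightarrow> 0"
    from tendsto_zero_powrI[OF this tendsto_const, of "1 / p"]
    show "(\<lambda>n. hist_dist S t z (zn n)) \<longlonglongrightarrow> 0"
      using p_pos by (simp add: hist_dist_root pcost_nonneg)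
  qed
  also have "\<dots> \<longleftrightarrow> zn \<longlonglongrightarrow> z"
    using assms unfolding hist_eq by (intro pcost_tendsto_iff p_pos) auto
  finally show ?thesis .
qed

lemma cont_map_hist:
  assumes "\<And>a b. 0 \<le> d' a b"
  shows "cont_map (H t) (hist_dist S t) B d' f \<longleftrightarrow> f \<in> H t \<rightarrow> B \<and>
    (\<forall>z\<in>H t. \<forall>zn. (\<forall>n. zn n \<in> H t) \<and> zn \<longlonglongrightarrow> z \<longrightarrow> (\<lambda>n. d' (f z) (f (zn n))) \<longlonglongrightarrow> 0)"
  using hist_tendsto_iff by (subst cont_map_seq[OF hist_dist_nonneg assms]) blast

lemma cont_map_hist_real: "cont_map (H t) (hist_dist S t) UNIV dist f \<longleftrightarrow> continuous_on (H t) f"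
proof -
  have e: "(\<lambda>n. dist (f z) (f (zn n))) \<longlonglongrightarrow> 0 \<longleftrightarrow> (\<lambda>n. f (zn n)) \<longlonglongrightarrow> f z" for z and zn :: "nat \<Rightarrow> 'd path \<times> 'd path"
    using tendsto_dist_iff[of "\<lambda>n. f (zn n)" "f z" sequentially] by (simp add: dist_commute)
  have "cont_map (H t) (hist_dist S t) UNIV dist f \<longleftrightarrow>
    (\<forall>z\<in>H t. \<forall>zn. (\<forall>n. zn n \<in> H t) \<and> zn \<longlonglongrightarrow> z \<longrightarrow> (\<lambda>n. f (zn n)) \<longlonglongrightarrow> f z)"
    by (subst cont_map_hist) (simp_all add: e)
  also have "\<dots> \<longleftrightarrow> continuous_on (H t) f"
    by (auto simp: continuous_on_sequentially comp_def)
  finally show ?thesis .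
qed

lemma C_growth_hist:
  "C_growth a (H t) (hist_dist S t) (ref t) f \<longleftrightarrow>
     continuous_on (H t) f \<and> (\<exists>C>0. \<forall>z\<in>H t. \<bar>f z\<bar> \<le> C * (1 + hnorm t z powr a))"
  by (simp add: C_growth_def cont_map_hist_real)

lemma test_fun_C_growth: "C_growth a (H T) (hist_dist S T) (ref T) F \<Longrightarrow> test_fun a F"
  unfolding C_growth_hist test_fun_def by (meson less_imp_le)

text \<open>h is known with growth 1/r; it must also pass as a test function of growth p. The
  estimate behind it is \<open>x powr a \<le> 1 + x powr b\<close> for nonnegative x.\<close>

lemma test_fun_mono:
  assumes "test_fun a F" "0 < a" "a \<le> b"
  shows "test_fun b F"
proof -
  obtain C where C: "0 \<le> C" "\<And>z. z \<in> H T \<Longrightarrow> \<bar>F z\<bar> \<le> C * (1 + hnorm T z powr a)" "continuous_on (H T) F"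
    using assms(1) by (auto simp: test_fun_def)
  have "\<bar>F z\<bar> \<le> 2 * C * (1 + hnorm T z powr b)" if "z \<in> H T" for z
  proof -
    have "hnorm T z powr a \<le> 1 + hnorm T z powr b"
    proof (cases "hnorm T z \<le> 1")
      case True
      then have "hnorm T z powr a \<le> 1" using assms hist_dist_nonneg[of T z "ref T"] by (intro powr_le1) auto
      then show ?thesis by (simp add: add_increasing2)
    next
      case False
      then have "hnorm T z powr a \<le> hnorm T z powr b" using assms by (intro powr_mono) auto
      then show ?thesis by simp
    qed
    moreover have "A \<le> 1 + B \<Longrightarrow> 0 \<le> B \<Longrightarrow> 1 + A \<le> 2 * (1 + B)" for A B :: real by simp
    ultimately have "1 + hnorm T z powr a \<le> 2 * (1 + hnorm T z powr b)" using powr_ge_zero by blast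
    from mult_left_mono[OF this C(1)] show ?thesis using C(2)[OF that] by (simp add: algebra_simps)
  qed
  then show ?thesis using C by (auto simp: test_fun_def intro!: exI[of _ "2 * C"])
qed

definition hF :: "'d path \<times> 'd path \<Rightarrow> real" where "hF z = hfun S (fst z) (snd z)"
definition cF :: "nat \<Rightarrow> 'd path \<times> 'd path \<Rightarrow> real" where
  "cF t z = cost S (coord X (fst z) t) (coord Y (snd z) t) (fst z) (snd z)"

lemma test_hF: "test_fun (1 / rexp S) hF" "test_fun p hF"
proof -
  show *: "test_fun (1 / rexp S) hF"
    using O2 by (intro test_fun_C_growth) (simp add: O2_def hF_def[abs_def] case_prod_unfold)
  show "test_fun p hF" using test_fun_mono[OF * r_pos(1,2)] .
qed

lemma test_cF: "t \<le> T \<Longrightarrow> test_fun p (cF t)"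
  using O1 by (intro test_fun_C_growth) (simp add: O1_def cF_def[abs_def] case_prod_unfold)

section \<open>Extending and completing histories\<close>

lemma extend_in: "z \<in> H t \<Longrightarrow> u \<in> X (Suc t) \<times> Y (Suc t) \<Longrightarrow> extend t z u \<in> H (Suc t)"
  unfolding hist_eq extend_def by (auto intro!: path_space_update_space simp del: One_nat_def)

lemma glue_in: "t \<le> T \<Longrightarrow> z \<in> H t \<Longrightarrow> z' \<in> jset X Y {Suc t..T} \<Longrightarrow> glue T t z z' \<in> H T"
  by (auto simp: glue_def hist_eq mem_Times_iff PiE_iff cat_apply extensional_def)

lemma glue_horizon: "z \<in> H T \<Longrightarrow> glue T T z z' = z"
  using cat_horizon[of "fst z" T X "fst z'"] cat_horizon[of "snd z" T Y "snd z'"]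
  by (simp add: glue_def hist_def mem_Times_iff prod_eq_iff)

lemma measurable_glue:
  assumes "t \<le> T" "z \<in> H t" "continuous_on (H T) (F :: _ \<Rightarrow> real)"
  shows "(\<lambda>z'. F (glue T t z z')) \<in> borel_measurable (PS {Suc t..T})"
proof (rule measurable_continuous_on_sets)
  show "sets (PS {Suc t..T}) = sets (restrict_space borel (jset X Y {Suc t..T}))"
    by (rule cost_space.sets_M[OF cost_space_tail])
  show "continuous_on (jset X Y {Suc t..T}) (\<lambda>z'. F (glue T t z z'))"
    using glue_in[OF assms(1,2)] by (intro continuous_on_compose2[OF assms(3) continuous_on_glue]) auto
qed

lemma hnorm_cont: "continuous_on (H t) (hnorm t)"
proof -
  have "continuous_on (H t) (\<lambda>z. (z, ref t))" by (intro continuous_intros)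
  from continuous_on_compose2[OF continuous_on_pcost[OF p_pos, of UNIV "{1..t}"] this]
  have "continuous_on (H t) (\<lambda>z. pcost p {1..t} z (ref t))" by simp
  then have "continuous_on (H t) (\<lambda>z. pcost p {1..t} z (ref t) powr (1 / p))"
    using p_pos by (intro continuous_on_powr' continuous_on_const) (auto simp: pcost_nonneg)
  then show ?thesis by (simp add: hist_dist_root)
qed

text \<open>Powers of order p add up over the time steps because the metrics are of l^p type. A
  bound of growth p at time t + 1 thus splits into one on the past and the one-step cost of
  u.\<close>

lemma hnorm_ext: "hnorm (Suc t) (extend t z u) powr p = hnorm t z powr p + state_dist u (sref t) powr p"
proof -
  have "pcost p {1..Suc t} (extend t z u) (ref (Suc t)) = pcost p {1..t} z (ref t) +
     (norm (fst u - xref S (Suc t)) powr p + norm (snd u - yref S (Suc t)) powr p)"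
    unfolding pcost_def atLeast1AtMost_Suc
    by (subst sum.insert) (auto simp: extend_def hist_ref_def add.commute intro!: sum.cong)
  then show ?thesis using p_ge by (simp add: hnorm_powr pair_dist_powr dist_norm)
qed

lemma ker_Suc:
  assumes "t < T"
  shows "ker \<theta> t z = gam S (Suc t) (pol \<theta> t z) \<bind> (\<lambda>u. ker \<theta> (Suc t) (extend t z u) \<bind> (\<lambda>z'. return (PS {Suc t..T}) (extend t z' u)))"
proof -
  have "T - t = Suc (T - Suc t)" using assms by simp
  then show ?thesis by (simp add: policy_kernel_def extend_def)
qed

lemma measurable_ext_hist: "(\<lambda>w. extend t (fst w) (snd w)) \<in> PS {1..t} \<Otimes>\<^sub>M SS (Suc t) \<rightarrow>\<^sub>M PS {1..Suc t}"
  unfolding extend_def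
  by (intro measurable_Pair measurable_path_update[OF atLeast1AtMost_Suc]; measurable)

lemma measurable_ext_tail:
  assumes "t < T"
  shows "(\<lambda>(u, z'). extend t z' u) \<in> SS (Suc t) \<Otimes>\<^sub>M PS {Suc (Suc t)..T} \<rightarrow>\<^sub>M PS {Suc t..T}"
  unfolding extend_def case_prod_unfold
  by (intro measurable_Pair measurable_path_update[OF atLeastAtMost_Suc_left[OF assms]]; measurable)

lemma regular_ker_D:
  assumes "regular_from \<theta> t" "z \<in> H t"
  shows "sets (ker \<theta> t z) = sets (PS {Suc t..T})" "prob_space (ker \<theta> t z)" "space (ker \<theta> t z) = jset X Y {Suc t..T}"
proof -
  have "ker \<theta> t z \<in> space (prob_algebra (PS {Suc t..T}))"
    using assms measurable_space[of "ker \<theta> t" "PS {1..t}" "prob_algebra (PS {Suc t..T})" z]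
    by (simp add: regular_from_def space_PS hist_eq)
  then show s: "sets (ker \<theta> t z) = sets (PS {Suc t..T})" "prob_space (ker \<theta> t z)"
    by (auto simp: space_prob_algebra)
  show "space (ker \<theta> t z) = jset X Y {Suc t..T}" using sets_eq_imp_space_eq[OF s(1)] space_PS by simp
qed

lemma regular_marginals:
  assumes "regular_from \<theta> t" "z \<in> H t"
  shows "has_marginal (ker \<theta> t z) (path_space X {Suc t..T}) fst (tail_kernel T X (muk S) (T - t) t (fst z))"
    and "has_marginal (ker \<theta> t z) (path_space Y {Suc t..T}) snd (tail_kernel T Y (nuk S) (T - t) t (snd z))"
  using assms unfolding regular_from_def by blast+

lemma ker_horizon: "ker \<theta> T z = return (PS {}) (\<lambda>_. undefined, \<lambda>_. undefined)"
  by (simp add: policy_kernel_def)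

lemma regular_from_horizon: "regular_from \<theta> T"
  unfolding regular_from_def
proof (intro conjI ballI allI impI)
  show "ker \<theta> T \<in> PS {1..T} \<rightarrow>\<^sub>M prob_algebra (PS {Suc T..T})"
    by (simp add: ker_horizon space_prob_algebra prob_space_return space_PS)
  show "continuous_on (H T) (avg \<theta> T F)" if "test_fun p F" for F
  proof -
    have "avg \<theta> T F z = F z" if "z \<in> H T" for z
      unfolding avg_def integral_policy_kernel_horizon using glue_horizon[OF that] by simp
    then show ?thesis using that by (simp add: test_fun_def cong: continuous_on_cong)
  qed
qed (simp_all add: has_marginal_def ker_horizon nn_integral_return space_PS space_path_space)

section \<open>Moments under the continuation kernels\<close>

lemma tail_moment_measurable:
  "(\<lambda>x'. ennreal (path_dist p {1..T} (cat T t x x') x0 powr a)) \<in> borel_measurable (path_space Z {Suc t..T})"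
proof -
  have "(\<lambda>x'. cat T t x x' s) \<in> borel_measurable (path_space Z {Suc t..T})" for s
    by (rule measurable_continuous_on_sets[OF _ sets_path_space])
      (rule continuous_on_fun_apply, rule continuous_on_cat, rule continuous_on_const, rule continuous_on_id)
  note [measurable] = this
  show ?thesis unfolding path_dist_def by measurable
qed

text \<open>(K2) speaks of the kernels of \<open>\<mu>\<close> and \<open>\<nu>\<close> separately.
  Subadditivity splits the joint moment, and the marginals of the kernel are the composed kernels of
  \<open>\<mu>\<close> and \<open>\<nu>\<close>, whatever couplings the policy chooses.\<close>

lemma moment_bound:
  assumes g: "regular_from \<theta> t" and t: "t \<le> T" and a: "a \<in> {1 / rexp S, p}"
  obtains C where "0 \<le> C"
    "\<And>z. z \<in> H t \<Longrightarrow> (\<integral>\<^sup>+z'. ennreal (hnorm T (glue T t z z') powr a) \<partial>ker \<theta> t z) \<le> ennreal (C * (1 + hnorm t z powr a))"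
\<comment> \<open>(K2) is assumed before the horizon only; at T nothing remains to be averaged and
  the moment is the norm of the history itself.\<close>
proof (cases "t = T")
  case True
  have "(\<integral>\<^sup>+z'. ennreal (hnorm T (glue T T z z') powr a) \<partial>ker \<theta> T z) \<le> ennreal (1 * (1 + hnorm T z powr a))" if "z \<in> H T" for z
    using prob_space.emeasure_space_1[OF regular_ker_D(2)[OF regular_from_horizon that]]
    by (simp add: glue_horizon[OF that] ennreal_leI)
  then show thesis using that[of 1] True by auto
next
  case False
  then have tT: "t < T" using t by simp
  have a0: "0 < a" "a \<le> p" using a r_pos p_pos by auto
  obtain C1 where C1: "0 < C1" "\<And>x. x \<in> PiE {1..t} X \<Longrightarrow>
      (\<integral>\<^sup>+x'. ennreal (path_dist p {1..T} (cat T t x x') (xref S) powr a) \<partial>tail_kernel T X (muk S) (T - t) t x)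
        \<le> ennreal (C1 * (1 + path_dist p {1..t} x (xref S) powr a))"
    using K2[unfolded K2_def K2_marginal_def, THEN conjunct1, rule_format, OF tT a] by blast
  obtain C2 where C2: "0 < C2" "\<And>y. y \<in> PiE {1..t} Y \<Longrightarrow>
      (\<integral>\<^sup>+y'. ennreal (path_dist p {1..T} (cat T t y y') (yref S) powr a) \<partial>tail_kernel T Y (nuk S) (T - t) t y)
        \<le> ennreal (C2 * (1 + path_dist p {1..t} y (yref S) powr a))"
    using K2[unfolded K2_def K2_marginal_def, THEN conjunct2, rule_format, OF tT a] by blast
  show thesis
  proof (rule that[of "C1 + C2"])
    show "0 \<le> C1 + C2" using C1 C2 by simp
    fix z assume z: "z \<in> H t"
    have r: "path_dist p {1..s} x (fst (ref s)) = path_dist p {1..s} x (xref S)"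
      "path_dist p {1..s} x (snd (ref s)) = path_dist p {1..s} x (yref S)" for s x
      by (auto simp: hist_ref_def intro!: path_dist_cong)
    have le: "hnorm T w powr a \<le> path_dist p {1..T} (fst w) (xref S) powr a + path_dist p {1..T} (snd w) (yref S) powr a" for w
      using pair_dist_powr_le[OF p_ge a0, of "path_dist p {1..T}" "path_dist p {1..T}" w "ref T"]
      by (simp add: hist_dist_eq r path_dist_nonneg del: One_nat_def)
    note sK = regular_ker_D[OF g z]
    have zp: "fst z \<in> PiE {1..t} X" "snd z \<in> PiE {1..t} Y" using z by (auto simp: hist_eq)
    have m: "fst \<in> ker \<theta> t z \<rightarrow>\<^sub>M path_space X {Suc t..T}" "snd \<in> ker \<theta> t z \<rightarrow>\<^sub>M path_space Y {Suc t..T}"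
      by (simp_all add: measurable_cong_sets[OF sK(1) refl])
    have hle: "path_dist p {1..t} (fst z) (xref S) \<le> hnorm t z" "path_dist p {1..t} (snd z) (yref S) \<le> hnorm t z"
      using pair_dist_component_le[OF p_ge, of "path_dist p {1..t}" "path_dist p {1..t}" z "ref t"]
      by (simp_all add: hist_dist_eq r path_dist_nonneg del: One_nat_def)
    let ?f = "\<lambda>x'. ennreal (path_dist p {1..T} (cat T t (fst z) x') (xref S) powr a)"
    let ?g = "\<lambda>y'. ennreal (path_dist p {1..T} (cat T t (snd z) y') (yref S) powr a)"
    have "(\<integral>\<^sup>+z'. ennreal (hnorm T (glue T t z z') powr a) \<partial>ker \<theta> t z) \<le> (\<integral>\<^sup>+z'. ?f (fst z') + ?g (snd z') \<partial>ker \<theta> t z)"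
    proof (rule nn_integral_mono)
      fix z'
      show "ennreal (hnorm T (glue T t z z') powr a) \<le> ?f (fst z') + ?g (snd z')"
        using le[of "glue T t z z'"] by (simp add: glue_def ennreal_plus[symmetric] ennreal_leI del: ennreal_plus)
    qed
    also have "\<dots> = (\<integral>\<^sup>+z'. ?f (fst z') \<partial>ker \<theta> t z) + (\<integral>\<^sup>+z'. ?g (snd z') \<partial>ker \<theta> t z)"
      by (intro nn_integral_add measurable_compose[OF m(1) tail_moment_measurable]
          measurable_compose[OF m(2) tail_moment_measurable])
    also have "\<dots> = (\<integral>\<^sup>+x'. ?f x' \<partial>tail_kernel T X (muk S) (T - t) t (fst z)) +
      (\<integral>\<^sup>+y'. ?g y' \<partial>tail_kernel T Y (nuk S) (T - t) t (snd z))"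
      using regular_marginals[OF g z, THEN has_marginalD, OF tail_moment_measurable] by simp
    also have "\<dots> \<le> ennreal (C1 * (1 + path_dist p {1..t} (fst z) (xref S) powr a)) +
      ennreal (C2 * (1 + path_dist p {1..t} (snd z) (yref S) powr a))"
      by (intro add_mono C1 C2 zp)
    also have "\<dots> \<le> ennreal (C1 * (1 + hnorm t z powr a)) + ennreal (C2 * (1 + hnorm t z powr a))"
      using C1 C2 hle a0 path_dist_nonneg
      by (intro add_mono ennreal_leI mult_left_mono powr_mono2) auto
    also have "\<dots> = ennreal ((C1 + C2) * (1 + hnorm t z powr a))"
      using C1 C2 by (subst ennreal_plus[symmetric]) (auto simp: algebra_simps)
    finally show "(\<integral>\<^sup>+z'. ennreal (hnorm T (glue T t z z') powr a) \<partial>ker \<theta> t z) \<le> ennreal ((C1 + C2) * (1 + hnorm t z powr a))" .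
  qed
qed

text \<open>The bound on absolute values is kept as well: its finiteness at every history is what
  the tower property needs, whereas the bound on \<open>avg\<close> alone says nothing about
  integrability.\<close>

lemma avg_bound:
  assumes g: "regular_from \<theta> t" and t: "t \<le> T" and a: "a \<in> {1 / rexp S, p}" and F: "test_fun a F"
  obtains C where "0 \<le> C"
    "\<And>z. z \<in> H t \<Longrightarrow> (\<integral>\<^sup>+z'. ennreal \<bar>F (glue T t z z')\<bar> \<partial>ker \<theta> t z) \<le> ennreal (C * (1 + hnorm t z powr a))"
    "\<And>z. z \<in> H t \<Longrightarrow> \<bar>avg \<theta> t F z\<bar> \<le> C * (1 + hnorm t z powr a)"
proof -
  obtain C1 where C1: "0 \<le> C1" "\<And>z. z \<in> H T \<Longrightarrow> \<bar>F z\<bar> \<le> C1 * (1 + hnorm T z powr a)" and Fc: "continuous_on (H T) F"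
    using F by (auto simp: test_fun_def)
  obtain C2 where C2: "0 \<le> C2" "\<And>z. z \<in> H t \<Longrightarrow> (\<integral>\<^sup>+z'. ennreal (hnorm T (glue T t z z') powr a) \<partial>ker \<theta> t z) \<le> ennreal (C2 * (1 + hnorm t z powr a))"
    by (rule moment_bound[OF g t a]) blast
  have hda: "continuous_on (H T) (\<lambda>z. hnorm T z powr a)"
    using a r_pos p_pos by (intro continuous_on_powr' hnorm_cont continuous_on_const) (auto simp: hist_dist_nonneg)
  have 1: "(\<integral>\<^sup>+z'. ennreal \<bar>F (glue T t z z')\<bar> \<partial>ker \<theta> t z) \<le> ennreal (C1 * (1 + C2) * (1 + hnorm t z powr a))" if z: "z \<in> H t" for z
  proof -
    interpret prob_space "ker \<theta> t z" by (rule regular_ker_D(2)[OF g z])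
    note sK = regular_ker_D[OF g z]
    have [measurable]: "(\<lambda>z'. hnorm T (glue T t z z') powr a) \<in> borel_measurable (ker \<theta> t z)"
      using measurable_glue[OF t z hda] measurable_cong_sets[OF sK(1) refl] by blast
    have m: "(\<lambda>z'. ennreal (hnorm T (glue T t z z') powr a)) \<in> borel_measurable (ker \<theta> t z)"
      by measurable
    have "(\<integral>\<^sup>+z'. ennreal \<bar>F (glue T t z z')\<bar> \<partial>ker \<theta> t z) \<le> (\<integral>\<^sup>+z'. ennreal C1 * (1 + ennreal (hnorm T (glue T t z z') powr a)) \<partial>ker \<theta> t z)"
    proof (rule nn_integral_mono)
      fix z' assume "z' \<in> space (ker \<theta> t z)"
      then have "ennreal \<bar>F (glue T t z z')\<bar> \<le> ennreal (C1 * (1 + hnorm T (glue T t z z') powr a))"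
        using sK(3) glue_in[OF t z] by (intro ennreal_leI C1) auto
      then show "ennreal \<bar>F (glue T t z z')\<bar> \<le> ennreal C1 * (1 + ennreal (hnorm T (glue T t z z') powr a))"
        using C1 by (simp add: ennreal_mult)
    qed
    also have "\<dots> = ennreal C1 * (1 + (\<integral>\<^sup>+z'. ennreal (hnorm T (glue T t z z') powr a) \<partial>ker \<theta> t z))"
      using m by (simp add: nn_integral_cmult nn_integral_add emeasure_space_1)
    also have "\<dots> \<le> ennreal C1 * (1 + ennreal (C2 * (1 + hnorm t z powr a)))"
      by (intro mult_left_mono add_left_mono C2 z) auto
    also have "\<dots> = ennreal (C1 * (1 + C2 * (1 + hnorm t z powr a)))"
      using C1 C2 by (simp add: ennreal_mult)
    also have "\<dots> \<le> ennreal (C1 * ((1 + C2) * (1 + hnorm t z powr a)))"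
      using C1 by (intro ennreal_leI mult_left_mono) (auto simp: algebra_simps)
    finally show ?thesis by (simp add: mult.assoc)
  qed
  show thesis
  proof (rule that[OF _ 1])
    show nn: "0 \<le> C1 * (1 + C2)" using C1 C2 by simp
    fix z assume z: "z \<in> H t"
    note sK = regular_ker_D[OF g z]
    have m: "(\<lambda>z'. F (glue T t z z')) \<in> borel_measurable (ker \<theta> t z)"
      using measurable_glue[OF t z Fc] measurable_cong_sets[OF sK(1) refl] by blast
    have "integrable (ker \<theta> t z) (\<lambda>z'. F (glue T t z z'))"
      using m 1[OF z] by (intro real_integral_eq_nn_integrals(1)) (auto intro: le_less_trans)
    from integral_norm_bound_ennreal[OF this] 1[OF z]
    have "ennreal \<bar>avg \<theta> t F z\<bar> \<le> ennreal (C1 * (1 + C2) * (1 + hnorm t z powr a))"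
      by (simp add: avg_def)
    moreover have "0 \<le> C1 * (1 + C2) * (1 + hnorm t z powr a)" by (intro mult_nonneg_nonneg[OF nn]) auto
    ultimately show "\<bar>avg \<theta> t F z\<bar> \<le> C1 * (1 + C2) * (1 + hnorm t z powr a)" by (simp add: ennreal_le_iff)
  qed
qed

end

section \<open>Optimal policies\<close>

context dp_problem
begin

abbreviation "Dset t z \<equiv> D_corr S t (fst z) (snd z)"
abbreviation "obj \<theta> t z \<equiv> f_fun S \<theta> t (fst z) (snd z)"
abbreviation "optimizer \<theta> t z \<equiv> DP_optimizer S \<theta> t (fst z) (snd z)"

lemma ker_ext_measurable:
  assumes g: "regular_from \<theta> (Suc t)" and z: "z \<in> H t"
  shows "(\<lambda>u. ker \<theta> (Suc t) (extend t z u)) \<in> SS (Suc t) \<rightarrow>\<^sub>M prob_algebra (PS {Suc (Suc t)..T})"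
proof -
  have "z \<in> space (PS {1..t})" using z by (simp only: space_PS hist_eq)
  from measurable_compose[OF measurable_Pair1'[OF this] measurable_ext_hist]
  have "(\<lambda>u. extend t z u) \<in> SS (Suc t) \<rightarrow>\<^sub>M PS {1..Suc t}" by simp
  moreover have "ker \<theta> (Suc t) \<in> PS {1..Suc t} \<rightarrow>\<^sub>M prob_algebra (PS {Suc (Suc t)..T})"
    using g unfolding regular_from_def by blast
  ultimately show ?thesis by (rule measurable_compose)
qed

text \<open>Tower property. The absolute integral is finite for each u by \<open>avg_bound\<close>,
  and remains finite over \<open>gam\<close> because \<open>hnorm_ext\<close> reduces the bound to
  the p-th moment of a law in \<open>state_laws t\<close>.\<close>

lemma avg_Suc:
  assumes t: "t < T" and g: "regular_from \<theta> (Suc t)" and z: "z \<in> H t" and \<eta>: "pol \<theta> t z \<in> \<Theta> t"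
    and F: "test_fun p F"
  shows "avg \<theta> t F z = (\<integral>u. avg \<theta> (Suc t) F (extend t z u) \<partial>gam S (Suc t) (pol \<theta> t z))"
proof -
  let ?M = "gam S (Suc t) (pol \<theta> t z)" and ?B = "PS {Suc t..T}"
  let ?N = "\<lambda>u. ker \<theta> (Suc t) (extend t z u) \<bind> (\<lambda>z'. return ?B (extend t z' u))"
  note gD = gam_D[OF t \<eta>]
  have Fc: "continuous_on (H T) F" using F by (simp add: test_fun_def)
  have mF: "(\<lambda>y. F (glue T t z y)) \<in> borel_measurable ?B"
    using t by (intro measurable_glue z Fc) simp
  have mF': "(\<lambda>y. ennreal \<bar>F (glue T t z y)\<bar>) \<in> borel_measurable ?B" using mF by measurable
  interpret gM: prob_space ?M by (rule gD)
  have ne: "space (SS (Suc t)) \<noteq> {}" using gM.not_empty gD(3) by (simp add: space_SS)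
  note nn = nn_integral_bind_update[OF gD(1) ne ker_ext_measurable[OF g z] measurable_ext_tail[OF t] mF']
  have N: "?N \<in> ?M \<rightarrow>\<^sub>M subprob_algebra ?B"
    using measurable_prob_algebraD[OF nn(1)] measurable_cong_sets[OF gD(1) refl] by blast
  have st: "Suc t \<le> T" using t by simp
  have pa: "p \<in> {1 / rexp S, p}" by simp
  obtain C where C: "0 \<le> C"
    "\<And>z. z \<in> H (Suc t) \<Longrightarrow> (\<integral>\<^sup>+z'. ennreal \<bar>F (glue T (Suc t) z z')\<bar> \<partial>ker \<theta> (Suc t) z) \<le> ennreal (C * (1 + hnorm (Suc t) z powr p))"
    by (rule avg_bound[OF g st pa F]) blast
  have b: "(\<integral>\<^sup>+y. ennreal \<bar>F (glue T t z y)\<bar> \<partial>?N u) \<le> ennreal (C * (1 + hnorm (Suc t) (extend t z u) powr p))"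
    if u: "u \<in> X (Suc t) \<times> Y (Suc t)" for u
    using nn(2)[of u] C(2)[OF extend_in[OF z u]] u by (simp add: space_SS glue_ext[OF t])
  have "integrable ?M (\<lambda>u. state_dist u (sref t) powr p)"
    by (rule cost_space.integrable_rho[OF cost_space_state[OF t] gam_laws[OF t \<eta>]])
  then have i: "integrable ?M (\<lambda>u. C * (1 + hnorm (Suc t) (extend t z u) powr p))"
    unfolding hnorm_ext by simp
  have "(\<integral>\<^sup>+u. \<integral>\<^sup>+y. ennreal \<bar>F (glue T t z y)\<bar> \<partial>?N u \<partial>?M) \<le> (\<integral>\<^sup>+u. ennreal (C * (1 + hnorm (Suc t) (extend t z u) powr p)) \<partial>?M)"
    using b gD(3) by (intro nn_integral_mono) simp
  also have "\<dots> < \<infinity>"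
    using C(1) by (subst nn_integral_eq_integral[OF i]) auto
  finally have fin: "(\<integral>\<^sup>+u. \<integral>\<^sup>+y. ennreal \<bar>F (glue T t z y)\<bar> \<partial>?N u \<partial>?M) < \<infinity>" .
  have "avg \<theta> t F z = (\<integral>u. (\<integral>y. F (glue T t z y) \<partial>?N u) \<partial>?M)"
    unfolding avg_def ker_Suc[OF t]
  proof (rule integral_bind_real[OF mF N _ fin gM.not_empty])
    fix u assume "u \<in> space ?M"
    then show "(\<integral>\<^sup>+y. ennreal \<bar>F (glue T t z y)\<bar> \<partial>?N u) < \<infinity>"
      using b[of u] gD(3) by (auto intro: le_less_trans)
  qed
  also have "\<dots> = (\<integral>u. avg \<theta> (Suc t) F (extend t z u) \<partial>?M)"
  proof (intro lebesgue_integral_cong refl)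
    fix u assume "u \<in> space ?M"
    then have u: "u \<in> X (Suc t) \<times> Y (Suc t)" using gD(3) by simp
    note kD = regular_ker_D[OF g extend_in[OF z u]]
    have "u \<in> space (SS (Suc t))" using u by (simp only: space_SS)
    from measurable_compose[OF measurable_Pair1'[OF this] measurable_ext_tail[OF t]]
    have m: "(\<lambda>z'. extend t z' u) \<in> ker \<theta> (Suc t) (extend t z u) \<rightarrow>\<^sub>M ?B"
      using measurable_cong_sets[OF kD(1) refl, of ?B] by simp
    \<comment> \<open>The inner composition with a point mass is a push-forward, so the real
      integral transfers without further integrability.\<close>
    have "?N u = distr (ker \<theta> (Suc t) (extend t z u)) ?B (\<lambda>z'. extend t z' u)"
      using prob_space.not_empty[OF kD(2)] m by (rule bind_return_distr')
    then show "(\<integral>y. F (glue T t z y) \<partial>?N u) = avg \<theta> (Suc t) F (extend t z u)"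
      using integral_distr[OF m mF] by (simp add: avg_def glue_ext[OF t])
  qed
  finally show ?thesis .
qed

text \<open>History and parameter both move, so integrand and law change together. A growth constant
  common to the whole sequence is needed; it is \<open>C * (1 + B)\<close>, since norms are bounded
  along a convergent sequence.\<close>

lemma gam_integral_tendsto:
  assumes t: "t < T" and g: "regular_from \<theta> (Suc t)" and F: "test_fun p F"
    and z: "z \<in> H t" "\<And>n. zn n \<in> H t" "zn \<longlonglongrightarrow> z"
    and \<eta>: "\<eta> \<in> \<Theta> t" "\<And>n. \<eta>n n \<in> \<Theta> t" "(\<lambda>n. d\<Theta> t \<eta> (\<eta>n n)) \<longlonglongrightarrow> 0"
  shows "(\<lambda>n. \<integral>u. avg \<theta> (Suc t) F (extend t (zn n) u) \<partial>gam S (Suc t) (\<eta>n n)) \<longlonglongrightarrow>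
    (\<integral>u. avg \<theta> (Suc t) F (extend t z u) \<partial>gam S (Suc t) \<eta>)"
proof -
  have st: "Suc t \<le> T" using t by simp
  have pa: "p \<in> {1 / rexp S, p}" by simp
  obtain C where C: "0 \<le> C" "\<And>z. z \<in> H (Suc t) \<Longrightarrow> \<bar>avg \<theta> (Suc t) F z\<bar> \<le> C * (1 + hnorm (Suc t) z powr p)"
    by (rule avg_bound[OF g st pa F]) blast
  have "(\<lambda>n. hnorm t (zn n)) \<longlonglongrightarrow> hnorm t z"
    using continuous_on_tendsto_compose[OF hnorm_cont z(3) z(1)] z(2) by simp
  then have "Bseq (\<lambda>n. hnorm t (zn n))" by (intro convergent_imp_Bseq) (auto simp: convergent_def)
  then obtain B0 where B0: "\<And>n. hnorm t (zn n) \<le> B0" by (auto simp: Bseq_def abs_le_iff)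
  define B where "B = max (hnorm t z) B0 powr p"
  have B: "hnorm t z powr p \<le> B" "hnorm t (zn n) powr p \<le> B" for n
    using B0[of n] p_pos hist_dist_nonneg unfolding B_def by (intro powr_mono2; simp)+
  have B0: "0 \<le> B" by (simp add: B_def)
  have bound: "\<bar>avg \<theta> (Suc t) F (extend t w u)\<bar> \<le> C * (1 + B) * (1 + state_dist u (sref t) powr p)"
    if "w \<in> H t" "hnorm t w powr p \<le> B" "u \<in> X (Suc t) \<times> Y (Suc t)" for w u
  proof -
    let ?r = "state_dist u (sref t) powr p"
    have "0 \<le> B * ?r" using B0 by (intro mult_nonneg_nonneg) auto
    then have "1 + (hnorm t w powr p + ?r) \<le> (1 + B) * (1 + ?r)" using that(2) by (simp add: algebra_simps)
    from mult_left_mono[OF this C(1)] show ?thesis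
      using C(2)[OF extend_in[OF that(1,3)]] by (simp only: hnorm_ext mult.assoc)
  qed
  have c: "continuous_on (H (Suc t)) (avg \<theta> (Suc t) F)" using g F unfolding regular_from_def by blast
  have cc: "continuous_on (H t \<times> (X (Suc t) \<times> Y (Suc t))) (\<lambda>w. avg \<theta> (Suc t) F (extend t (fst w) (snd w)))"
    by (rule continuous_on_compose2[OF c continuous_on_ext]) (auto intro!: extend_in)
  show ?thesis
  proof (rule cost_space.integral_tendsto[OF cost_space_state[OF t], where H="H t" and z=z and zn=zn
        and F="\<lambda>z u. avg \<theta> (Suc t) F (extend t z u)" and C="C * (1 + B)"])
    show "continuous_on (H t \<times> X (Suc t) \<times> Y (Suc t)) (\<lambda>(z, u). avg \<theta> (Suc t) F (extend t z u))"
      using cc by (simp add: case_prod_unfold)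
    show "0 \<le> C * (1 + B)" using C B0 by simp
  qed (use z \<eta> t gam_laws gam_tendsto bound B in auto)
qed

text \<open>The average of \<open>cF t\<close>, not of \<open>cF (Suc t)\<close>, appears:
  b_{t+1}(x_t, y_t, .) keeps the state of time t, and extending the history does not change that
  coordinate.\<close>

lemma f_fun_eq:
  "obj \<theta> t z \<eta> =
    Gfun S (coord X (fst z) t) (coord Y (snd z) t) (\<integral>u. avg \<theta> (Suc t) hF (extend t z u) \<partial>gam S (Suc t) \<eta>) +
    (\<integral>u. avg \<theta> (Suc t) (cF t) (extend t z u) \<partial>gam S (Suc t) \<eta>)"
  by (simp add: f_fun_def g_fun_def b_fun_def avg_def hF_def cF_def glue_def extend_def coord_cat coord_update)

lemma value_fun_eq:
  "value_fun S \<theta> t (fst z) (snd z) =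
    avg \<theta> t (cF t) z + Gfun S (coord X (fst z) t) (coord Y (snd z) t) (avg \<theta> t hF z)"
  by (simp add: value_fun_def J_cost_def avg_def hF_def cF_def glue_def coord_cat)

lemma coord_in: "t \<le> T \<Longrightarrow> z \<in> H t \<Longrightarrow> coord X (fst z) t \<in> X t" "t \<le> T \<Longrightarrow> z \<in> H t \<Longrightarrow> coord Y (snd z) t \<in> Y t"
  using initial_states by (auto simp: coord_def hist_eq mem_Times_iff PiE_iff)

lemma Gfun_tendsto:
  assumes t: "t \<le> T" and z: "z \<in> H t" "\<And>n. zn n \<in> H t" "zn \<longlonglongrightarrow> z" and g: "gn \<longlonglongrightarrow> g"
  shows "(\<lambda>n. Gfun S (coord X (fst (zn n)) t) (coord Y (snd (zn n)) t) (gn n))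
    \<longlonglongrightarrow> Gfun S (coord X (fst z) t) (coord Y (snd z) t) g"
proof -
  have "(\<lambda>n. fst (zn n)) \<longlonglongrightarrow> fst z" "(\<lambda>n. snd (zn n)) \<longlonglongrightarrow> snd z"
    using tendsto_fst[OF z(3)] tendsto_snd[OF z(3)] by auto
  then have "(\<lambda>n. fst (zn n) t) \<longlonglongrightarrow> fst z t" "(\<lambda>n. snd (zn n) t) \<longlonglongrightarrow> snd z t"
    by (simp_all add: tendsto_fun_iff)
  then have "(\<lambda>n. coord X (fst (zn n)) t) \<longlonglongrightarrow> coord X (fst z) t" "(\<lambda>n. coord Y (snd (zn n)) t) \<longlonglongrightarrow> coord Y (snd z) t"
    by (simp_all add: coord_def)
  then have l: "(\<lambda>n. (coord X (fst (zn n)) t, coord Y (snd (zn n)) t, gn n)) \<longlonglongrightarrow> (coord X (fst z) t, coord Y (snd z) t, g)"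
    by (intro tendsto_Pair g)
  have "continuous_on (X t \<times> Y t \<times> UNIV) (\<lambda>(a, b, g). Gfun S a b g)"
    using O3 t by (simp add: O3_def)
  from continuous_on_tendsto_compose[OF this l] show ?thesis
    using coord_in[OF t z(1)] coord_in[OF t z(2)] by simp
qed

lemma f_fun_tendsto:
  assumes t: "t < T" and g: "regular_from \<theta> (Suc t)"
    and z: "z \<in> H t" "\<And>n. zn n \<in> H t" "zn \<longlonglongrightarrow> z"
    and \<eta>: "\<eta> \<in> \<Theta> t" "\<And>n. \<eta>n n \<in> \<Theta> t" "(\<lambda>n. d\<Theta> t \<eta> (\<eta>n n)) \<longlonglongrightarrow> 0"
  shows "(\<lambda>n. obj \<theta> t (zn n) (\<eta>n n)) \<longlonglongrightarrow> obj \<theta> t z \<eta>"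
  unfolding f_fun_eq using t
  by (intro tendsto_add Gfun_tendsto gam_integral_tendsto g test_hF test_cF z \<eta>) auto

section \<open>Minimization over the parameter sets\<close>

lemma Dset_P2:
  assumes "t < T" "z \<in> H t"
  shows "Dset t z \<noteq> {}" (is ?nonempty) "convex (Dset t z)" (is ?convex)
    "compactin (Metric_space.mtopology (\<Theta> t) (d\<Theta> t)) (Dset t z)" (is ?compact)
proof -
  have "\<forall>(x, y)\<in>hist S t. D_corr S t x y \<noteq> {} \<and> convex (D_corr S t x y) \<and>
           compactin (Metric_space.mtopology (\<Theta> t) (d\<Theta> t)) (D_corr S t x y)"
    using P2 assms(1) unfolding P2_def by blast
  then show ?nonempty ?convex
    ?compact
    using assms(2) by (auto simp: case_prod_unfold)
qed

lemma Dset_subset: "Dset t z \<subseteq> \<Theta> t"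
  by (auto simp: D_corr_def)

lemma optimizer_iff: "optimizer \<theta> t z \<eta> \<longleftrightarrow> \<eta> \<in> Dset t z \<and> (\<forall>\<eta>'\<in>Dset t z. obj \<theta> t z \<eta> \<le> obj \<theta> t z \<eta>')"
  by (auto simp: DP_optimizer_def is_arg_min_def not_less)

lemma optimizer_exists:
  assumes t: "t < T" and g: "regular_from \<theta> (Suc t)" and z: "z \<in> H t"
  shows "\<exists>\<eta>. optimizer \<theta> t z \<eta>"
proof -
  interpret Metric_space "\<Theta> t" "d\<Theta> t" by (rule metric_Theta[OF t])
  obtain v where "v \<in> Dset t z" "\<And>w. w \<in> Dset t z \<Longrightarrow> obj \<theta> t z v \<le> obj \<theta> t z w"
  proof (rule compactin_attains_min[OF Dset_P2(3)[OF t z] Dset_P2(1)[OF t z], where f="obj \<theta> t z"])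
    show "(\<lambda>n. obj \<theta> t z (vn n)) \<longlonglongrightarrow> obj \<theta> t z v"
      if "v \<in> \<Theta> t" "\<And>n. vn n \<in> \<Theta> t" "(\<lambda>n. d\<Theta> t v (vn n)) \<longlonglongrightarrow> 0" for v vn
      using that by (intro f_fun_tendsto[OF t g z z tendsto_const]) auto
  qed blast
  then show ?thesis by (auto simp: optimizer_iff)
qed

text \<open>Otherwise the midpoint of w and \<open>\<eta>\<close>, which lies in the convex set
  \<open>Dset t z\<close>, would have a value below the minimum. The hypothesis compares values
  instead of asking w to be optimal, as \<open>berge_unique_argmin\<close> wants it.\<close>

lemma optimizer_unique_le:
  assumes t: "t < T" and o: "optimal_from S (Suc t) \<theta>" and z: "z \<in> H t"
    and opt: "optimizer \<theta> t z \<eta>" and w: "w \<in> Dset t z" "obj \<theta> t z w \<le> obj \<theta> t z \<eta>"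
  shows "w = \<eta>"
proof (rule ccontr)
  assume "w \<noteq> \<eta>"
  have e: "\<eta> \<in> Dset t z" "\<And>\<eta>'. \<eta>' \<in> Dset t z \<Longrightarrow> obj \<theta> t z \<eta> \<le> obj \<theta> t z \<eta>'" using opt by (auto simp: optimizer_iff)
  have "strictly_quasiconvex (\<Theta> t) (obj \<theta> t z)"
    using P3 t o z unfolding P3_def by (auto simp: case_prod_unfold)
  moreover have "w \<in> \<Theta> t" "\<eta> \<in> \<Theta> t" using w(1) e(1) Dset_subset by blast+
  ultimately have "obj \<theta> t z (l *\<^sub>R w + (1 - l) *\<^sub>R \<eta>) < max (obj \<theta> t z w) (obj \<theta> t z \<eta>)" if "0 < l" "l < 1" for l
    using \<open>w \<noteq> \<eta>\<close> that unfolding strictly_quasiconvex_def by blast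
  from this[of "1/2"] have "obj \<theta> t z ((1/2) *\<^sub>R w + (1 - 1/2) *\<^sub>R \<eta>) < max (obj \<theta> t z w) (obj \<theta> t z \<eta>)"
    by simp
  moreover have "(1/2) *\<^sub>R w + (1 - 1/2) *\<^sub>R \<eta> \<in> Dset t z"
    by (rule convexD[OF Dset_P2(2)[OF t z] w(1) e(1)]) auto
  ultimately show False using e(2)[of "(1/2) *\<^sub>R w + (1 - 1/2) *\<^sub>R \<eta>"] w(2) by linarith
qed

lemma optimal_from_optimizer: "optimal_from S t \<theta> \<Longrightarrow> t \<le> s \<Longrightarrow> s < T \<Longrightarrow> z \<in> H s \<Longrightarrow> optimizer \<theta> s z (pol \<theta> s z)"
  by (auto simp: optimal_from_def case_prod_unfold)

lemma optimal_from_Suc: "optimal_from S t \<theta> \<Longrightarrow> optimal_from S (Suc t) \<theta>"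
  by (simp add: optimal_from_def)

lemma policy_in_Theta: "optimal_from S t \<theta> \<Longrightarrow> t < T \<Longrightarrow> z \<in> H t \<Longrightarrow> pol \<theta> t z \<in> \<Theta> t"
  using optimal_from_optimizer[of t \<theta> t z] Dset_subset[of t z] unfolding optimizer_iff by blast

text \<open>Every optimal policy is continuous, however its values were selected: the minimizer at
  each history is the only one, and Berge's argument leaves no freedom.\<close>

lemma policy_tendsto:
  assumes t: "t < T" and o: "optimal_from S t \<theta>" and g: "regular_from \<theta> (Suc t)"
    and z: "z \<in> H t" "\<And>n. zn n \<in> H t" "zn \<longlonglongrightarrow> z"
  shows "(\<lambda>n. d\<Theta> t (pol \<theta> t z) (pol \<theta> t (zn n))) \<longlonglongrightarrow> 0"
proof -
  interpret Metric_space "\<Theta> t" "d\<Theta> t" by (rule metric_Theta[OF t])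
  have hz: "(\<lambda>n. hist_dist S t z (zn n)) \<longlonglongrightarrow> 0" using hist_tendsto_iff z by blast
  have uhc: "upper_hemicontinuous (hist S t) (hist_dist S t) mtopology (Dset t)"
   and lhc: "lower_hemicontinuous (hist S t) (hist_dist S t) mtopology (Dset t)"
    using P2 t by (auto simp: P2_def case_prod_unfold)
  have opt: "optimizer \<theta> t w (pol \<theta> t w)" if "w \<in> H t" for w
    using optimal_from_optimizer[OF o _ t that] by simp
  show ?thesis
  proof (rule berge_unique_argmin[where D="Dset t" and z=z and zn=zn and f="obj \<theta> t"])
    show "compactin mtopology (Dset t z)" by (rule Dset_P2(3)[OF t z(1)])
    show "Dset t (zn n) \<subseteq> \<Theta> t" for n by (rule Dset_subset)
    show "zn \<longlonglongrightarrow> z" by (rule z)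
    show "\<forall>\<^sub>F n in sequentially. Dset t (zn n) \<subseteq> U" if "openin mtopology U" "Dset t z \<subseteq> U" for U
    proof -
      have "\<exists>\<delta>>0. \<forall>w\<in>H t. hist_dist S t z w < \<delta> \<longrightarrow> Dset t w \<subseteq> U"
        by (rule uhc[unfolded upper_hemicontinuous_def, rule_format, OF z(1) conjI[OF that]])
      then obtain \<delta> where \<delta>: "0 < \<delta>" "\<And>w. w \<in> H t \<Longrightarrow> hist_dist S t z w < \<delta> \<Longrightarrow> Dset t w \<subseteq> U" by blast
      show ?thesis
        by (rule eventually_mono[OF order_tendstoD(2)[OF hz \<delta>(1)]]) (rule \<delta>(2)[OF z(2)])
    qed
    show "\<forall>\<^sub>F n in sequentially. Dset t (zn n) \<inter> U \<noteq> {}" if "openin mtopology U" "Dset t z \<inter> U \<noteq> {}" for U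
    proof -
      have "\<exists>\<delta>>0. \<forall>w\<in>H t. hist_dist S t z w < \<delta> \<longrightarrow> Dset t w \<inter> U \<noteq> {}"
        by (rule lhc[unfolded lower_hemicontinuous_def, rule_format, OF z(1) conjI[OF that]])
      then obtain \<delta> where \<delta>: "0 < \<delta>" "\<And>w. w \<in> H t \<Longrightarrow> hist_dist S t z w < \<delta> \<Longrightarrow> Dset t w \<inter> U \<noteq> {}" by blast
      show ?thesis
        by (rule eventually_mono[OF order_tendstoD(2)[OF hz \<delta>(1)]]) (rule \<delta>(2)[OF z(2)])
    qed
    show "(\<lambda>n. obj \<theta> t (zn (r n)) (vn n)) \<longlonglongrightarrow> obj \<theta> t z v"
      if "filterlim r sequentially sequentially" "v \<in> \<Theta> t" "\<And>n. vn n \<in> \<Theta> t"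
        "(\<lambda>n. d\<Theta> t v (vn n)) \<longlonglongrightarrow> 0" for r v vn
      using filterlim_compose[OF z(3) that(1)] that z by (intro f_fun_tendsto[OF t g]) auto
    show "pol \<theta> t z \<in> Dset t z" using opt[OF z(1)] by (simp add: optimizer_iff)
    show "w = pol \<theta> t z" if "w \<in> Dset t z" "obj \<theta> t z w \<le> obj \<theta> t z (pol \<theta> t z)" for w
      by (rule optimizer_unique_le[OF t optimal_from_Suc[OF o] z(1) opt[OF z(1)] that])
    show "pol \<theta> t (zn n) \<in> Dset t (zn n)" for n using opt[OF z(2)] by (simp add: optimizer_iff)
    show "obj \<theta> t (zn n) (pol \<theta> t (zn n)) \<le> obj \<theta> t (zn n) w" if "w \<in> Dset t (zn n)" for n w
      using opt[OF z(2)] that by (simp add: optimizer_iff)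
  qed
qed

text \<open>Takes the place of a measurable selection: the policy is continuous, so
  \<open>gam\<close> along it is weakly continuous and
  \<open>measurable_prob_kernel_continuous\<close> applies. Measurability is what allows the
  composition defining \<open>ker\<close> to be evaluated.\<close>

lemma gam_policy_measurable:
  assumes t: "t < T" and o: "optimal_from S t \<theta>" and g: "regular_from \<theta> (Suc t)"
  shows "(\<lambda>z. gam S (Suc t) (pol \<theta> t z)) \<in> PS {1..t} \<rightarrow>\<^sub>M prob_algebra (SS (Suc t))"
proof (rule measurable_prob_kernel_continuous[where E="X (Suc t) \<times> Y (Suc t)" and H="H t"])
  show "sets (SS (Suc t)) = sets (restrict_space borel (X (Suc t) \<times> Y (Suc t)))"
    by (rule cost_space.sets_M[OF cost_space_state[OF t]])
  show "sets (PS {1..t}) = sets (restrict_space borel (H t))"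
    using t by (intro cost_space.sets_M[OF cost_space_hist]) simp
  show "closed (X (Suc t) \<times> Y (Suc t))" using t closed_states by (intro closed_Times) auto
  fix \<phi> :: "(real ^ 'd) \<times> (real ^ 'd) \<Rightarrow> real"
  assume \<phi>: "continuous_on UNIV \<phi>" "\<And>u. \<bar>\<phi> u\<bar> \<le> 1"
  show "continuous_on (H t) (\<lambda>z. \<integral>u. \<phi> u \<partial>gam S (Suc t) (pol \<theta> t z))"
  proof (rule continuous_on_seqI)
    fix z zn assume z: "z \<in> H t" "\<And>n. zn n \<in> H t" "zn \<longlonglongrightarrow> z"
    show "(\<lambda>n. \<integral>u. \<phi> u \<partial>gam S (Suc t) (pol \<theta> t (zn n))) \<longlonglongrightarrow> (\<integral>u. \<phi> u \<partial>gam S (Suc t) (pol \<theta> t z))"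
    proof (rule cost_space.integral_tendsto[OF cost_space_state[OF t], where H="H t" and z=z and zn=zn and F="\<lambda>z u. \<phi> u" and C=1])
      have "continuous_on (H t \<times> X (Suc t) \<times> Y (Suc t)) (\<lambda>w. \<phi> (snd w))"
        by (rule continuous_on_compose2[OF \<phi>(1)]) (auto intro: continuous_intros)
      then show "continuous_on (H t \<times> X (Suc t) \<times> Y (Suc t)) (\<lambda>(z, u). \<phi> u)" by (simp add: case_prod_unfold)
      show "\<bar>\<phi> u\<bar> \<le> 1 * (1 + state_dist u (sref t) powr p)" for u
        using \<phi>(2)[of u] by (simp add: add_increasing2)
      then show "\<bar>\<phi> u\<bar> \<le> 1 * (1 + state_dist u (sref t) powr p)" for u .
      show "(\<lambda>n. wasserstein p state_dist (gam S (Suc t) (pol \<theta> t z)) (gam S (Suc t) (pol \<theta> t (zn n)))) \<longlonglongrightarrow> 0"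
        by (rule gam_tendsto[OF t _ _ policy_tendsto[OF t o g z]]) (use policy_in_Theta[OF o t] z in auto)
    qed (use z gam_laws[OF t policy_in_Theta[OF o t]] in auto)
  qed
qed (use gam_D[OF t policy_in_Theta[OF o t]] in auto)

text \<open>Measurability comes from \<open>gam_policy_measurable\<close>, continuity of averages
  from the tower property and \<open>gam_integral_tendsto\<close>, and the marginals from the
  optimizer lying in \<open>Dset t z\<close>, which makes the next step a coupling of the one-step
  kernels.\<close>

lemma regular_from_step:
  assumes t: "t < T" and o: "optimal_from S t \<theta>" and g: "regular_from \<theta> (Suc t)"
  shows "regular_from \<theta> t"
  unfolding regular_from_def
proof (intro conjI ballI allI impI)
  have k: "ker \<theta> (Suc t) \<in> PS {1..Suc t} \<rightarrow>\<^sub>M prob_algebra (PS {Suc (Suc t)..T})"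
    using g unfolding regular_from_def by blast
  have m1: "(\<lambda>w. ker \<theta> (Suc t) (extend t (fst w) (snd w))) \<in> PS {1..t} \<Otimes>\<^sub>M SS (Suc t) \<rightarrow>\<^sub>M prob_algebra (PS {Suc (Suc t)..T})"
    by (rule measurable_compose[OF measurable_ext_hist k])
  have m2: "(\<lambda>v. return (PS {Suc t..T}) (extend t (snd v) (snd (fst v))))
      \<in> (PS {1..t} \<Otimes>\<^sub>M SS (Suc t)) \<Otimes>\<^sub>M PS {Suc (Suc t)..T} \<rightarrow>\<^sub>M prob_algebra (PS {Suc t..T})"
  proof (rule measurable_compose[OF _ measurable_return_prob_space])
    have "(\<lambda>v. (snd (fst v), snd v)) \<in> (PS {1..t} \<Otimes>\<^sub>M SS (Suc t)) \<Otimes>\<^sub>M PS {Suc (Suc t)..T} \<rightarrow>\<^sub>M SS (Suc t) \<Otimes>\<^sub>M PS {Suc (Suc t)..T}"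
      by measurable
    from measurable_compose[OF this measurable_ext_tail[OF t]]
    show "(\<lambda>v. extend t (snd v) (snd (fst v))) \<in> (PS {1..t} \<Otimes>\<^sub>M SS (Suc t)) \<Otimes>\<^sub>M PS {Suc (Suc t)..T} \<rightarrow>\<^sub>M PS {Suc t..T}"
      by simp
  qed
  have "(\<lambda>w. ker \<theta> (Suc t) (extend t (fst w) (snd w)) \<bind> (\<lambda>z'. return (PS {Suc t..T}) (extend t z' (snd w))))
     \<in> PS {1..t} \<Otimes>\<^sub>M SS (Suc t) \<rightarrow>\<^sub>M prob_algebra (PS {Suc t..T})"
    by (rule measurable_bind_prob_space2[OF m1]) (use m2 in \<open>simp add: case_prod_unfold\<close>)
  then show "ker \<theta> t \<in> PS {1..t} \<rightarrow>\<^sub>M prob_algebra (PS {Suc t..T})"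
    unfolding ker_Suc[OF t]
    by (intro measurable_bind_prob_space2[OF gam_policy_measurable[OF t o g]]) (simp add: case_prod_unfold)
next
  fix F assume F: "test_fun p F"
  show "continuous_on (H t) (avg \<theta> t F)"
  proof (rule continuous_on_seqI)
    fix z zn assume z: "z \<in> H t" "\<And>n. zn n \<in> H t" "zn \<longlonglongrightarrow> z"
    show "(\<lambda>n. avg \<theta> t F (zn n)) \<longlonglongrightarrow> avg \<theta> t F z"
      unfolding avg_Suc[OF t g z(1) policy_in_Theta[OF o t z(1)] F] avg_Suc[OF t g z(2) policy_in_Theta[OF o t z(2)] F]
      by (rule gam_integral_tendsto[OF t g F z policy_in_Theta[OF o t z(1)] policy_in_Theta[OF o t z(2)] policy_tendsto[OF t o g z]])
  qed
next
  fix z assume z: "z \<in> H t"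
  let ?\<gamma> = "gam S (Suc t) (pol \<theta> t z)"
  have \<eta>: "pol \<theta> t z \<in> \<Theta> t" by (rule policy_in_Theta[OF o t z])
  note gD = gam_D[OF t \<eta>]
  have "optimizer \<theta> t z (pol \<theta> t z)" by (rule optimal_from_optimizer[OF o order_refl t z])
  then have cpl: "distr ?\<gamma> (muk S t (fst z)) fst = muk S t (fst z)" "distr ?\<gamma> (nuk S t (snd z)) snd = nuk S t (snd z)"
    by (auto simp: optimizer_iff D_corr_def couplings_def)
  interpret gM: prob_space ?\<gamma> by (rule gD)
  have ne: "space (SS (Suc t)) \<noteq> {}" using gM.not_empty gD(3) by (simp add: space_SS)
  note nn = nn_integral_bind_update(3)[OF gD(1) ne ker_ext_measurable[OF g z] measurable_ext_tail[OF t]]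
  \<comment> \<open>One argument for both sides: \<open>pr\<close> projects paths and
    \<open>pr'\<close> states, with \<open>\<kappa>\<close> the kernels of \<open>\<mu>\<close> or
    of \<open>\<nu>\<close>. The inner integral depends on u through \<open>pr' u\<close> only, so
    that the coupling enters through one marginal.\<close>
  have marginal: "has_marginal (ker \<theta> t z) (path_space Z {Suc t..T}) pr (tail_kernel T Z \<kappa> (T - t) t (pr z))"
    if \<kappa>: "\<And>t. t < T \<Longrightarrow> \<kappa> t \<in> path_space Z {1..t} \<rightarrow>\<^sub>M prob_algebra (state_space Z (Suc t))"
      and x: "pr z \<in> PiE {1..t} Z"
      and pr: "\<And>z' u. pr (extend t z' u) = (pr z')(Suc t := pr' u)"
        "pr \<in> PS {Suc t..T} \<rightarrow>\<^sub>M path_space Z {Suc t..T}" "pr' \<in> SS (Suc t) \<rightarrow>\<^sub>M state_space Z (Suc t)"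
      and d: "distr ?\<gamma> (\<kappa> t (pr z)) pr' = \<kappa> t (pr z)"
      and IH: "\<And>w. w \<in> H (Suc t) \<Longrightarrow> has_marginal (ker \<theta> (Suc t) w) (path_space Z {Suc (Suc t)..T}) pr
          (tail_kernel T Z \<kappa> (T - Suc t) (Suc t) (pr w))"
    for \<kappa> :: "nat \<Rightarrow> 'd path \<Rightarrow> (real ^ 'd) measure" and Z and pr :: "'d path \<times> 'd path \<Rightarrow> 'd path" and pr'
    unfolding has_marginal_def
  proof
    fix \<phi> :: "'d path \<Rightarrow> ennreal" assume \<phi>: "\<phi> \<in> borel_measurable (path_space Z {Suc t..T})"
    let ?K = "\<lambda>u. tail_kernel T Z \<kappa> (T - Suc t) (Suc t) ((pr z)(Suc t := u))"
    let ?Q = "\<lambda>u. \<integral>\<^sup>+x'. \<phi> (x'(Suc t := u)) \<partial>?K u"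
    have upd: "(\<lambda>w. \<phi> ((snd w)(Suc t := fst w))) \<in> borel_measurable (state_space Z (Suc t) \<Otimes>\<^sub>M path_space Z {Suc (Suc t)..T})"
      by (rule measurable_compose[OF _ \<phi>], rule measurable_path_update[OF atLeastAtMost_Suc_left[OF t]]) auto
    have "(\<lambda>u. (pr z)(Suc t := u)) \<in> state_space Z (Suc t) \<rightarrow>\<^sub>M path_space Z {1..Suc t}"
      using x by (intro measurable_path_update[OF atLeast1AtMost_Suc] measurable_const) (auto simp: space_path_space)
    from measurable_compose[OF this tail_kernel_measurable[OF \<kappa>]]
    have "?K \<in> state_space Z (Suc t) \<rightarrow>\<^sub>M subprob_algebra (path_space Z {Suc (Suc t)..T})"
      using t by (intro measurable_prob_algebraD) simp
    then have Q: "?Q \<in> borel_measurable (state_space Z (Suc t))"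
      using upd by (intro nn_integral_measurable_subprob_algebra2) (simp_all add: case_prod_unfold)
    have sk: "sets (\<kappa> t (pr z)) = sets (state_space Z (Suc t))"
      using measurable_space[OF \<kappa>[OF t], of "pr z"] x by (simp add: space_path_space space_prob_algebra)
    have "(\<integral>\<^sup>+z'. \<phi> (pr z') \<partial>ker \<theta> t z) = (\<integral>\<^sup>+u. \<integral>\<^sup>+z'. \<phi> ((pr z')(Suc t := pr' u)) \<partial>ker \<theta> (Suc t) (extend t z u) \<partial>?\<gamma>)"
      unfolding ker_Suc[OF t] using measurable_compose[OF pr(2) \<phi>] by (subst nn) (simp_all add: pr(1))
    also have "\<dots> = (\<integral>\<^sup>+u. ?Q (pr' u) \<partial>?\<gamma>)"
    proof (rule nn_integral_cong)
      fix u assume "u \<in> space ?\<gamma>"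
      then have u: "u \<in> X (Suc t) \<times> Y (Suc t)" using gD(3) by simp
      have "pr' u \<in> space (state_space Z (Suc t))"
        by (rule measurable_space[OF pr(3)]) (simp only: space_SS u)
      from measurable_compose[OF measurable_Pair1'[OF this] upd]
      have "(\<lambda>x'. \<phi> (x'(Suc t := pr' u))) \<in> borel_measurable (path_space Z {Suc (Suc t)..T})" by simp
      from has_marginalD[OF IH[OF extend_in[OF z u]] this]
      show "(\<integral>\<^sup>+z'. \<phi> ((pr z')(Suc t := pr' u)) \<partial>ker \<theta> (Suc t) (extend t z u)) = ?Q (pr' u)"
        by (simp add: pr(1))
    qed
    also have "\<dots> = (\<integral>\<^sup>+u. ?Q u \<partial>distr ?\<gamma> (\<kappa> t (pr z)) pr')"
    proof (rule nn_integral_distr[symmetric])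
      show "pr' \<in> ?\<gamma> \<rightarrow>\<^sub>M \<kappa> t (pr z)"
        using pr(3) measurable_cong_sets[OF gD(1) sk] by blast
      show "?Q \<in> borel_measurable (distr ?\<gamma> (\<kappa> t (pr z)) pr')"
        unfolding measurable_distr_eq1 using Q measurable_cong_sets[OF sk refl] by blast
    qed
    \<comment> \<open>The coupling property \<open>d\<close> replaces the push-forward by the
      one-step kernel, and what remains is the recursion of \<open>tail_kernel\<close>.\<close>
    also have "\<dots> = (\<integral>\<^sup>+x'. \<phi> x' \<partial>tail_kernel T Z \<kappa> (T - t) t (pr z))"
      unfolding d using tail_kernel_nn_integral[OF \<kappa> t x \<phi>] by simp
    finally show "(\<integral>\<^sup>+z'. \<phi> (pr z') \<partial>ker \<theta> t z) = (\<integral>\<^sup>+x'. \<phi> x' \<partial>tail_kernel T Z \<kappa> (T - t) t (pr z))" .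
  qed
  have zs: "fst z \<in> PiE {1..t} X" "snd z \<in> PiE {1..t} Y" using z by (auto simp: hist_eq)
  show "has_marginal (ker \<theta> t z) (path_space X {Suc t..T}) fst (tail_kernel T X (muk S) (T - t) t (fst z))"
    by (rule marginal[OF kernels_measurable(1) zs(1) _ _ _ cpl(1) regular_marginals(1)[OF g]]) (auto simp: extend_def)
  show "has_marginal (ker \<theta> t z) (path_space Y {Suc t..T}) snd (tail_kernel T Y (nuk S) (T - t) t (snd z))"
    by (rule marginal[OF kernels_measurable(2) zs(2) _ _ _ cpl(2) regular_marginals(2)[OF g]]) (auto simp: extend_def)
qed

lemma optimal_imp_regular: "optimal_from S t \<theta> \<Longrightarrow> t \<le> T \<Longrightarrow> regular_from \<theta> t"
proof (induction "T - t" arbitrary: t)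
  case 0
  then show ?case using regular_from_horizon by simp
next
  case (Suc n)
  then have t: "t < T" "n = T - Suc t" "Suc t \<le> T" by auto
  show ?case
    by (rule regular_from_step[OF t(1) Suc.prems(1) Suc.hyps(1)[OF t(2) optimal_from_Suc[OF Suc.prems(1)] t(3)]])
qed

end

section \<open>Existence and uniqueness of optimal policies\<close>

lemma joint_kernel_cong: "(\<And>k. t < k \<Longrightarrow> \<theta> k = \<theta>' k) \<Longrightarrow> joint_kernel S \<theta> n t x y = joint_kernel S \<theta>' n t x y"
proof (induction n arbitrary: t x y)
  case (Suc n)
  have "joint_kernel S \<theta> n (Suc t) x' y' = joint_kernel S \<theta>' n (Suc t) x' y'" for x' y'
    by (rule Suc.IH) (simp add: Suc.prems)
  then show ?case by (simp add: Suc.prems)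
qed simp

text \<open>The objective at t looks at the policy strictly after index t + 1, so that redefining it
  at t + 1 disturbs neither this objective nor any later one.\<close>

lemma f_fun_cong: "(\<And>k. Suc t < k \<Longrightarrow> \<theta> k = \<theta>' k) \<Longrightarrow> f_fun S \<theta> t = f_fun S \<theta>' t"
  using joint_kernel_cong[of "Suc t" \<theta> \<theta>' S]
  by (simp add: fun_eq_iff f_fun_def g_fun_def b_fun_def policy_kernel_def)

context dp_problem
begin

lemma optimal_policy_exists: "t \<le> T \<Longrightarrow> \<exists>\<theta>. optimal_from S t \<theta>"
proof (induction "T - t" arbitrary: t)
  case 0
  then show ?case by (auto simp: optimal_from_def)
next
  case (Suc n)
  then have t: "t < T" "n = T - Suc t" "Suc t \<le> T" by auto
  obtain \<theta> where o: "optimal_from S (Suc t) \<theta>" using Suc.hyps(1)[OF t(2,3)] by blast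
  \<comment> \<open>The choice is made for every pair x, y; outside \<open>H t\<close> an optimizer
    may fail to exist and the value is arbitrary, which \<open>optimal_from\<close> does not
    inspect.\<close>
  define \<theta>' where "\<theta>' = \<theta>(Suc t := (\<lambda>x y. SOME \<eta>. DP_optimizer S \<theta> t x y \<eta>))"
  have f: "f_fun S \<theta>' s = f_fun S \<theta> s" if "t \<le> s" for s
    using that by (intro f_fun_cong) (simp add: \<theta>'_def)
  have "DP_optimizer S \<theta>' s x y (\<theta>' (Suc s) x y)" if s: "t \<le> s" "s < T" and xy: "(x, y) \<in> H s" for s x y
  proof (cases "s = t")
    case True
    have "\<exists>\<eta>. DP_optimizer S \<theta> t x y \<eta>"
      using optimizer_exists[OF t(1) optimal_imp_regular[OF o t(3)], of "(x, y)"] xy True by simp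
    from someI_ex[OF this] show ?thesis
      using f[OF s(1)] True by (simp add: \<theta>'_def DP_optimizer_def)
  next
    case False
    then have "DP_optimizer S \<theta> s x y (\<theta> (Suc s) x y)"
      using optimal_from_optimizer[OF o _ s(2), of "(x, y)"] s(1) xy by simp
    then show ?thesis using f[OF s(1)] False by (simp add: \<theta>'_def DP_optimizer_def)
  qed
  then show ?case unfolding optimal_from_def by blast
qed

text \<open>Equal kernels from t + 1 on give equal objectives at t, hence the same minimizer, and
  then equal kernels at t. Agreement is confined to histories, as the values of a policy elsewhere
  are arbitrary.\<close>

lemma optimal_policy_unique:
  "\<lbrakk>optimal_from S t \<theta>; optimal_from S t \<theta>'; t \<le> T; z \<in> H t\<rbrakk> \<Longrightarrow>
    ker \<theta>' t z = ker \<theta> t z \<and> (t < T \<longrightarrow> pol \<theta>' t z = pol \<theta> t z)"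
proof (induction "T - t" arbitrary: t z)
  case 0
  then have "t = T" by simp
  then show ?case by (simp only: ker_horizon) simp
next
  case (Suc n)
  then have t: "t < T" "n = T - Suc t" "Suc t \<le> T" by auto
  note o = optimal_from_Suc[OF Suc.prems(1)] and o' = optimal_from_Suc[OF Suc.prems(2)]
  have k: "ker \<theta>' (Suc t) w = ker \<theta> (Suc t) w" if "w \<in> H (Suc t)" for w
    using Suc.hyps(1)[OF t(2) o o' t(3) that] by blast
  have i: "(\<integral>u. avg \<theta>' (Suc t) F (extend t z u) \<partial>gam S (Suc t) \<eta>) = (\<integral>u. avg \<theta> (Suc t) F (extend t z u) \<partial>gam S (Suc t) \<eta>)"
    if "\<eta> \<in> \<Theta> t" for F \<eta>
    using gam_D(3)[OF t(1) that] k[OF extend_in[OF Suc.prems(4)]]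
    by (intro lebesgue_integral_cong refl) (simp add: avg_def)
  have e: "obj \<theta>' t z \<eta> = obj \<theta> t z \<eta>" if "\<eta> \<in> Dset t z" for \<eta>
    unfolding f_fun_eq i[OF subsetD[OF Dset_subset that]] ..
  have p: "optimizer \<theta> t z (pol \<theta> t z)" "optimizer \<theta>' t z (pol \<theta>' t z)"
    using optimal_from_optimizer[OF Suc.prems(1) order_refl t(1) Suc.prems(4)]
      optimal_from_optimizer[OF Suc.prems(2) order_refl t(1) Suc.prems(4)] by auto
  have "pol \<theta>' t z \<in> Dset t z" "obj \<theta> t z (pol \<theta>' t z) \<le> obj \<theta> t z (pol \<theta> t z)"
    using p e by (auto simp: optimizer_iff)
  then have q: "pol \<theta>' t z = pol \<theta> t z"
    by (rule optimizer_unique_le[OF t(1) o Suc.prems(4) p(1)])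
  have "ker \<theta>' t z = ker \<theta> t z"
    unfolding ker_Suc[OF t(1)] q
  \<comment> \<open>The continuations agree only along histories, so they are compared on the space
    of the one-step law.\<close>
  proof (rule bind_cong[OF refl])
    fix u assume "u \<in> space (gam S (Suc t) (pol \<theta> t z))"
    then have "u \<in> X (Suc t) \<times> Y (Suc t)"
      using gam_D(3)[OF t(1) policy_in_Theta[OF Suc.prems(1) t(1) Suc.prems(4)]] by simp
    then show "ker \<theta>' (Suc t) (extend t z u) \<bind> (\<lambda>z'. return (PS {Suc t..T}) (extend t z' u)) =
        ker \<theta> (Suc t) (extend t z u) \<bind> (\<lambda>z'. return (PS {Suc t..T}) (extend t z' u))"
      using k[OF extend_in[OF Suc.prems(4)]] by simp
  qed
  then show ?case using q by blast
qed

section \<open>Continuity of the equilibrium kernel in W_p\<close>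

lemma tail_cost_le: "t \<le> T \<Longrightarrow> pcost p {Suc t..T} z' (tail_ref t) \<le> hnorm T (glue T t z z') powr p"
proof -
  assume t: "t \<le> T"
  have "pcost p {Suc t..T} z' (tail_ref t) = pcost p {Suc t..T} (glue T t z z') (ref T)"
    unfolding pcost_def using t by (intro sum.cong refl) (simp add: glue_def cat_apply hist_ref_def)
  also have "\<dots> \<le> pcost p {1..T} (glue T t z z') (ref T)"
    unfolding pcost_def by (intro sum_mono2) auto
  finally show ?thesis by (simp only: hnorm_powr)
qed

lemma ker_in_tail_laws:
  assumes g: "regular_from \<theta> t" and t: "t \<le> T" and z: "z \<in> H t"
  shows "ker \<theta> t z \<in> tail_laws S t"
proof -
  note kD = regular_ker_D[OF g z]
  have pa: "p \<in> {1 / rexp S, p}" by simp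
  obtain C where C: "\<And>z. z \<in> H t \<Longrightarrow> (\<integral>\<^sup>+z'. ennreal (hnorm T (glue T t z z') powr p) \<partial>ker \<theta> t z) \<le> ennreal (C * (1 + hnorm t z powr p))"
    by (rule moment_bound[OF g t pa]) blast
  have "(\<integral>\<^sup>+z'. ennreal (tail_dist S t z' (tail_ref t) powr p) \<partial>ker \<theta> t z) \<le> (\<integral>\<^sup>+z'. ennreal (hnorm T (glue T t z z') powr p) \<partial>ker \<theta> t z)"
    using tail_cost_le[OF t] by (intro nn_integral_mono ennreal_leI) (simp add: tail_dist_eq jdist_powr p_ge)
  also have "\<dots> \<le> ennreal (C * (1 + hnorm t z powr p))" by (rule C[OF z])
  also have "\<dots> < \<infinity>" by simp
  finally show ?thesis using kD by (simp add: tail_laws_def P_moment_def)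
qed

text \<open>A test function on the tails becomes one on full paths by composition with the
  restriction \<open>R\<close>, which undoes \<open>glue\<close>. Continuity of averages in
  \<open>regular_from\<close> then yields the convergence of integrals required by
  \<open>wasserstein_tendsto\<close>.\<close>

lemma ker_tendsto:
  assumes g: "regular_from \<theta> t" and t: "t \<le> T" and z: "z \<in> H t" "\<And>n. zn n \<in> H t" "zn \<longlonglongrightarrow> z"
  shows "(\<lambda>n. wasserstein p (tail_dist S t) (ker \<theta> t z) (ker \<theta> t (zn n))) \<longlonglongrightarrow> 0"
proof (rule cost_space.wasserstein_tendsto[OF cost_space_tail])
  show "ker \<theta> t z \<in> P_moment p (PS {Suc t..T}) (tail_dist S t) (tail_ref t)"
    using ker_in_tail_laws[OF g t z(1)] by (simp add: tail_laws_def)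
  show "ker \<theta> t (zn n) \<in> P_moment p (PS {Suc t..T}) (tail_dist S t) (tail_ref t)" for n
    using ker_in_tail_laws[OF g t z(2)] by (simp add: tail_laws_def)
  fix \<phi> :: "'d path \<times> 'd path \<Rightarrow> real" and C
  assume \<phi>: "continuous_on (jset X Y {Suc t..T}) \<phi>"
    and le: "\<And>u. u \<in> jset X Y {Suc t..T} \<Longrightarrow> \<bar>\<phi> u\<bar> \<le> C * (1 + tail_dist S t u (tail_ref t) powr p)"
  define R where "R w = (restrict (fst w) {Suc t..T}, restrict (snd w) {Suc t..T})" for w :: "'d path \<times> 'd path"
  have R_in: "R w \<in> jset X Y {Suc t..T}" if "w \<in> H T" for w
    using that by (auto simp: R_def hist_eq mem_Times_iff PiE_iff)
  have R_cont: "continuous_on A R" for A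
  proof -
    have rc: "continuous_on A (\<lambda>w. restrict (f w) {Suc t..T})" if "continuous_on A f" for f :: "'d path \<times> 'd path \<Rightarrow> 'd path"
    proof (rule continuous_on_coordinatewise_then_product)
      fix i show "continuous_on A (\<lambda>w. restrict (f w) {Suc t..T} i)"
        using continuous_on_fun_apply[OF that, of i] by (cases "i \<in> {Suc t..T}") auto
    qed
    show ?thesis
      unfolding R_def by (intro continuous_on_Pair rc continuous_on_fst continuous_on_snd continuous_on_id)
  qed
  have R_glue: "R (glue T t w z') = z'" if "z' \<in> jset X Y {Suc t..T}" for w z'
    using that by (auto simp: R_def glue_def PiE_iff restrict_cat)
  have "test_fun p (\<lambda>w. \<phi> (R w))"
    unfolding test_fun_def
  proof (intro conjI exI[of _ "\<bar>C\<bar>"] ballI)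
    show "continuous_on (H T) (\<lambda>w. \<phi> (R w))"
      by (rule continuous_on_compose2[OF \<phi> R_cont], rule image_subsetI, rule R_in)
    fix w assume w: "w \<in> H T"
    have "\<bar>\<phi> (R w)\<bar> \<le> C * (1 + tail_dist S t (R w) (tail_ref t) powr p)" by (rule le[OF R_in[OF w]])
    \<comment> \<open>\<open>test_fun\<close> requires a nonnegative constant, while C comes without
      a sign.\<close>
    also have "\<dots> \<le> \<bar>C\<bar> * (1 + tail_dist S t (R w) (tail_ref t) powr p)"
      by (intro mult_right_mono) auto
    also have "\<dots> \<le> \<bar>C\<bar> * (1 + hnorm T w powr p)"
    proof (intro mult_left_mono add_left_mono)
      \<comment> \<open>Gluing the past of w to its own tail gives back w, so the cost of the tail
        is bounded by that of the full path.\<close>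
      have "glue T t w (R w) = w"
        using w t by (auto simp: glue_def R_def cat_apply fun_eq_iff prod_eq_iff hist_eq mem_Times_iff PiE_iff extensional_def)
      then show "tail_dist S t (R w) (tail_ref t) powr p \<le> hnorm T w powr p"
        using tail_cost_le[OF t, of "R w" w] by (simp add: tail_dist_eq jdist_powr p_ge)
    qed simp
    finally show "\<bar>\<phi> (R w)\<bar> \<le> \<bar>C\<bar> * (1 + hnorm T w powr p)" .
  qed simp
  then have "continuous_on (H t) (avg \<theta> t (\<lambda>w. \<phi> (R w)))"
    using g unfolding regular_from_def by blast
  from continuous_on_tendsto_compose[OF this z(3) z(1)]
  have "(\<lambda>n. avg \<theta> t (\<lambda>w. \<phi> (R w)) (zn n)) \<longlonglongrightarrow> avg \<theta> t (\<lambda>w. \<phi> (R w)) z"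
    using z(2) by simp
  moreover have "avg \<theta> t (\<lambda>w. \<phi> (R w)) w = (\<integral>u. \<phi> u \<partial>ker \<theta> t w)" if "w \<in> H t" for w
    unfolding avg_def using regular_ker_D(3)[OF g that]
    by (intro lebesgue_integral_cong refl) (simp add: R_glue)
  ultimately show "(\<lambda>n. \<integral>u. \<phi> u \<partial>ker \<theta> t (zn n)) \<longlonglongrightarrow> (\<integral>u. \<phi> u \<partial>ker \<theta> t z)"
    using z(1,2) by simp
qed

section \<open>Dynamic programming equation and growth of the value\<close>

lemma value_fun_DP:
  assumes t: "t < T" and o: "optimal_from S t \<theta>" and z: "z \<in> H t"
  shows "value_fun S \<theta> t (fst z) (snd z) = (INF \<eta>\<in>Dset t z. obj \<theta> t z \<eta>)"
proof -
  have g: "regular_from \<theta> (Suc t)" using optimal_imp_regular[OF optimal_from_Suc[OF o]] t by simp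
  \<comment> \<open>\<open>value_fun\<close> is the cost of the whole continuation; the tower
    property, applied to h and to c separately, identifies it with the objective at the parameter of
    the policy.\<close>
  have "value_fun S \<theta> t (fst z) (snd z) = obj \<theta> t z (pol \<theta> t z)"
    using avg_Suc[OF t g z policy_in_Theta[OF o t z]] test_hF(2) test_cF[of t] t
    by (simp add: value_fun_eq f_fun_eq)
  \<comment> \<open>The minimum is attained at the policy, so no separate lower bound has to be
    shown for the infimum of reals.\<close>
  also have "\<dots> = (INF \<eta>\<in>Dset t z. obj \<theta> t z \<eta>)"
    using optimal_from_optimizer[OF o order_refl t z]
    by (intro cInf_eq_minimum[symmetric]) (auto simp: optimizer_iff)
  finally show ?thesis .
qed

abbreviation "Gavg \<theta> t z \<equiv> Gfun S (coord X (fst z) t) (coord Y (snd z) t) (avg \<theta> t hF z)"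

text \<open>The exponents fit exactly: the average of h has growth 1/r, G raises it to the power pr,
  and the product is p. This is where moments of order 1/r are needed; growth p of the average would
  in general give too large an exponent.\<close>

lemma Gfun_avg_bound:
  assumes t: "t \<le> T" and g: "regular_from \<theta> t"
  obtains C where "0 \<le> C"
    "\<And>z. z \<in> H t \<Longrightarrow> \<bar>Gavg \<theta> t z\<bar> \<le> C * (1 + hnorm t z powr p)"
proof -
  let ?q = "p * rexp S"
  have q: "0 \<le> ?q" "?q / rexp S = p"
    using mult_nonneg_nonneg[OF less_imp_le[OF p_pos] less_imp_le[OF r_pos(3)]] r_pos(3) by simp_all
  obtain C0 where C0: "0 < C0" "\<And>a b h. a \<in> X t \<Longrightarrow> b \<in> Y t \<Longrightarrow> \<bar>Gfun S a b h\<bar> \<le> C0 * (1 + \<bar>h\<bar> powr ?q +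
      state_dist (a, b) (coord X (xref S) t, coord Y (yref S) t) powr p)"
    using O3[unfolded O3_def, rule_format, OF t, THEN conjunct2] by blast
  have ra: "1 / rexp S \<in> {1 / rexp S, p}" by simp
  obtain C1 where C1: "0 \<le> C1" "\<And>z. z \<in> H t \<Longrightarrow> \<bar>avg \<theta> t hF z\<bar> \<le> C1 * (1 + hnorm t z powr (1 / rexp S))"
    by (rule avg_bound[OF g t ra test_hF(1)]) blast
  \<comment> \<open>\<open>2 powr ?q\<close> is the constant of \<open>powr_quasi_triangle\<close>
    for the sum \<open>1 + hnorm t z powr (1 / rexp S)\<close>.\<close>
  define C2 where "C2 = C1 powr ?q * 2 powr ?q"
  have C2: "0 \<le> C2" by (simp add: C2_def)
  show thesis
  proof (rule that[of "C0 * (1 + C2 + 1)"])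
    show "0 \<le> C0 * (1 + C2 + 1)" using C0 C2 by simp
    fix z assume z: "z \<in> H t"
    have "\<bar>avg \<theta> t hF z\<bar> powr ?q \<le> (C1 * (1 + hnorm t z powr (1 / rexp S))) powr ?q"
      using C1(2)[OF z] q by (intro powr_mono2) auto
    also have "\<dots> = C1 powr ?q * (1 + hnorm t z powr (1 / rexp S)) powr ?q"
      using C1 by (intro powr_mult)
    also have "\<dots> \<le> C1 powr ?q * (2 powr ?q * (1 powr ?q + (hnorm t z powr (1 / rexp S)) powr ?q))"
      using q by (intro mult_left_mono powr_quasi_triangle) auto
    also have "\<dots> = C2 * (1 + hnorm t z powr p)"
      using r_pos q by (simp add: C2_def powr_powr)
    finally have a: "\<bar>avg \<theta> t hF z\<bar> powr ?q \<le> C2 * (1 + hnorm t z powr p)" .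
    have b: "state_dist (coord X (fst z) t, coord Y (snd z) t) (coord X (xref S) t, coord Y (yref S) t) powr p \<le> hnorm t z powr p"
    \<comment> \<open>At time 0 both arguments are the fixed initial state and the distance is 0,
      whatever \<open>xref S 0\<close> is.\<close>
    proof (cases "t = 0")
      case True
      then show ?thesis using p_ge by (simp add: pair_dist_powr coord_def)
    next
      case False
      have "norm (fst z t - fst (ref t) t) powr p + norm (snd z t - snd (ref t) t) powr p \<le> pcost p {1..t} z (ref t)"
        unfolding pcost_def using False by (intro member_le_sum) auto
      then show ?thesis
        unfolding hnorm_powr using False p_ge by (simp add: pair_dist_powr coord_def hist_ref_def dist_norm)
    qed
    have "\<bar>Gavg \<theta> t z\<bar> \<le> C0 * (1 + \<bar>avg \<theta> t hF z\<bar> powr ?q +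
      state_dist (coord X (fst z) t, coord Y (snd z) t) (coord X (xref S) t, coord Y (yref S) t) powr p)"
      using coord_in[OF t z] by (intro C0(2)) auto
    also have "\<dots> \<le> C0 * (1 + C2 * (1 + hnorm t z powr p) + hnorm t z powr p)"
      using a b C0(1) by (intro mult_left_mono add_mono) auto
    also have "\<dots> \<le> C0 * ((1 + C2 + 1) * (1 + hnorm t z powr p))"
      using C0(1) by (intro mult_left_mono) (auto simp: algebra_simps)
    finally show "\<bar>Gavg \<theta> t z\<bar> \<le> C0 * (1 + C2 + 1) * (1 + hnorm t z powr p)"
      by (simp add: mult.assoc)
  qed
qed

lemma value_fun_growth:
  assumes t: "t \<le> T" and g: "regular_from \<theta> t"
  shows "C_growth p (H t) (hist_dist S t) (ref t) (\<lambda>z. value_fun S \<theta> t (fst z) (snd z))"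
  unfolding C_growth_hist value_fun_eq
proof (intro conjI)
  have c: "continuous_on (H t) (avg \<theta> t hF)" "continuous_on (H t) (avg \<theta> t (cF t))"
    using g test_hF(2) test_cF[OF t] unfolding regular_from_def by blast+
  have "continuous_on (H t) (\<lambda>z. Gavg \<theta> t z)"
  proof (rule continuous_on_seqI)
    fix z zn assume z: "z \<in> H t" "\<And>n. zn n \<in> H t" "zn \<longlonglongrightarrow> z"
    from continuous_on_tendsto_compose[OF c(1) z(3) z(1)]
    show "(\<lambda>n. Gavg \<theta> t (zn n))
        \<longlonglongrightarrow> Gavg \<theta> t z"
      using z(2) by (intro Gfun_tendsto[OF t z]) simp
  qed
  then show "continuous_on (H t) (\<lambda>z. avg \<theta> t (cF t) z + Gavg \<theta> t z)"
    by (intro continuous_on_add c)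
  have pa: "p \<in> {1 / rexp S, p}" by simp
  obtain C1 where C1: "0 \<le> C1" "\<And>z. z \<in> H t \<Longrightarrow> \<bar>avg \<theta> t (cF t) z\<bar> \<le> C1 * (1 + hnorm t z powr p)"
    by (rule avg_bound[OF g t pa test_cF[OF t]]) blast
  obtain C2 where C2: "0 \<le> C2"
    "\<And>z. z \<in> H t \<Longrightarrow> \<bar>Gavg \<theta> t z\<bar> \<le> C2 * (1 + hnorm t z powr p)"
    by (rule Gfun_avg_bound[OF t g]) blast
  show "\<exists>C>0. \<forall>z\<in>H t. \<bar>avg \<theta> t (cF t) z + Gavg \<theta> t z\<bar>
      \<le> C * (1 + hnorm t z powr p)"
  proof (intro exI[of _ "C1 + C2 + 1"] conjI ballI)
    fix z assume z: "z \<in> H t"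
    have "\<bar>avg \<theta> t (cF t) z + Gavg \<theta> t z\<bar>
      \<le> C1 * (1 + hnorm t z powr p) + C2 * (1 + hnorm t z powr p)"
      using C1(2)[OF z] C2(2)[OF z] by linarith
    also have "\<dots> \<le> (C1 + C2 + 1) * (1 + hnorm t z powr p)"
      by (simp add: algebra_simps)
    finally show "\<bar>avg \<theta> t (cF t) z + Gavg \<theta> t z\<bar>
      \<le> (C1 + C2 + 1) * (1 + hnorm t z powr p)" .
  qed (use C1 C2 in simp)
qed

end

theorem theorem4p5:
  fixes S :: "('d::finite, 'b::real_vector) problem"
  assumes "setting S"
    and "O1 S" and "O2 S" and "O3 S"
    and "K1 S" and "K2 S"
    and "P1 S" and "P2 S" and "P3 S"
  shows "\<exists>\<theta>. optimal_from S 0 \<theta> \<and>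
    (\<forall>t<horizon S.
      \<comment> \<open>(a)\<close>
      (cont_map (hist S t) (hist_dist S t) (Theta S (Suc t)) (dTheta S (Suc t))
         (\<lambda>(x, y). \<theta> (Suc t) x y) \<and>
       (\<forall>(x, y)\<in>hist S t. \<forall>\<eta>. DP_optimizer S \<theta> t x y \<eta> \<longrightarrow> \<eta> = \<theta> (Suc t) x y) \<and>
       (\<forall>\<theta>'. optimal_from S t \<theta>' \<longrightarrow>
          (\<forall>(x, y)\<in>hist S t. \<theta>' (Suc t) x y = \<theta> (Suc t) x y))) \<and>
      \<comment> \<open>(b)\<close>
      (cont_map (hist S t) (hist_dist S t)
         (tail_laws S t) (wasserstein (pexp S) (tail_dist S t))
         (\<lambda>(x, y). policy_kernel S \<theta> t x y) \<and>
       (\<forall>\<theta>'. optimal_from S t \<theta>' \<longrightarrow>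
          (\<forall>(x, y)\<in>hist S t. policy_kernel S \<theta>' t x y = policy_kernel S \<theta> t x y))) \<and>
      \<comment> \<open>(c)\<close>
      ((\<forall>(x, y)\<in>hist S t.
          value_fun S \<theta> t x y = (INF \<eta>\<in>D_corr S t x y. f_fun S \<theta> t x y \<eta>)) \<and>
       C_growth (pexp S) (hist S t) (hist_dist S t) (hist_ref S t)
         (\<lambda>(x, y). value_fun S \<theta> t x y)))"
proof -
  interpret dp_problem S using assms by unfold_locales
  obtain \<theta> where o: "optimal_from S 0 \<theta>" using optimal_policy_exists[of 0] by auto
  have ot: "optimal_from S t \<theta>" for t using o by (simp add: optimal_from_def)
  show ?thesis
  proof (intro exI[of _ \<theta>] conjI allI impI o)
    fix t assume t: "t < T"
    have g: "regular_from \<theta> t" "regular_from \<theta> (Suc t)" using optimal_imp_regular[OF ot] t by auto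
    interpret M: Metric_space "\<Theta> t" "d\<Theta> t" by (rule metric_Theta[OF t])
    show "cont_map (hist S t) (hist_dist S t) (\<Theta> t) (d\<Theta> t) (\<lambda>(x, y). \<theta> (Suc t) x y)"
      unfolding case_prod_unfold
      by (subst cont_map_hist) (use policy_in_Theta[OF ot t] policy_tendsto[OF t ot g(2)] in auto)
    show "\<forall>(x, y)\<in>hist S t. \<forall>\<eta>. DP_optimizer S \<theta> t x y \<eta> \<longrightarrow> \<eta> = \<theta> (Suc t) x y"
    proof (clarify)
      fix x y \<eta> assume xy: "(x, y) \<in> H t" and \<eta>: "DP_optimizer S \<theta> t x y \<eta>"
      have p: "optimizer \<theta> t (x, y) (pol \<theta> t (x, y))" by (rule optimal_from_optimizer[OF ot order_refl t xy])
      from \<eta> p have "\<eta> \<in> Dset t (x, y)" "obj \<theta> t (x, y) \<eta> \<le> obj \<theta> t (x, y) (pol \<theta> t (x, y))"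
        using optimizer_iff[of \<theta> t "(x, y)"] by auto
      then show "\<eta> = \<theta> (Suc t) x y"
        using optimizer_unique_le[OF t ot xy p] by simp
    qed
    show "\<forall>(x, y)\<in>hist S t. \<theta>' (Suc t) x y = \<theta> (Suc t) x y" if "optimal_from S t \<theta>'" for \<theta>'
      using optimal_policy_unique[OF ot that] t by (auto simp: case_prod_unfold)
    show "cont_map (hist S t) (hist_dist S t) (tail_laws S t) (wasserstein p (tail_dist S t)) (\<lambda>(x, y). policy_kernel S \<theta> t x y)"
      unfolding case_prod_unfold
      by (subst cont_map_hist) (use ker_in_tail_laws[OF g(1)] ker_tendsto[OF g(1)] t in \<open>auto simp: wasserstein_def\<close>)
    show "\<forall>(x, y)\<in>hist S t. policy_kernel S \<theta>' t x y = policy_kernel S \<theta> t x y" if "optimal_from S t \<theta>'" for \<theta>'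
      using optimal_policy_unique[OF ot that] t by (auto simp: case_prod_unfold)
    show "\<forall>(x, y)\<in>hist S t. value_fun S \<theta> t x y = (INF \<eta>\<in>D_corr S t x y. f_fun S \<theta> t x y \<eta>)"
      using value_fun_DP[OF t ot] by (auto simp: case_prod_unfold)
    show "C_growth p (hist S t) (hist_dist S t) (hist_ref S t) (\<lambda>(x, y). value_fun S \<theta> t x y)"
      using value_fun_growth[OF _ g(1)] t by (simp add: case_prod_unfold)
  qed
qed

end
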